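(* Let $S_{g,n}$, $\mathcal{T}=(V,E,F)$ be as in the context, and let $\hat k\in\mathbb{R}_{>0}^{|V^{\partial}|}$ and $\hat T\in\mathfrak{T}$. For any initial geodesic curvature $k(0)\in\mathbb{R}_{>0}^{|V^{\circ}|}$, the solution to the combinatorial Calabi flow $$\frac{dk}{dt}=-KM'(T-\hat T),\qquad k=k(t)\in\mathbb{R}_{>0}^{|V^{\circ}|},$$ exists for all time $t\in[0,+\infty)$ and is unique.
   Context: **Generalized circles.** In the hyperbolic plane $\mathbb{H}^2$ (curvature $-1$) a generalized circle is a circle, a horocycle or a hypercycle (a curve at constant distance from a geodesic, its axis). Its shape is determined by its constant geodesic curvature $k>0$: if $k>1$ it is a circle of radius $\operatorname{arccoth}k$; if $k=1$ a horocycle; if $0<k<1$ a hypercycle at distance $\operatorname{arctanh}k$ from its axis. Externally tangent means tangent with the convex sides (disk, horodisk, side containing the axis) having disjoint interiors. **Packing of one triangle.** For a triangle $f$ with vertices $v_1,v_2,v_3$ and $(k_1,k_2,k_3)\in\mathbb{R}_{>0}^3$, it is known that there is a configuration, determined by $(k_1,k_2,k_3)$ up to isometry, of three mutually externally tangent generalized circles $C_1,C_2,C_3$ in $\mathbb{H}^2$ with geodesic curvatures $k_1,k_2,k_3$, together with a hyperbolic circle $C_f$ (the dual circle) perpendicular to each $C_i$ and passing through all the tangent points. Let $l_i^f$ be the length of the sub-arc of $C_i$ contained in (inside) $C_f$, and $T_i^f=k_i\,l_i^f$ its total geodesic curvature. **Surface and triangulation.** $S_{g,n}$ is obtained by removing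 $n\ge 1$ topological open disks from an oriented compact surface of genus $g\ge 0$. $\mathcal{T}=(V,E,F)$ is a triangulation; $V_f$ is the set of three vertices of $f\in F$. $V^{\partial}$ and $V^{\circ}$ are the sets of boundary and interior vertices, each enumerated $1,2,\dots$. It is assumed that there are at least two boundary vertices and that each face has at most two boundary vertices. **Flow data.** Fix the curvatures $\hat k$ on $V^{\partial}$. For $k\in\mathbb{R}_{>0}^{|V^{\circ}|}$ on $V^{\circ}$, let $T=(T_1,\dots,T_{|V^{\circ}|})$ with $T_i=\sum_{f\in F,\,i\in V_f}T_i^f$, each $T_i^f$ computed from the curvatures ($k$ on interior, $\hat k$ on boundary vertices) of the three vertices of $f$. With $s_i=\ln k_i$, $M=\big(\partial T_i/\partial s_j\big)_{1\le i,j\le|V^{\circ}|}$, $M'$ is its transpose, and $K=\operatorname{diag}(k_1,\dots,k_{|V^{\circ}|})$. For $I\subset V^{\circ}$, $F_I=\{f\in F\mid \exists v\in I,\ v\in V_f\}$, and $\mathfrak{T}=\{(T_1,\ldots,T_{|V^{\circ}|})\in\mathbb{R}^{|V^{\circ}|}_{>0}\mid \sum_{v\in I}T_v<\pi|F_I|\ \forall\,\emptyset\ne I\subset V^{\circ}\}$. *)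

theory Defs
  imports "HOL-Analysis.Analysis" "HOL-Homology.Homology"
begin

section \<open>Generalized circles in the hyperbolic plane\<close>

text \<open>The hyperbolic plane of curvature \<open>-1\<close> is taken in its hyperboloid model: the sheet
  \<open>x\<^sub>3 > 0\<close> of \<open>\<langle>x,x\<rangle> = -1\<close> for the Lorentz form of \<open>\<real>\<^sup>3\<close>. The form restricts to the Riemannian
  metric on tangent vectors of the sheet.\<close>

definition lorentz :: "real^3 \<Rightarrow> real^3 \<Rightarrow> real" where
  "lorentz x y = x$1 * y$1 + x$2 * y$2 - x$3 * y$3"

definition hyp_plane :: "(real^3) set" where
  "hyp_plane = {x. lorentz x x = -1 \<and> x$3 > 0}"

definition hyp_dist :: "real^3 \<Rightarrow> real^3 \<Rightarrow> real" where
  "hyp_dist x y = arcosh (- lorentz x y)"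

text \<open>The geodesic with unit normal \<open>n\<close>, where \<open>\<langle>n,n\<rangle> = 1\<close>.\<close>

definition geodesic :: "real^3 \<Rightarrow> (real^3) set" where
  "geodesic n = {y \<in> hyp_plane. lorentz y n = 0}"

definition geodesic_dist :: "real^3 \<Rightarrow> real^3 \<Rightarrow> real" where
  "geodesic_dist n x = (INF y\<in>geodesic n. hyp_dist x y)"

text \<open>\<open>Circle p r\<close> has centre \<open>p\<close> and radius \<open>r\<close>. A horocycle is given by a future light-like
  vector \<open>v\<close>, which determines both its ideal point and its size. \<open>Hypercycle n d\<close> is the curve at
  distance \<open>d\<close> from the geodesic with unit normal \<open>n\<close>, on the side into which \<open>n\<close> points.\<close>

datatype gen_circle =
    Circle "real^3" real
  | Horocycle "real^3"
  | Hypercycle "real^3" real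

fun gen_circle_ok :: "gen_circle \<Rightarrow> bool" where
  "gen_circle_ok (Circle p r) \<longleftrightarrow> p \<in> hyp_plane \<and> r > 0"
| "gen_circle_ok (Horocycle v) \<longleftrightarrow> lorentz v v = 0 \<and> v$3 > 0"
| "gen_circle_ok (Hypercycle n d) \<longleftrightarrow> lorentz n n = 1 \<and> d > 0"

text \<open>Geodesic curvature: \<open>coth r\<close>, \<open>1\<close> and \<open>tanh d\<close>, respectively.\<close>

fun geod_curvature :: "gen_circle \<Rightarrow> real" where
  "geod_curvature (Circle p r) = 1 / tanh r"
| "geod_curvature (Horocycle v) = 1"
| "geod_curvature (Hypercycle n d) = tanh d"

fun curve :: "gen_circle \<Rightarrow> (real^3) set" where
  "curve (Circle p r) = {x \<in> hyp_plane. hyp_dist p x = r}"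
| "curve (Horocycle v) = {x \<in> hyp_plane. lorentz x v = -1}"
| "curve (Hypercycle n d) = {x \<in> hyp_plane. lorentz x n > 0 \<and> geodesic_dist n x = d}"

text \<open>The closed convex side: disk, horodisk, side containing the axis.\<close>

fun convex_side :: "gen_circle \<Rightarrow> (real^3) set" where
  "convex_side (Circle p r) = {x \<in> hyp_plane. hyp_dist p x \<le> r}"
| "convex_side (Horocycle v) = {x \<in> hyp_plane. lorentz x v \<ge> -1}"
| "convex_side (Hypercycle n d) = {x \<in> hyp_plane. lorentz x n \<le> 0 \<or> geodesic_dist n x \<le> d}"

text \<open>Velocities at \<open>x\<close> of paths running in \<open>A\<close>; for a smooth curve \<open>A\<close> this is its tangent line.\<close>

definition tangent_vectors :: "(real^3) set \<Rightarrow> real^3 \<Rightarrow> (real^3) set" where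
  "tangent_vectors A x =
     {v. \<exists>\<gamma>::real \<Rightarrow> real^3. \<gamma> 0 = x \<and> (\<forall>t. \<gamma> t \<in> A) \<and> (\<gamma> has_vector_derivative v) (at 0)}"

definition tangent_at :: "(real^3) set \<Rightarrow> (real^3) set \<Rightarrow> real^3 \<Rightarrow> bool" where
  "tangent_at A B x \<longleftrightarrow> x \<in> A \<and> x \<in> B \<and> tangent_vectors A x = tangent_vectors B x"

definition externally_tangent :: "gen_circle \<Rightarrow> gen_circle \<Rightarrow> bool" where
  "externally_tangent C D \<longleftrightarrow>
     (\<exists>x. tangent_at (curve C) (curve D) x) \<and>
     (top_of_set hyp_plane interior_of convex_side C) \<inter>
       (top_of_set hyp_plane interior_of convex_side D) = {}"

definition perpendicular :: "(real^3) set \<Rightarrow> (real^3) set \<Rightarrow> bool" where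
  "perpendicular A B \<longleftrightarrow> A \<inter> B \<noteq> {} \<and>
     (\<forall>x\<in>A \<inter> B. \<forall>a\<in>tangent_vectors A x. \<forall>b\<in>tangent_vectors B x. lorentz a b = 0)"

text \<open>\<open>l\<close> is the hyperbolic length of the simple arc \<open>A\<close>: there is an injective parametrization of
  \<open>A\<close> by \<open>[0,l]\<close> with unit speed.\<close>

definition has_arc_length :: "(real^3) set \<Rightarrow> real \<Rightarrow> bool" where
  "has_arc_length A l \<longleftrightarrow> l \<ge> 0 \<and>
     (\<exists>\<gamma>. inj_on \<gamma> {0..l} \<and> \<gamma> ` {0..l} = A \<and>
       (\<forall>t\<in>{0..l}. \<exists>v. (\<gamma> has_vector_derivative v) (at t within {0..l}) \<and> lorentz v v = 1))"

text \<open>For the three-element vertex set \<open>W\<close> of a triangle: the generalized circles \<open>C v\<close>, for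
  \<open>v \<in> W\<close>, have curvatures \<open>k v\<close> and are mutually externally tangent, and the circle with centre \<open>p\<close>
  and radius \<open>r\<close> is their dual circle.\<close>

definition triangle_packing ::
  "'v set \<Rightarrow> ('v \<Rightarrow> real) \<Rightarrow> ('v \<Rightarrow> gen_circle) \<Rightarrow> real^3 \<Rightarrow> real \<Rightarrow> bool" where
  "triangle_packing W k C p r \<longleftrightarrow>
     (\<forall>v\<in>W. gen_circle_ok (C v) \<and> geod_curvature (C v) = k v) \<and>
     (\<forall>u\<in>W. \<forall>v\<in>W. u \<noteq> v \<longrightarrow> externally_tangent (C u) (C v)) \<and>
     gen_circle_ok (Circle p r) \<and>
     (\<forall>v\<in>W. perpendicular (curve (Circle p r)) (curve (C v))) \<and>
     (\<forall>u\<in>W. \<forall>v\<in>W. \<forall>x. u \<noteq> v \<longrightarrow> tangent_at (curve (C u)) (curve (C v)) x \<longrightarrow>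
        x \<in> curve (Circle p r))"

text \<open>The total geodesic curvature, at the vertex \<open>i\<close> of the triangle with vertex set \<open>W\<close>. The
  description is proper for \<open>card W = 3\<close>, \<open>i \<in> W\<close> and \<open>k > 0\<close> on \<open>W\<close>, since the packing exists and is
  unique up to isometry.\<close>

definition triangle_total_curvature :: "'v set \<Rightarrow> ('v \<Rightarrow> real) \<Rightarrow> 'v \<Rightarrow> real" where
  "triangle_total_curvature W k i =
     (THE T. \<exists>C p r l. triangle_packing W k C p r \<and>
        has_arc_length (curve (C i) \<inter> convex_side (Circle p r)) l \<and> T = k i * l)"


section \<open>Surfaces with boundary and their triangulations\<close>

definition closed_surface :: "'a topology \<Rightarrow> bool" where
  "closed_surface X \<longleftrightarrow> topspace X \<noteq> {} \<and> compact_space X \<and> connected_space X \<and> Hausdorff_space X \<and>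
     (\<forall>x\<in>topspace X. \<exists>U. openin X U \<and> x \<in> U \<and>
        subtopology X U homeomorphic_space (euclidean :: (real^2) topology))"

text \<open>Among closed surfaces, the orientable ones are those with a fundamental class, i.e. with
  \<open>H\<^sub>2 \<cong> \<int>\<close>, and the genus is half the rank of \<open>H\<^sub>1\<close>.\<close>

definition orientable_surface_of_genus :: "nat \<Rightarrow> 'a topology \<Rightarrow> bool" where
  "orientable_surface_of_genus g X \<longleftrightarrow> closed_surface X \<and>
     homology_group 2 X \<cong> integer_group \<and>
     homology_group 1 X \<cong> free_Abelian_group {..<2 * g}"

text \<open>\<open>S\<close> is a surface of genus \<open>g\<close> minus the interiors of \<open>n\<close> disjoint embedded closed disks, and
  \<open>B\<close> is the union of the boundary circles. Removing open disks whose closures meet, or are not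
  closed disks, would not leave a surface with \<open>n\<close> boundary components.\<close>

definition surface_with_holes :: "nat \<Rightarrow> nat \<Rightarrow> 'a topology \<Rightarrow> 'a set \<Rightarrow> bool" where
  "surface_with_holes g n S B \<longleftrightarrow>
     (\<exists>X (e :: nat \<Rightarrow> real^2 \<Rightarrow> 'a). orientable_surface_of_genus g X \<and>
        (\<forall>i<n. embedding_map (top_of_set (cball 0 1)) X (e i)) \<and>
        (\<forall>i<n. \<forall>j<n. i \<noteq> j \<longrightarrow> e i ` cball 0 1 \<inter> e j ` cball 0 1 = {}) \<and>
        S = subtopology X (topspace X - (\<Union>i<n. e i ` ball 0 1)) \<and>
        B = (\<Union>i<n. e i ` sphere 0 1))"

definition edge_in :: "'a topology \<Rightarrow> 'a set \<Rightarrow> 'a set \<Rightarrow> bool" where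
  "edge_in S V e \<longleftrightarrow>
     (\<exists>\<gamma>::real \<Rightarrow> 'a. embedding_map (top_of_set {0..1}) S \<gamma> \<and> e = \<gamma> ` {0..1} \<and> e \<inter> V = {\<gamma> 0, \<gamma> 1})"

text \<open>A face is an embedded closed triangle whose corners are the vertices, and whose sides are the
  edges, that it contains.\<close>

definition face_in :: "'a topology \<Rightarrow> 'a set \<Rightarrow> 'a set set \<Rightarrow> 'a set \<Rightarrow> bool" where
  "face_in S V E f \<longleftrightarrow>
     (\<exists>(\<phi> :: real^2 \<Rightarrow> 'a) a b c. \<not> collinear {a, b, c} \<and>
        embedding_map (top_of_set (convex hull {a, b, c})) S \<phi> \<and>
        f = \<phi> ` (convex hull {a, b, c}) \<and>
        f \<inter> V = {\<phi> a, \<phi> b, \<phi> c} \<and>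
        {e \<in> E. e \<subseteq> f} =
          {\<phi> ` closed_segment a b, \<phi> ` closed_segment b c, \<phi> ` closed_segment c a})"

text \<open>Each face has three distinct vertices. Simplicial triangulations are included; more generally
  two faces may share several edges or have the same three vertices. Edges and faces are
  closed cells, so that \<open>f \<inter> V\<close> is the vertex set of a face \<open>f\<close>.\<close>

definition surface_triangulation :: "'a topology \<Rightarrow> 'a set \<Rightarrow> 'a set set \<Rightarrow> 'a set set \<Rightarrow> bool" where
  "surface_triangulation S V E F \<longleftrightarrow>
     finite V \<and> finite E \<and> finite F \<and> V \<subseteq> topspace S \<and>
     (\<forall>e\<in>E. edge_in S V e) \<and>
     (\<forall>f\<in>F. face_in S V E f) \<and>
     (\<forall>e\<in>E. \<forall>e'\<in>E. e \<noteq> e' \<longrightarrow> e \<inter> e' \<subseteq> V) \<and>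
     (\<forall>f\<in>F. \<forall>f'\<in>F. f \<noteq> f' \<longrightarrow> f \<inter> f' \<subseteq> V \<union> \<Union>E) \<and>
     \<Union>F = topspace S"


section \<open>The combinatorial Calabi flow\<close>

definition total_curvature :: "'a set \<Rightarrow> 'a set set \<Rightarrow> ('a \<Rightarrow> real) \<Rightarrow> 'a \<Rightarrow> real" where
  "total_curvature V F k i = (\<Sum>f\<in>{f \<in> F. i \<in> f \<inter> V}. triangle_total_curvature (f \<inter> V) k i)"

text \<open>Throughout, \<open>B\<close> is the boundary of the surface, so \<open>V \<inter> B\<close> and \<open>V - B\<close> are the boundary and
  the interior vertices. Functions of interior vertices are only looked at on \<open>V - B\<close>.\<close>

definition interior_total_curvature ::
  "'a set \<Rightarrow> 'a set set \<Rightarrow> 'a set \<Rightarrow> ('a \<Rightarrow> real) \<Rightarrow> ('a \<Rightarrow> real) \<Rightarrow> 'a \<Rightarrow> real" where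
  "interior_total_curvature V F B khat k i =
     total_curvature V F (\<lambda>v. if v \<in> B then khat v else k v) i"

text \<open>\<open>\<partial>T\<^sub>i/\<partial>s\<^sub>j\<close>, where \<open>s\<^sub>j = ln k\<^sub>j\<close>.\<close>

definition curvature_jacobian ::
  "'a set \<Rightarrow> 'a set set \<Rightarrow> 'a set \<Rightarrow> ('a \<Rightarrow> real) \<Rightarrow> ('a \<Rightarrow> real) \<Rightarrow> 'a \<Rightarrow> 'a \<Rightarrow> real" where
  "curvature_jacobian V F B khat k i j =
     deriv (\<lambda>s. interior_total_curvature V F B khat (k(j := exp s)) i) (ln (k j))"

definition admissible_curvatures :: "'a set \<Rightarrow> 'a set set \<Rightarrow> 'a set \<Rightarrow> ('a \<Rightarrow> real) set" where
  "admissible_curvatures V F B =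
     {T. (\<forall>i\<in>V - B. T i > 0) \<and>
         (\<forall>I. I \<noteq> {} \<and> I \<subseteq> V - B \<longrightarrow>
            (\<Sum>v\<in>I. T v) < pi * real (card {f \<in> F. \<exists>v\<in>I. v \<in> f \<inter> V}))}"

text \<open>\<open>k\<close> is a positive solution on the time interval \<open>J\<close>; the transposed Jacobian shows in the
  order of the indices.\<close>

definition calabi_flow_on ::
  "'a set \<Rightarrow> 'a set set \<Rightarrow> 'a set \<Rightarrow> ('a \<Rightarrow> real) \<Rightarrow> ('a \<Rightarrow> real) \<Rightarrow> real set \<Rightarrow>
    (real \<Rightarrow> 'a \<Rightarrow> real) \<Rightarrow> bool" where
  "calabi_flow_on V F B khat That J k \<longleftrightarrow>
     (\<forall>t\<in>J. \<forall>i\<in>V - B. k t i > 0 \<and>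
        ((\<lambda>t. k t i) has_real_derivative
           - k t i * (\<Sum>j\<in>V - B. curvature_jacobian V F B khat (k t) j i *
               (interior_total_curvature V F B khat (k t) j - That j)))
          (at t within J))"

end

theory Submission
  imports Defs
begin

text \<open>The flow is written in the logarithmic coordinates \<open>s = ln k\<close>, where it reads
  \<open>ds/dt = - M' (T - That)\<close>. The point is that this field is globally Lipschitz on the whole space of
  the \<open>s\<close>. Picard iteration (\<open>global_solution_exists\<close>) then gives a solution for all times, Gronwall's
  argument (\<open>solutions_unique\<close>) its uniqueness, and \<open>k = exp s\<close> stays positive.

  To see this, one needs the total curvatures in closed form. In the hyperboloid model, a generalized
  circle of curvature \<open>k\<close> of any kind is the section by a plane \<open>\<langle>x,N\<rangle> = -k\<close>, with a normal that satisfies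
  \<open>\<langle>N,N\<rangle> = 1 - k\<^sup>2\<close> (\<open>gen_circle_as_cycle\<close>). External tangency of two of them means
  \<open>\<langle>N,M\<rangle> = - 1 - k m\<close>, and perpendicularity to the dual circle with centre \<open>p\<close> and radius \<open>r\<close> means
  \<open>\<langle>p,N\<rangle> = - k cosh r\<close>. The projections of the three normals to the plane orthogonal to \<open>p\<close> are linearly
  dependent, and the vanishing of their Gram determinant says that
  \<open>(sinh r)\<^sup>2 (k\<^sub>1 k\<^sub>2 + k\<^sub>1 k\<^sub>3 + k\<^sub>2 k\<^sub>3) = 1\<close> (\<open>dual_circle_radius\<close>). The arc inside the dual circle has a
  rational parametrization by \<open>[0, tanh r]\<close> of speed \<open>2 / (1 + (k\<^sup>2 - 1) Y\<^sup>2)\<close>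
  (\<open>arc_inside_dual_circle\<close>). Hence the total curvature \<open>T\<^sub>i\<close> in a triangle is \<open>2 k\<^sub>i\<close> times the integral
  of \<open>1 / (1 + (k\<^sub>i\<^sup>2 - 1) Y\<^sup>2)\<close> over \<open>[0, tanh r]\<close> (\<open>triangle_total_curvature_eq\<close>). An explicit choice of
  normals shows that a packing exists (\<open>packing_exists\<close>), so that the definite description of the total
  curvature denotes this number.

  Put \<open>e\<^sup>2\<^sup>\<sigma> = k\<^sub>1 k\<^sub>2 + k\<^sub>1 k\<^sub>3 + k\<^sub>2 k\<^sub>3\<close>. After a substitution, \<open>T\<^sub>i\<close> is the integral over \<open>[\<sigma>, \<infinity>)\<close> of the function
  \<open>\<tau> \<mapsto> 1 / (cosh (\<tau> - s\<^sub>i) sqrt (1 + exp (- 2 \<tau>)))\<close>. This explains why everything is bounded and Lipschitz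
  uniformly in \<open>s\<close>: the integrand is at most \<open>1 / cosh (\<tau> - s\<^sub>i)\<close>, whose total integral is \<open>\<pi>\<close>; its
  value at \<open>\<sigma>\<close> is the derivative with respect to \<open>- \<sigma>\<close>; and \<open>\<sigma>\<close> itself is a Lipschitz function of the
  logarithmic curvatures (\<open>log_scale_lipschitz\<close>), and so are its partial derivatives. In the derivative
  with respect to \<open>s\<^sub>i\<close>, an integration by parts shifts the differentiation to the factor with the square
  root, which is increasing with values between \<open>0\<close> and \<open>1\<close>; what remains of the integral varies with
  \<open>s\<^sub>i\<close> and \<open>\<sigma>\<close> in a Lipschitz way (\<open>arc_tail_lipschitz\<close>). As the product of two
  bounded Lipschitz functions is again one, so are the entries of \<open>M\<close> and the components of
  \<open>M' (T - That)\<close> (\<open>interior_total_curvature_partials\<close>).\<close>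

section \<open>Lorentz geometry and curves of constant geodesic curvature\<close>

lemma lorentz_sym: "lorentz x y = lorentz y x"
  by (simp add: lorentz_def mult.commute)

lemma lorentz_linear [simp]:
  "lorentz (x + y) z = lorentz x z + lorentz y z"
  "lorentz z (x + y) = lorentz z x + lorentz z y"
  "lorentz (x - y) z = lorentz x z - lorentz y z"
  "lorentz z (x - y) = lorentz z x - lorentz z y"
  "lorentz (- x) z = - lorentz x z"
  "lorentz z (- x) = - lorentz z x"
  "lorentz (c *\<^sub>R x) z = c * lorentz x z"
  "lorentz z (c *\<^sub>R x) = c * lorentz z x"
  "lorentz 0 z = 0" "lorentz z 0 = 0"
  by (simp_all add: lorentz_def algebra_simps)

lemma bounded_bilinear_lorentz: "bounded_bilinear lorentz"
proof -
  have "lorentz = (\<lambda>x y. x \<bullet> y - 2 * (x$3 * y$3))"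
    by (intro ext) (simp add: lorentz_def inner_vec_def sum_3)
  moreover have "bounded_bilinear (\<lambda>x y :: real^3. x \<bullet> y - 2 * (x$3 * y$3))"
  proof
    show "\<exists>K. \<forall>a b :: real^3. norm (a \<bullet> b - 2 * (a$3 * b$3)) \<le> norm a * norm b * K"
    proof (intro exI allI)
      fix a b :: "real^3"
      have "\<bar>a \<bullet> b\<bar> \<le> norm a * norm b" by (rule Cauchy_Schwarz_ineq2)
      moreover have "\<bar>a$3 * b$3\<bar> \<le> norm a * norm b"
        by (simp add: abs_mult mult_mono component_le_norm_cart)
      ultimately show "norm (a \<bullet> b - 2 * (a$3 * b$3)) \<le> norm a * norm b * 3"
        by (simp add: abs_le_iff)
    qed
  qed (simp_all add: algebra_simps)
  ultimately show ?thesis by simp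
qed

lemmas lorentz_has_derivative = bounded_bilinear.has_vector_derivative [OF bounded_bilinear_lorentz]
lemmas continuous_on_lorentz [continuous_intros] = bounded_bilinear.continuous_on [OF bounded_bilinear_lorentz]

lemma hyp_planeD:
  assumes "x \<in> hyp_plane"
  shows "lorentz x x = -1" "x$3 > 0" "(x$3)\<^sup>2 = 1 + (x$1)\<^sup>2 + (x$2)\<^sup>2"
  using assms by (auto simp: hyp_plane_def lorentz_def power2_eq_square)

text \<open>With \<open>x\<^sub>3\<close> and \<open>y\<^sub>3\<close> written as square roots, the claim is the ordinary Cauchy-Schwarz inequality in the
  plane: \<open>(x\<^sub>3 y\<^sub>3)\<^sup>2\<close> exceeds \<open>(1 + x\<^sub>1 y\<^sub>1 + x\<^sub>2 y\<^sub>2)\<^sup>2\<close> by the sum of squares \<open>d\<close> of the proof, which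
  vanishes only for \<open>x = y\<close>.\<close>

lemma reverse_Cauchy_Schwarz:
  assumes x: "x \<in> hyp_plane" and y: "y \<in> hyp_plane"
  shows "lorentz x y \<le> -1" and "lorentz x y = -1 \<longleftrightarrow> x = y"
proof -
  note X = hyp_planeD[OF x] and Y = hyp_planeD[OF y]
  define a where "a = 1 + x$1 * y$1 + x$2 * y$2"
  define d where "d = (x$1 - y$1)\<^sup>2 + (x$2 - y$2)\<^sup>2 + (x$1 * y$2 - x$2 * y$1)\<^sup>2"
  have sq: "(x$3 * y$3)\<^sup>2 = a\<^sup>2 + d"
    unfolding power_mult_distrib X(3) Y(3) by (simp add: a_def d_def power2_eq_square algebra_simps)
  have d: "d \<ge> 0" by (simp add: d_def)
  have pos: "x$3 * y$3 > 0" using X Y by simp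
  have "a \<le> x$3 * y$3"
  proof (rule power2_le_imp_le)
    show "a\<^sup>2 \<le> (x$3 * y$3)\<^sup>2" unfolding sq using d by linarith
    show "0 \<le> x$3 * y$3" using pos by linarith
  qed
  then show le: "lorentz x y \<le> -1" by (simp add: lorentz_def a_def)
  show "lorentz x y = -1 \<longleftrightarrow> x = y"
  proof
    assume "lorentz x y = -1"
    then have "x$3 * y$3 = a" by (simp add: lorentz_def a_def)
    with sq have "d = 0" by simp
    then have "x$1 = y$1" "x$2 = y$2"
      using zero_le_power2[of "x$1 - y$1"] zero_le_power2[of "x$2 - y$2"]
        zero_le_power2[of "x$1 * y$2 - x$2 * y$1"]
      by (auto simp: d_def add_nonneg_eq_0_iff)
    moreover from this have "x$3 = y$3" using X Y by (simp add: power2_eq_imp_eq)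
    ultimately show "x = y" by (simp add: vec_eq_iff forall_3)
  qed (use X in simp)
qed

text \<open>Of the two sheets of \<open>\<langle>z,z\<rangle> = -1\<close>, only the upper one has negative products with points of the upper
  sheet. This replaces an inspection of the third coordinate.\<close>

lemma hyp_planeI:
  assumes "lorentz z z = -1" and x: "x \<in> hyp_plane" and "lorentz z x < 0"
  shows "z \<in> hyp_plane"
proof (rule ccontr)
  assume "z \<notin> hyp_plane"
  moreover have "z$3 \<noteq> 0"
  proof
    assume "z$3 = 0"
    then have "lorentz z z \<ge> 0" by (simp add: lorentz_def)
    with assms show False by simp
  qed
  ultimately have "- z \<in> hyp_plane" using assms by (auto simp: hyp_plane_def)
  from reverse_Cauchy_Schwarz(1)[OF this x] assms(3) show False by simp
qed

text \<open>The cross product of the Lorentz form: the Euclidean cross product followed by a reflection in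
  the third coordinate.\<close>

definition lcross :: "real^3 \<Rightarrow> real^3 \<Rightarrow> real^3" where
  "lcross a b = vector [a$2 * b$3 - a$3 * b$2, a$3 * b$1 - a$1 * b$3, a$2 * b$1 - a$1 * b$2]"

lemma lcross_orthogonal [simp]:
  "lorentz (lcross a b) a = 0" "lorentz (lcross a b) b = 0"
  "lorentz a (lcross a b) = 0" "lorentz b (lcross a b) = 0"
  by (simp_all add: lorentz_def lcross_def algebra_simps)

lemma lorentz_lcross:
  "lorentz (lcross a b) (lcross c d) = lorentz a d * lorentz b c - lorentz a c * lorentz b d"
  by (simp add: lorentz_def lcross_def algebra_simps)

text \<open>The vectors orthogonal to two independent vectors \<open>a\<close>, \<open>b\<close> are the multiples of \<open>lcross a b\<close>. Cleared
  of denominators, this is a polynomial identity.\<close>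

lemma lcross_eqI:
  assumes "lorentz v a = 0" "lorentz v b = 0"
  shows "lorentz (lcross a b) (lcross a b) *\<^sub>R v = lorentz v (lcross a b) *\<^sub>R lcross a b"
proof -
  have "lorentz (lcross a b) (lcross a b) *\<^sub>R v - lorentz v (lcross a b) *\<^sub>R lcross a b =
    lorentz v a *\<^sub>R (lorentz a b *\<^sub>R b - lorentz b b *\<^sub>R a)
    + lorentz v b *\<^sub>R (lorentz a b *\<^sub>R a - lorentz a a *\<^sub>R b)"
    by (simp add: vec_eq_iff forall_3 lorentz_def lcross_def algebra_simps)
  then show ?thesis using assms by simp
qed

text \<open>The section of the hyperboloid by an affine plane, normalized so that the three kinds of
  generalized circles are treated alike: if \<open>\<langle>N,N\<rangle> = 1 - k\<^sup>2\<close>, then \<open>cycle_curve N k\<close> has geodesic curvature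
  \<open>k\<close>, and it is a circle, a horocycle or a hypercycle as \<open>N\<close> is time-like, light-like or space-like.\<close>

definition cycle_curve :: "real^3 \<Rightarrow> real \<Rightarrow> (real^3) set" where
  "cycle_curve N k = {x \<in> hyp_plane. lorentz x N = - k}"

definition cycle_disk :: "real^3 \<Rightarrow> real \<Rightarrow> (real^3) set" where
  "cycle_disk N k = {x \<in> hyp_plane. lorentz x N \<ge> - k}"

definition unit_tangent :: "real^3 \<Rightarrow> real^3 \<Rightarrow> real^3 \<Rightarrow> bool" where
  "unit_tangent N x e \<longleftrightarrow> lorentz e x = 0 \<and> lorentz e N = 0 \<and> lorentz e e = 1"

text \<open>The Gram determinant of \<open>x\<close> and \<open>N\<close> equals \<open>- (1 - k\<^sup>2) - k\<^sup>2 = -1\<close>, so \<open>lcross x N\<close> is a unit vector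
  whatever the kind of the curve.\<close>

lemma unit_tangent_lcross:
  assumes "x \<in> cycle_curve N k" and "lorentz N N = 1 - k\<^sup>2"
  shows "unit_tangent N x (lcross x N)"
proof -
  have "lorentz (lcross x N) (lcross x N) = (lorentz x N)\<^sup>2 - lorentz x x * lorentz N N"
    by (simp add: lorentz_lcross lorentz_sym[of N x] power2_eq_square)
  then show ?thesis
    using assms by (simp add: unit_tangent_def cycle_curve_def hyp_plane_def)
qed

lemma orthogonal_eq_multiple_tangent:
  assumes x: "x \<in> cycle_curve N k" and N: "lorentz N N = 1 - k\<^sup>2" and e: "unit_tangent N x e"
    and v: "lorentz v x = 0" "lorentz v N = 0"
  shows "v = lorentz v e *\<^sub>R e"
proof -
  let ?E = "lcross x N"
  have E: "lorentz ?E ?E = 1" using unit_tangent_lcross[OF x N] by (simp add: unit_tangent_def)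
  have *: "w = lorentz w ?E *\<^sub>R ?E" if "lorentz w x = 0" "lorentz w N = 0" for w
    using lcross_eqI[OF that] E by simp
  define c d where "c = lorentz v ?E" and "d = lorentz e ?E"
  have v': "v = c *\<^sub>R ?E" unfolding c_def by (rule *) (rule v)+
  have e': "e = d *\<^sub>R ?E" unfolding d_def by (rule *) (use e in \<open>auto simp: unit_tangent_def\<close>)
  have "d * d = 1" using e E unfolding unit_tangent_def by (subst (asm) (3 4) e') simp
  then have "(c * d * d) *\<^sub>R ?E = c *\<^sub>R ?E" by (simp add: mult.assoc)
  then show ?thesis unfolding v' e' using E by (simp add: mult_ac)
qed

text \<open>A curve of constant curvature \<open>k\<close> satisfies \<open>\<gamma>'' = w\<close> at \<open>x\<close>, with \<open>w = (1 - k\<^sup>2) x + k N\<close>, and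
  \<open>\<gamma>''' = (1 - k\<^sup>2) \<gamma>'\<close>. Its solution involves trigonometric, polynomial or hyperbolic functions of the arc
  length as \<open>k\<close> is greater than, equal to or less than \<open>1\<close>. The tangent \<open>Y\<close> of half the (possibly
  hyperbolic) angle, suitably scaled, gives one rational parametrization for all three.\<close>

definition cycle_point :: "real^3 \<Rightarrow> real \<Rightarrow> real^3 \<Rightarrow> real^3 \<Rightarrow> real \<Rightarrow> real^3" where
  "cycle_point N k x e Y = x + (2 / (1 - (1 - k\<^sup>2) * Y\<^sup>2)) *\<^sub>R
     (Y\<^sup>2 *\<^sub>R ((1 - k\<^sup>2) *\<^sub>R x + k *\<^sub>R N) + Y *\<^sub>R e)"

text \<open>The denominator is \<open>(1 - Y\<^sup>2) + k\<^sup>2 Y\<^sup>2\<close>, so that all \<open>Y\<close> in the unit interval are legal parameters for every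
  \<open>k\<close>. All arcs below use only such parameters.\<close>

lemma cycle_speed_pos:
  fixes k Y :: real
  assumes "\<bar>Y\<bar> \<le> 1" "k > 0"
  shows "1 - (1 - k\<^sup>2) * Y\<^sup>2 > 0"
proof -
  have *: "1 - (1 - k\<^sup>2) * Y\<^sup>2 = (1 - Y\<^sup>2) + k\<^sup>2 * Y\<^sup>2" by (simp add: algebra_simps)
  have "Y\<^sup>2 \<le> 1" using assms(1) by (simp add: abs_square_le_1)
  then show ?thesis unfolding *
    using assms(2) by (cases "Y = 0") (auto intro!: add_nonneg_pos)
qed

lemma cycle_point_in_curve:
  assumes x: "x \<in> cycle_curve N k" and N: "lorentz N N = 1 - k\<^sup>2" and e: "unit_tangent N x e"
    and D: "1 - (1 - k\<^sup>2) * Y\<^sup>2 > 0"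
  shows "cycle_point N k x e Y \<in> cycle_curve N k"
proof -
  define D w where "D = 1 - (1 - k\<^sup>2) * Y\<^sup>2" and "w = (1 - k\<^sup>2) *\<^sub>R x + k *\<^sub>R N"
  have D0: "D > 0" using D by (simp add: D_def)
  have g: "cycle_point N k x e Y = x + (2 / D) *\<^sub>R (Y\<^sup>2 *\<^sub>R w + Y *\<^sub>R e)" (is "?g = _")
    by (simp add: cycle_point_def D_def w_def)
  have xx: "lorentz x x = -1" "lorentz x N = -k" "x \<in> hyp_plane" "lorentz N x = - k"
    using x by (auto simp: cycle_curve_def hyp_plane_def lorentz_sym)
  have ee: "lorentz e e = 1" "lorentz e x = 0" "lorentz e N = 0" "lorentz x e = 0" "lorentz N e = 0"
    using e by (auto simp: unit_tangent_def lorentz_sym)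
  have w: "lorentz w N = 0" "lorentz w x = -1" "lorentz w w = k\<^sup>2 - 1" "lorentz w e = 0"
      "lorentz x w = -1" "lorentz e w = 0"
    by (simp_all add: w_def xx ee N) (simp_all add: power2_eq_square algebra_simps)
  have "lorentz ?g N = - k" by (simp add: g w xx ee)
  moreover have "lorentz ?g x = - 1 - 2 * Y\<^sup>2 / D" by (simp add: g w xx ee)
  then have "lorentz ?g x < 0" using D0 by (smt (verit) divide_nonneg_pos zero_le_power2)
  moreover have "lorentz ?g ?g = -1"
  proof -
    have "lorentz ?g ?g = -1 - 4 * Y\<^sup>2 / D + (4 / (D * D)) * (Y\<^sup>2 * (1 - (1 - k\<^sup>2) * Y\<^sup>2))"
      using D0 by (simp add: g w xx ee power2_eq_square field_simps)
    also have "\<dots> = -1" using D0 by (simp flip: D_def)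
    finally show ?thesis .
  qed
  ultimately show ?thesis using hyp_planeI[OF _ xx(3)] by (simp add: cycle_curve_def)
qed

lemma cycle_point_has_derivative:
  assumes "1 - (1 - k\<^sup>2) * Y\<^sup>2 \<noteq> 0"
  shows "(cycle_point N k x e has_vector_derivative
     (2 / (1 - (1 - k\<^sup>2) * Y\<^sup>2)\<^sup>2) *\<^sub>R ((2 * Y) *\<^sub>R ((1 - k\<^sup>2) *\<^sub>R x + k *\<^sub>R N) + (1 + (1 - k\<^sup>2) * Y\<^sup>2) *\<^sub>R e))
     (at Y within A)"
proof -
  define a w where "a = 1 - k\<^sup>2" and "w = (1 - k\<^sup>2) *\<^sub>R x + k *\<^sub>R N"
  have a: "1 - a * Y\<^sup>2 \<noteq> 0" using assms by (simp add: a_def)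
  have "cycle_point N k x e = (\<lambda>Y. x + ((2 * Y\<^sup>2 / (1 - a * Y\<^sup>2)) *\<^sub>R w + (2 * Y / (1 - a * Y\<^sup>2)) *\<^sub>R e))"
    by (rule ext) (simp add: cycle_point_def a_def w_def scaleR_add_right mult_ac)
  moreover have 1: "((\<lambda>Y. 2 * Y\<^sup>2 / (1 - a * Y\<^sup>2)) has_real_derivative 4 * Y / (1 - a * Y\<^sup>2)\<^sup>2) (at Y within A)"
    by (rule derivative_eq_intros refl a)+ (use a in \<open>simp add: field_simps power2_eq_square\<close>)
  moreover have 2: "((\<lambda>Y. 2 * Y / (1 - a * Y\<^sup>2)) has_real_derivative 2 * (1 + a * Y\<^sup>2) / (1 - a * Y\<^sup>2)\<^sup>2) (at Y within A)"
    by (rule derivative_eq_intros refl a)+ (use a in \<open>simp add: field_simps power2_eq_square\<close>)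
  note has_vector_derivative_add[OF has_vector_derivative_const[of x]
      has_vector_derivative_add[OF has_vector_derivative_scaleR[OF 1 has_vector_derivative_const[of w]]
        has_vector_derivative_scaleR[OF 2 has_vector_derivative_const[of e]]]]
  ultimately show ?thesis
    unfolding w_def[symmetric] unfolding a_def[symmetric] by (simp add: scaleR_add_right)
qed

text \<open>Differentiating the equations of the curve confines its velocities to a line. Conversely, a
  velocity \<open>c e\<close> is that of the path with parameter \<open>Y = sin (c t / 2)\<close>, which stays in the unit
  interval for all times.\<close>

lemma tangent_vectors_cycle:
  assumes x: "x \<in> cycle_curve N k" and N: "lorentz N N = 1 - k\<^sup>2" and k: "k > 0"
  shows "tangent_vectors (cycle_curve N k) x = {v. lorentz v x = 0 \<and> lorentz v N = 0}"
proof (intro Set.set_eqI iffI)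
  fix v assume "v \<in> tangent_vectors (cycle_curve N k) x"
  then obtain \<gamma> where g: "\<gamma> 0 = x" "\<And>t. \<gamma> t \<in> cycle_curve N k" "(\<gamma> has_vector_derivative v) (at 0)"
    by (auto simp: tangent_vectors_def)
  have "((\<lambda>t. lorentz (\<gamma> t) N) has_vector_derivative lorentz (\<gamma> 0) 0 + lorentz v N) (at 0)"
    by (rule lorentz_has_derivative g derivative_intros)+
  moreover have "(\<lambda>t. lorentz (\<gamma> t) N) = (\<lambda>t. - k)" using g(2) by (auto simp: cycle_curve_def)
  ultimately have 1: "lorentz v N = 0"
    using vector_derivative_unique_at[OF _ has_vector_derivative_const] by fastforce
  have "((\<lambda>t. lorentz (\<gamma> t) (\<gamma> t)) has_vector_derivative lorentz (\<gamma> 0) v + lorentz v (\<gamma> 0)) (at 0)"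
    by (rule lorentz_has_derivative g)+
  moreover have "(\<lambda>t. lorentz (\<gamma> t) (\<gamma> t)) = (\<lambda>t. - 1)"
    using g(2) by (auto simp: cycle_curve_def hyp_plane_def)
  ultimately have "lorentz (\<gamma> 0) v + lorentz v (\<gamma> 0) = 0"
    using vector_derivative_unique_at[OF _ has_vector_derivative_const] by fastforce
  then have "lorentz v x = 0" using g(1) lorentz_sym[of x v] by simp
  with 1 show "v \<in> {v. lorentz v x = 0 \<and> lorentz v N = 0}" by simp
next
  fix v assume v: "v \<in> {v. lorentz v x = 0 \<and> lorentz v N = 0}"
  define e where "e = lcross x N"
  have e: "unit_tangent N x e" unfolding e_def by (rule unit_tangent_lcross[OF x N])
  define c where "c = lorentz v e"
  have vc: "v = c *\<^sub>R e" unfolding c_def using orthogonal_eq_multiple_tangent[OF x N e] v by auto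
  let ?g = "\<lambda>t. cycle_point N k x e (sin (c * t / 2))"
  have "?g 0 = x" by (simp add: cycle_point_def)
  moreover have "?g t \<in> cycle_curve N k" for t
    by (intro cycle_point_in_curve[OF x N e] cycle_speed_pos k abs_sin_le_one)
  moreover have "(?g has_vector_derivative v) (at 0)"
  proof -
    have s: "((\<lambda>t. sin (c * t / 2)) has_vector_derivative c / 2) (at 0)"
      unfolding has_real_derivative_iff_has_vector_derivative[symmetric]
      by (auto intro!: derivative_eq_intros)
    have "(cycle_point N k x e has_vector_derivative 2 *\<^sub>R e) (at (sin (c * 0 / 2)))"
      using cycle_point_has_derivative[of k 0 N x e UNIV] by simp
    from vector_diff_chain_at[OF s this] show ?thesis by (simp add: o_def vc)
  qed
  ultimately show "v \<in> tangent_vectors (cycle_curve N k) x"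
    unfolding tangent_vectors_def mem_Collect_eq by (intro exI[of _ ?g]) simp
qed

section \<open>Tangency and perpendicularity\<close>

lemma cycle_curveD:
  assumes "x \<in> cycle_curve N k"
  shows "x \<in> hyp_plane" "lorentz x x = -1" "lorentz x N = - k" "lorentz N x = - k"
  using assms by (auto simp: cycle_curve_def hyp_plane_def lorentz_sym[of N x])

text \<open>The vector \<open>N - k x\<close> is the unit normal of the curve at \<open>x\<close> that points into the convex side.\<close>

lemma inner_normal:
  assumes "x \<in> cycle_curve N k" and "lorentz N N = 1 - k\<^sup>2"
  shows "lorentz (N - k *\<^sub>R x) x = 0" "lorentz x (N - k *\<^sub>R x) = 0"
    "lorentz (N - k *\<^sub>R x) (N - k *\<^sub>R x) = 1" "lorentz (N - k *\<^sub>R x) N = 1"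
    "lorentz N (N - k *\<^sub>R x) = 1"
  using assms by (simp_all add: cycle_curveD power2_eq_square algebra_simps)

text \<open>A common tangent line at \<open>x\<close> determines the unit normals of both curves up to sign.\<close>

lemma tangent_at_cycles_normals:
  assumes t: "tangent_at (cycle_curve N k) (cycle_curve M m) x"
    and N: "lorentz N N = 1 - k\<^sup>2" "k > 0" and M: "lorentz M M = 1 - m\<^sup>2" "m > 0"
  shows "N - k *\<^sub>R x = M - m *\<^sub>R x \<or> N - k *\<^sub>R x = - (M - m *\<^sub>R x)"
proof -
  have x: "x \<in> cycle_curve N k" "x \<in> cycle_curve M m" using t by (auto simp: tangent_at_def)
  define e where "e = lcross x N"
  have e: "unit_tangent N x e" unfolding e_def by (rule unit_tangent_lcross[OF x(1) N(1)])
  have "lorentz e M = 0"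
  proof -
    have "e \<in> tangent_vectors (cycle_curve N k) x"
      using e by (simp add: tangent_vectors_cycle[OF x(1) N] unit_tangent_def)
    then have "e \<in> tangent_vectors (cycle_curve M m) x" using t by (simp add: tangent_at_def)
    then show ?thesis by (simp add: tangent_vectors_cycle[OF x(2) M])
  qed
  then have M0: "lorentz M e = 0" by (simp add: lorentz_sym)
  have e0: "lorentz N e = 0" "lorentz e x = 0" "lorentz e e = 1" "lorentz x e = 0"
    using e by (auto simp: unit_tangent_def lorentz_sym)
  let ?E = "lcross x e"
  have E: "lorentz ?E ?E = 1" using x e0 by (simp add: lorentz_lcross cycle_curveD)
  have *: "\<exists>c. v = c *\<^sub>R ?E" if "lorentz v x = 0" "lorentz v e = 0" for v
    using lcross_eqI[OF that] E by auto
  obtain c where c: "N - k *\<^sub>R x = c *\<^sub>R ?E"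
    using *[of "N - k *\<^sub>R x"] inner_normal(1)[OF x(1) N(1)] by (auto simp: e0)
  obtain d where d: "M - m *\<^sub>R x = d *\<^sub>R ?E"
    using *[of "M - m *\<^sub>R x"] inner_normal(1)[OF x(2) M(1)] by (auto simp: e0 M0)
  have "c * c = 1" using inner_normal(3)[OF x(1) N(1)] E by (simp add: c)
  moreover have "d * d = 1" using inner_normal(3)[OF x(2) M(1)] E by (simp add: d)
  ultimately have "c = d \<or> c = - d" by (metis square_eq_iff)
  then show ?thesis unfolding c d by auto
qed

definition normal_point :: "real^3 \<Rightarrow> real^3 \<Rightarrow> real \<Rightarrow> real^3" where
  "normal_point x \<nu> t = (1 / (1 - t\<^sup>2)) *\<^sub>R ((1 + t\<^sup>2) *\<^sub>R x + (2 * t) *\<^sub>R \<nu>)"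

lemma normal_point:
  assumes x: "x \<in> cycle_curve N k" and N: "lorentz N N = 1 - k\<^sup>2" and t: "\<bar>t\<bar> < 1"
  shows "normal_point x (N - k *\<^sub>R x) t \<in> hyp_plane"
    and "lorentz (normal_point x (N - k *\<^sub>R x) t) N = - k + 2 * t * (1 - t * k) / (1 - t\<^sup>2)"
proof -
  note n = inner_normal[OF x N] and xx = cycle_curveD[OF x]
  define \<nu> where "\<nu> = N - k *\<^sub>R x"
  note n = n[folded \<nu>_def]
  have t1: "1 - t\<^sup>2 > 0" using t by (simp add: abs_square_less_1)
  have "lorentz (normal_point x \<nu> t) (normal_point x \<nu> t) =
      (4 * t\<^sup>2 - (1 + t\<^sup>2)\<^sup>2) / (1 - t\<^sup>2)\<^sup>2"
    unfolding normal_point_def lorentz_linear n xx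
    using t1 by (simp add: power2_eq_square divide_simps) (simp add: algebra_simps)
  also have "4 * t\<^sup>2 - (1 + t\<^sup>2)\<^sup>2 = - (1 - t\<^sup>2)\<^sup>2"
    by (simp add: power2_eq_square algebra_simps)
  finally have "lorentz (normal_point x \<nu> t) (normal_point x \<nu> t) = -1" using t1 by simp
  moreover
  have "lorentz (normal_point x \<nu> t) x < 0"
  proof -
    have "lorentz (normal_point x \<nu> t) x = - (1 + t\<^sup>2) / (1 - t\<^sup>2)"
      by (simp add: normal_point_def n xx)
    moreover have "1 + t\<^sup>2 > 0" by (simp add: add_pos_nonneg)
    ultimately show ?thesis using t1 by (simp add: divide_neg_pos)
  qed
  ultimately show "normal_point x (N - k *\<^sub>R x) t \<in> hyp_plane"
    unfolding \<nu>_def[symmetric] by (intro hyp_planeI[OF _ xx(1)])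
  show "lorentz (normal_point x (N - k *\<^sub>R x) t) N = - k + 2 * t * (1 - t * k) / (1 - t\<^sup>2)"
    unfolding \<nu>_def[symmetric] normal_point_def lorentz_linear n xx
    using t1 by (simp add: divide_simps) (simp add: power2_eq_square algebra_simps)
qed

lemma open_disk_subset_interior:
  "{y \<in> hyp_plane. lorentz y N > - k} \<subseteq> top_of_set hyp_plane interior_of cycle_disk N k"
proof (rule interior_of_maximal)
  show "{y \<in> hyp_plane. lorentz y N > - k} \<subseteq> cycle_disk N k" by (auto simp: cycle_disk_def)
  have "continuous_on hyp_plane (\<lambda>y. lorentz y N)" by (intro continuous_intros)
  from continuous_openin_preimage_gen[OF this open_greaterThan[of "-k"]]
  show "openin (top_of_set hyp_plane) {y \<in> hyp_plane. lorentz y N > - k}"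
    by (simp add: vimage_def Int_def)
qed

text \<open>Internal tangency: a short step along the common inner normal enters both convex sides.\<close>

lemma interiors_meet_if_normals_agree:
  assumes x: "x \<in> cycle_curve N k" "x \<in> cycle_curve M m"
    and N: "lorentz N N = 1 - k\<^sup>2" "k > 0" and M: "lorentz M M = 1 - m\<^sup>2" "m > 0"
    and eq: "N - k *\<^sub>R x = M - m *\<^sub>R x"
  shows "(top_of_set hyp_plane interior_of cycle_disk N k) \<inter>
    (top_of_set hyp_plane interior_of cycle_disk M m) \<noteq> {}"
proof -
  \<comment> \<open>small enough for \<open>t k\<close> and \<open>t m\<close> to be less than \<open>1\<close>\<close>
  define t where "t = 1 / (1 + k + m)"
  have t: "0 < t" "\<bar>t\<bar> < 1" "t * k < 1" "t * m < 1" using N M by (auto simp: t_def field_simps)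
  then have t2: "1 - t\<^sup>2 > 0" by (simp add: abs_square_less_1)
  let ?z = "normal_point x (N - k *\<^sub>R x) t"
  have "?z \<in> {y \<in> hyp_plane. lorentz y N > - k}"
    using t t2 normal_point[OF x(1) N(1) t(2)] by simp
  moreover have "?z \<in> {y \<in> hyp_plane. lorentz y M > - m}"
    using t t2 normal_point[OF x(2) M(1) t(2)] by (simp add: eq)
  ultimately show ?thesis using open_disk_subset_interior by blast
qed

text \<open>Every neighbourhood of \<open>x\<close> contains points of the geodesic normal to the curve that lie on the
  far side of it.\<close>

lemma boundary_not_in_interior:
  assumes x: "x \<in> cycle_curve N k" and N: "lorentz N N = 1 - k\<^sup>2" "k > 0"
  shows "x \<notin> top_of_set hyp_plane interior_of cycle_disk N k"
proof
  assume "x \<in> top_of_set hyp_plane interior_of cycle_disk N k"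
  then obtain U where U: "open U" "x \<in> U" "hyp_plane \<inter> U \<subseteq> cycle_disk N k"
    by (auto simp: interior_of_def openin_open)
  let ?z = "normal_point x (N - k *\<^sub>R x)"
  have "isCont ?z 0" unfolding normal_point_def by (intro continuous_intros) auto
  moreover have "?z 0 = x" by (simp add: normal_point_def)
  ultimately have "(?z \<longlongrightarrow> x) (at_left 0)"
    unfolding isCont_def by (auto intro: filterlim_at_within_If tendsto_mono[OF at_le])
  then have "eventually (\<lambda>t. ?z t \<in> U) (at_left 0)" using U(1,2) by (rule topological_tendstoD)
  moreover have "eventually (\<lambda>t::real. t > -1 \<and> t < 0) (at_left 0)"
    using eventually_at_left_real[of "-1" 0] by simp
  ultimately have "eventually (\<lambda>t. False) (at_left (0::real))"
  proof eventually_elim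
    case (elim t)
    then have t: "\<bar>t\<bar> < 1" by simp
    then have t2: "1 - t\<^sup>2 > 0" by (simp add: abs_square_less_1)
    have "t * k < 0" using elim N by (intro mult_neg_pos) auto
    then have "2 * t * (1 - t * k) < 0" using elim mult_neg_pos[of "2 * t" "1 - t * k"] by simp
    then have "2 * t * (1 - t * k) / (1 - t\<^sup>2) < 0" using t2 by (simp add: divide_neg_pos)
    then have "?z t \<notin> cycle_disk N k" using normal_point[OF x N(1) t] by (simp add: cycle_disk_def)
    moreover have "?z t \<in> cycle_disk N k" using normal_point(1)[OF x N(1) t] elim U by blast
    ultimately show False by simp
  qed
  then show False by simp
qed

text \<open>If the normals at \<open>x\<close> are opposite, then \<open>N + M = (k + m) x\<close>. Adding the inequalities of the two
  disks yields \<open>\<langle>y,x\<rangle> \<ge> -1\<close> for a common point \<open>y\<close>, and by the reverse Cauchy-Schwarz inequality \<open>y = x\<close>. So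
  the closed disks share only a boundary point.\<close>

lemma interiors_disjoint_if_normals_opposite:
  assumes x: "x \<in> cycle_curve N k" "x \<in> cycle_curve M m"
    and N: "lorentz N N = 1 - k\<^sup>2" "k > 0" and M: "m > 0"
    and eq: "N - k *\<^sub>R x = - (M - m *\<^sub>R x)"
  shows "(top_of_set hyp_plane interior_of cycle_disk N k) \<inter>
    (top_of_set hyp_plane interior_of cycle_disk M m) = {}"
proof (rule ccontr)
  assume "\<not> ?thesis"
  then have "\<exists>y. y \<in> top_of_set hyp_plane interior_of cycle_disk N k \<and>
    y \<in> top_of_set hyp_plane interior_of cycle_disk M m" by blast
  then obtain y where y: "y \<in> top_of_set hyp_plane interior_of cycle_disk N k"
    "y \<in> top_of_set hyp_plane interior_of cycle_disk M m" by blast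
  then have d: "y \<in> cycle_disk N k" "y \<in> cycle_disk M m"
    by (auto dest: subsetD[OF interior_of_subset])
  have "N + M = (k + m) *\<^sub>R x" using eq by (simp add: algebra_simps)
  then have "lorentz y N + lorentz y M = (k + m) * lorentz y x"
    by (metis lorentz_linear(2,8))
  then have "(k + m) * lorentz y x \<ge> (k + m) * (-1)" using d by (simp add: cycle_disk_def)
  then have "lorentz y x \<ge> -1" using N M by (simp only: mult_le_cancel_left_pos)
  moreover have yH: "y \<in> hyp_plane" using d by (simp add: cycle_disk_def)
  ultimately have "y = x"
    using reverse_Cauchy_Schwarz[OF yH cycle_curveD(1)[OF x(1)]] by (metis antisym)
  then show False using boundary_not_in_interior[OF x(1) N] y by simp
qed

lemma tangency_inner_product:
  assumes "x \<in> hyp_plane" and N: "lorentz N N = 1 - k\<^sup>2" and M: "lorentz M M = 1 - m\<^sup>2"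
    and eq: "N + M = (k + m) *\<^sub>R x"
  shows "lorentz N M = - 1 - k * m"
proof -
  have "lorentz (N + M) (N + M) = - (k + m)\<^sup>2" unfolding eq
    using assms(1) by (simp add: hyp_plane_def power2_eq_square algebra_simps)
  then show ?thesis using N M by (simp add: lorentz_sym[of M N] power2_eq_square algebra_simps)
qed

text \<open>For curves whose normals have the product of external tangency, internal tangency at \<open>x\<close> would
  give \<open>\<langle>N - M,N - M\<rangle>\<close> the two values \<open>- (k - m)\<^sup>2\<close> and \<open>4 - (k - m)\<^sup>2\<close>.\<close>

lemma tangent_point_cycles:
  assumes N: "lorentz N N = 1 - k\<^sup>2" "k > 0" and M: "lorentz M M = 1 - m\<^sup>2" "m > 0"
    and NM: "lorentz N M = - 1 - k * m" and t: "tangent_at (cycle_curve N k) (cycle_curve M m) x"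
  shows "N + M = (k + m) *\<^sub>R x"
proof -
  have x: "x \<in> cycle_curve N k" "x \<in> cycle_curve M m" using t by (auto simp: tangent_at_def)
  have False if "N - k *\<^sub>R x = M - m *\<^sub>R x"
  proof -
    have "N - M = (k - m) *\<^sub>R x" using that by (simp add: algebra_simps)
    then have "lorentz (N - M) (N - M) = lorentz ((k - m) *\<^sub>R x) ((k - m) *\<^sub>R x)" by simp
    also have "\<dots> = - (k - m)\<^sup>2" using x by (simp add: cycle_curveD power2_eq_square algebra_simps)
    finally have "lorentz (N - M) (N - M) = - (k - m)\<^sup>2" .
    then show False using N M NM by (simp add: lorentz_sym[of M N] power2_eq_square algebra_simps)
  qed
  with tangent_at_cycles_normals[OF t N M] have "N - k *\<^sub>R x = - (M - m *\<^sub>R x)" by blast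
  then show ?thesis by (simp add: algebra_simps)
qed

text \<open>The tangency point is \<open>N + M\<close>, normalized. The assumption on the third coordinates puts it on
  the upper sheet.\<close>

lemma tangent_at_cyclesI:
  assumes N: "lorentz N N = 1 - k\<^sup>2" "k > 0" and M: "lorentz M M = 1 - m\<^sup>2" "m > 0"
    and NM: "lorentz N M = - 1 - k * m" and pos: "N$3 + M$3 > 0"
    and x: "x = (1 / (k + m)) *\<^sub>R (N + M)"
  shows "tangent_at (cycle_curve N k) (cycle_curve M m) x"
    and "N - k *\<^sub>R x = - (M - m *\<^sub>R x)"
proof -
  have km: "k + m > 0" using N M by simp
  have MN: "lorentz M N = - 1 - k * m" using NM by (simp add: lorentz_sym)
  have "lorentz x x = (1 / (k + m)\<^sup>2) * (- (k + m)\<^sup>2)"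
    unfolding x lorentz_linear N M NM MN by (simp add: power2_eq_square divide_simps) (simp add: algebra_simps)
  then have "lorentz x x = -1" using km by simp
  moreover have "x$3 > 0" using pos km by (simp add: x)
  ultimately have xH: "x \<in> hyp_plane" by (simp add: hyp_plane_def)
  have "lorentz x N = (1 / (k + m)) * (lorentz N N + lorentz M N)" by (simp add: x)
  also have "lorentz N N + lorentz M N = - k * (k + m)"
    unfolding N MN by (simp add: power2_eq_square algebra_simps)
  finally have "lorentz x N = - k" using km by simp
  with xH have xN: "x \<in> cycle_curve N k" by (simp add: cycle_curve_def)
  have "lorentz x M = (1 / (k + m)) * (lorentz N M + lorentz M M)" by (simp add: x)
  also have "lorentz N M + lorentz M M = - m * (k + m)"
    unfolding M NM by (simp add: power2_eq_square algebra_simps)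
  finally have "lorentz x M = - m" using km by simp
  with xH have xM: "x \<in> cycle_curve M m" by (simp add: cycle_curve_def)
  have "(k + m) *\<^sub>R x = N + M" using km by (simp add: x)
  then have Meq: "M = (k + m) *\<^sub>R x - N" by simp
  then show "N - k *\<^sub>R x = - (M - m *\<^sub>R x)" by (simp add: algebra_simps)
  have "lorentz v M = - lorentz v N" if "lorentz v x = 0" for v
    using that by (simp add: Meq)
  then show "tangent_at (cycle_curve N k) (cycle_curve M m) x"
    unfolding tangent_at_def tangent_vectors_cycle[OF xN N] tangent_vectors_cycle[OF xM M]
    using xN xM by auto
qed

lemma perpendicular_cyclesD:
  assumes "perpendicular (cycle_curve P K) (cycle_curve N k)"
    and P: "lorentz P P = 1 - K\<^sup>2" "K > 0" and N: "lorentz N N = 1 - k\<^sup>2" "k > 0"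
  shows "lorentz P N = - K * k"
proof -
  obtain x where x: "x \<in> cycle_curve P K" "x \<in> cycle_curve N k"
    using assms(1) by (auto simp: perpendicular_def)
  have "lcross x P \<in> tangent_vectors (cycle_curve P K) x"
    by (simp add: tangent_vectors_cycle[OF x(1) P])
  moreover have "lcross x N \<in> tangent_vectors (cycle_curve N k) x"
    by (simp add: tangent_vectors_cycle[OF x(2) N])
  ultimately have "lorentz (lcross x P) (lcross x N) = 0"
    using assms(1) x by (auto simp: perpendicular_def)
  then show ?thesis using cycle_curveD[OF x(1)] cycle_curveD[OF x(2)] by (simp add: lorentz_lcross algebra_simps)
qed

lemma perpendicular_cyclesI:
  assumes x0: "x0 \<in> cycle_curve P K" "x0 \<in> cycle_curve N k"
    and P: "lorentz P P = 1 - K\<^sup>2" "K > 0" and N: "lorentz N N = 1 - k\<^sup>2" "k > 0"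
    and PN: "lorentz P N = - K * k"
  shows "perpendicular (cycle_curve P K) (cycle_curve N k)"
  unfolding perpendicular_def
proof (intro conjI ballI)
  show "cycle_curve P K \<inter> cycle_curve N k \<noteq> {}" using x0 by auto
next
  fix x a b assume "x \<in> cycle_curve P K \<inter> cycle_curve N k"
    and a: "a \<in> tangent_vectors (cycle_curve P K) x" and b: "b \<in> tangent_vectors (cycle_curve N k) x"
  then have x: "x \<in> cycle_curve P K" "x \<in> cycle_curve N k" by auto
  have 0: "lorentz (lcross x P) (lcross x N) = 0"
    using cycle_curveD[OF x(1)] cycle_curveD[OF x(2)] PN by (simp add: lorentz_lcross)
  have "a = lorentz a (lcross x P) *\<^sub>R lcross x P"
    using a unfolding tangent_vectors_cycle[OF x(1) P]
    by (intro orthogonal_eq_multiple_tangent[OF x(1) P(1) unit_tangent_lcross[OF x(1) P(1)]]) auto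
  then obtain c where c: "a = c *\<^sub>R lcross x P" by blast
  have "b = lorentz b (lcross x N) *\<^sub>R lcross x N"
    using b unfolding tangent_vectors_cycle[OF x(2) N]
    by (intro orthogonal_eq_multiple_tangent[OF x(2) N(1) unit_tangent_lcross[OF x(2) N(1)]]) auto
  then obtain d where d: "b = d *\<^sub>R lcross x N" by blast
  show "lorentz a b = 0" unfolding c d lorentz_linear 0 by simp
qed

section \<open>Generalized circles as plane sections\<close>

text \<open>Split \<open>x = c f + h n\<close> with \<open>h = \<langle>x,n\<rangle>\<close> and \<open>c = sqrt (h\<^sup>2 + 1)\<close>. Then \<open>f\<close> lies on the geodesic, and for every
  \<open>y\<close> there \<open>- \<langle>x,y\<rangle> = - c \<langle>f,y\<rangle> \<ge> c = cosh (arsinh \<bar>h\<bar>)\<close>, with equality at the foot point \<open>f\<close>.\<close>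

lemma geodesic_dist_eq_arsinh:
  assumes n: "lorentz n n = 1" and x: "x \<in> hyp_plane"
  shows "geodesic_dist n x = arsinh \<bar>lorentz x n\<bar>"
proof -
  define h c where "h = lorentz x n" and "c = sqrt (h\<^sup>2 + 1)"
  have c1: "c \<ge> 1" by (simp add: c_def)
  have cc: "c * c = h * h + 1" unfolding c_def by (simp add: power2_eq_square)
  have xx: "lorentz x x = -1" using x by (simp add: hyp_plane_def)
  have nx: "lorentz n x = h" by (simp add: h_def lorentz_sym)
  define f where "f = (1 / c) *\<^sub>R (x - h *\<^sub>R n)"
  have "lorentz f f = (1 / (c * c)) * (- (h * h + 1))"
    by (simp add: f_def xx n nx flip: h_def)
  also have "\<dots> = -1" using c1 by (simp flip: cc)
  finally have ff: "lorentz f f = -1" .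
  have "lorentz f x = (1 / c) * (- (c * c))"
    unfolding cc by (simp add: f_def xx n nx flip: h_def)
  then have fx: "lorentz f x = - c" using c1 by simp
  have fH: "f \<in> hyp_plane" using hyp_planeI[OF ff x] fx c1 by simp
  have fn: "lorentz f n = 0" by (simp add: f_def n flip: h_def)
  have fg: "f \<in> geodesic n" using fH fn by (simp add: geodesic_def)
  have cosh: "cosh (arsinh \<bar>h\<bar>) = c" by (simp add: cosh_arsinh_real c_def)
  have dist_f: "hyp_dist x f = arsinh \<bar>h\<bar>"
    unfolding hyp_dist_def using fx by (simp add: lorentz_sym[of x f] flip: cosh)
       (rule arcosh_cosh_real, simp add: not_less[symmetric])
  have "arsinh \<bar>h\<bar> \<le> hyp_dist x y" if y: "y \<in> geodesic n" for y
  proof -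
    have yH: "y \<in> hyp_plane" and yn: "lorentz n y = 0"
      using y by (auto simp: geodesic_def lorentz_sym)
    have "x = c *\<^sub>R f + h *\<^sub>R n" using c1 by (simp add: f_def)
    then have "lorentz x y = c * lorentz f y" by (simp add: yn)
    moreover have "lorentz f y \<le> -1" by (rule reverse_Cauchy_Schwarz(1)[OF fH yH])
    ultimately have le: "c \<le> - lorentz x y" using c1 mult_left_mono[of 1 "- lorentz f y" c] by simp
    show ?thesis
    proof (rule ccontr)
      assume "\<not> ?thesis"
      then have "arcosh (- lorentz x y) < arsinh \<bar>h\<bar>" by (simp add: hyp_dist_def)
      moreover have "0 \<le> arcosh (- lorentz x y)" using le c1 by (intro arcosh_nonneg_real) simp
      ultimately have "cosh (arcosh (- lorentz x y)) < cosh (arsinh \<bar>h\<bar>)"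
        by (intro cosh_real_strict_mono)
      then show False using le c1 by (simp add: cosh)
    qed
  qed
  then have "geodesic_dist n x = arsinh \<bar>h\<bar>"
    unfolding geodesic_dist_def
    by (intro antisym cINF_greatest cINF_lower2[OF _ fg])
       (use fg dist_f in \<open>auto intro!: bdd_belowI[where m = "arsinh \<bar>h\<bar>"]\<close>)
  then show ?thesis by (simp add: h_def)
qed

text \<open>The scaling turns the equation of the curve into \<open>\<langle>x,N\<rangle> = -k\<close> with \<open>\<langle>N,N\<rangle> = 1 - k\<^sup>2\<close>. The sign in the last
  case makes the convex side of a hypercycle the one with larger \<open>\<langle>x,N\<rangle>\<close>, as for the other curves.\<close>

fun normal_vector :: "gen_circle \<Rightarrow> real^3" where
  "normal_vector (Circle p r) = (1 / sinh r) *\<^sub>R p"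
| "normal_vector (Horocycle v) = v"
| "normal_vector (Hypercycle n d) = (- 1 / cosh d) *\<^sub>R n"

lemma hyp_dist_le_iff:
  assumes "p \<in> hyp_plane" "x \<in> hyp_plane" "r > 0"
  shows "hyp_dist p x \<le> r \<longleftrightarrow> - lorentz x p \<le> cosh r"
    and "hyp_dist p x = r \<longleftrightarrow> - lorentz x p = cosh r"
proof -
  define d where "d = hyp_dist p x"
  have *: "- lorentz x p \<ge> 1" using reverse_Cauchy_Schwarz(1)[OF assms(2,1)] by simp
  have d: "d \<ge> 0" "cosh d = - lorentz x p"
    using * by (simp_all add: d_def hyp_dist_def lorentz_sym[of p x])
  show "hyp_dist p x \<le> r \<longleftrightarrow> - lorentz x p \<le> cosh r"
    unfolding d_def[symmetric] d(2)[symmetric]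
    using d(1) assms(3) cosh_real_nonneg_le_iff[of d r] by simp
  show "hyp_dist p x = r \<longleftrightarrow> - lorentz x p = cosh r"
    unfolding d_def[symmetric] d(2)[symmetric]
    using d(1) assms(3) cosh_real_nonneg_le_iff[of d r] cosh_real_nonneg_le_iff[of r d] by auto
qed

text \<open>From here on, the kind of a generalized circle does not matter.\<close>

lemma gen_circle_as_cycle:
  assumes "gen_circle_ok C"
  defines "N \<equiv> normal_vector C" and "k \<equiv> geod_curvature C"
  shows "lorentz N N = 1 - k\<^sup>2" and "k > 0"
    and "curve C = cycle_curve N k" and "convex_side C = cycle_disk N k"
proof -
  have "lorentz N N = 1 - k\<^sup>2 \<and> 0 < k \<and> curve C = cycle_curve N k \<and> convex_side C = cycle_disk N k"
  proof (cases C)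
  case (Circle p r)
  then have p: "p \<in> hyp_plane" and r: "r > 0" using assms by auto
  have s: "sinh r > 0" "cosh r > 0" using r by auto
  have N: "N = (1 / sinh r) *\<^sub>R p" and k: "k = cosh r / sinh r"
    using Circle by (simp_all add: N_def k_def tanh_def)
  have "lorentz N N = - 1 / (sinh r)\<^sup>2" using p by (simp add: N hyp_plane_def power2_eq_square)
  also have "\<dots> = 1 - k\<^sup>2"
    using s cosh_square_eq[of r] by (simp add: k power_divide field_simps)
  finally have 1: "lorentz N N = 1 - k\<^sup>2" .
  have le: "(- (cosh r / sinh r) \<le> lorentz x p / sinh r) = (- lorentz x p \<le> cosh r)"
    and eq: "(lorentz x p / sinh r = - (cosh r / sinh r)) = (- lorentz x p = cosh r)" for x
    using s by (auto simp: field_simps)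
  show ?thesis
  proof (intro conjI 1)
    show "0 < k" using s by (simp add: k)
    show "curve C = cycle_curve N k"
      using hyp_dist_le_iff(2)[OF p _ r] eq by (auto simp: Circle cycle_curve_def N k)
    show "convex_side C = cycle_disk N k"
      using hyp_dist_le_iff(1)[OF p _ r] le by (auto simp: Circle cycle_disk_def N k)
  qed
next
  case (Horocycle v)
  then show ?thesis
    using assms by (auto simp: N_def k_def cycle_curve_def cycle_disk_def)
next
  case (Hypercycle n d)
  then have n: "lorentz n n = 1" and d: "d > 0" using assms by auto
  have s: "sinh d > 0" "cosh d > 0" using d by auto
  have N: "N = (- 1 / cosh d) *\<^sub>R n" and k: "k = sinh d / cosh d"
    using Hypercycle by (simp_all add: N_def k_def tanh_def)
  have "lorentz N N = 1 / (cosh d)\<^sup>2" using n by (simp add: N power2_eq_square)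
  also have "\<dots> = ((cosh d)\<^sup>2 - (sinh d)\<^sup>2) / (cosh d)\<^sup>2"
    using cosh_square_eq[of d] by simp
  also have "\<dots> = 1 - k\<^sup>2" using s by (simp add: k power_divide diff_divide_distrib)
  finally have 1: "lorentz N N = 1 - k\<^sup>2" .
  have le: "(lorentz x n / cosh d \<le> sinh d / cosh d) = (lorentz x n \<le> sinh d)"
    and eq: "(lorentz x n / cosh d = sinh d / cosh d) = (lorentz x n = sinh d)" for x
    using s by (auto simp: field_simps)
  have ar: "(arsinh y \<le> d) = (y \<le> sinh d)" "(arsinh y = d) = (y = sinh d)" for y
  proof -
    have "sinh (arsinh y) = y" by simp
    then show "(arsinh y \<le> d) = (y \<le> sinh d)" "(arsinh y = d) = (y = sinh d)"
      by (metis sinh_real_le_iff) (metis arsinh_sinh_real sinh_arsinh_real)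
  qed
  show ?thesis
  proof (intro conjI 1)
    show "0 < k" using s by (simp add: k)
    show "curve C = cycle_curve N k"
      using s by (auto simp: Hypercycle cycle_curve_def N k geodesic_dist_eq_arsinh[OF n] ar eq)
    show "convex_side C = cycle_disk N k"
      by (auto simp: Hypercycle cycle_disk_def N k geodesic_dist_eq_arsinh[OF n] ar le
          intro: order_trans[OF _ less_imp_le[OF s(1)]])
  qed
qed
  then show "lorentz N N = 1 - k\<^sup>2" "k > 0" "curve C = cycle_curve N k" "convex_side C = cycle_disk N k"
    by simp_all
qed

lemma gen_circle_with_normal:
  assumes N: "lorentz N N = 1 - k\<^sup>2" and k: "k > 0" and pos: "N$3 > 0"
  shows "\<exists>C. gen_circle_ok C \<and> geod_curvature C = k \<and> normal_vector C = N"
proof (cases k "1::real" rule: linorder_cases)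
  case greater
  define s r where "s = sqrt (k\<^sup>2 - 1)" and "r = arsinh (1 / s)"
  have k2: "k\<^sup>2 > 1" using greater by (simp add: one_less_power)
  then have s: "s > 0" "s\<^sup>2 = k\<^sup>2 - 1" by (simp_all add: s_def)
  have r: "r > 0" "sinh r = 1 / s" using s by (simp_all add: r_def)
  have "(cosh r)\<^sup>2 = (k / s)\<^sup>2"
    using s(1) k2 unfolding cosh_square_eq r(2) power_divide s(2) by (simp add: field_simps)
  then have c: "cosh r = k / s" using s k by (simp add: power2_eq_iff_nonneg)
  have "gen_circle_ok (Circle ((1 / s) *\<^sub>R N) r)"
    using N s pos r k2 by (simp add: hyp_plane_def divide_simps) (simp add: power2_eq_square)
  moreover have "geod_curvature (Circle ((1 / s) *\<^sub>R N) r) = k"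
    using s by (simp add: tanh_def r(2) c)
  moreover have "normal_vector (Circle ((1 / s) *\<^sub>R N) r) = N" using s by (simp add: r(2))
  ultimately show ?thesis by blast
next
  case equal
  then show ?thesis using N pos by (intro exI[of _ "Horocycle N"]) simp
next
  case less
  define s d where "s = sqrt (1 - k\<^sup>2)" and "d = arsinh (k / s)"
  have k2: "k\<^sup>2 < 1" using less k by (simp add: power_less_one_iff)
  then have s: "s > 0" "s\<^sup>2 = 1 - k\<^sup>2" by (simp_all add: s_def)
  have d: "d > 0" "sinh d = k / s" using s k by (simp_all add: d_def)
  have "(cosh d)\<^sup>2 = (1 / s)\<^sup>2"
    using s(1) k2 unfolding cosh_square_eq d(2) power_divide s(2) by (simp add: field_simps)
  then have c: "cosh d = 1 / s" using s by (simp add: power2_eq_iff_nonneg)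
  have "gen_circle_ok (Hypercycle ((- 1 / s) *\<^sub>R N) d)"
    using N s d k2 by (simp add: power2_eq_square)
  moreover have "geod_curvature (Hypercycle ((- 1 / s) *\<^sub>R N) d) = k"
    using s by (simp add: tanh_def d(2) c)
  moreover have "normal_vector (Hypercycle ((- 1 / s) *\<^sub>R N) d) = N" using s by (simp add: c)
  ultimately show ?thesis by blast
qed

section \<open>Lengths of arcs\<close>

text \<open>The length of the arc of \<open>cycle_point\<close> with parameters in \<open>[0,u]\<close>.\<close>

definition arc_integral :: "real \<Rightarrow> real \<Rightarrow> real" where
  "arc_integral k u = integral {0..u} (\<lambda>x. 2 / (1 + (k\<^sup>2 - 1) * x\<^sup>2))"

lemma cycle_density_pos:
  fixes k x :: real
  assumes "k > 0" "0 \<le> x" "x \<le> 1"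
  shows "1 + (k\<^sup>2 - 1) * x\<^sup>2 > 0"
  using cycle_speed_pos[of x k] assms by (simp add: algebra_simps)

lemma arc_integral_has_derivative:
  assumes k: "k > 0" and v: "v \<le> 1" and x: "x \<in> {0..v}"
  shows "(arc_integral k has_real_derivative 2 / (1 + (k\<^sup>2 - 1) * x\<^sup>2)) (at x within {0..v})"
proof -
  have "continuous_on {0..v} (\<lambda>x. 2 / (1 + (k\<^sup>2 - 1) * x\<^sup>2))"
    using cycle_density_pos[OF k] v by (intro continuous_intros) force
  from integral_has_real_derivative[OF this x]
  show ?thesis unfolding arc_integral_def .
qed

text \<open>An arc has only one length. If \<open>c\<close> parametrizes it with speed \<open>s\<close>, and \<open>\<phi>\<close> is a differentiable inverse
  of \<open>c\<close>, then for any other unit-speed injective parametrization \<open>\<gamma>\<close> the function \<open>F \<circ> \<phi> \<circ> \<gamma>\<close>, where \<open>F\<close> is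
  the primitive of \<open>s\<close>, has derivative \<open>1\<close> or \<open>-1\<close> everywhere. It is also monotone, being continuous and
  injective. So its domain and its range \<open>[0, F u]\<close> have the same length.\<close>

lemma has_arc_length_by_speed:
  fixes c :: "real \<Rightarrow> real^3" and \<phi> :: "real^3 \<Rightarrow> real" and F s :: "real \<Rightarrow> real"
  assumes u: "u > 0"
    and F: "\<And>x. x \<in> {0..u} \<Longrightarrow> (F has_real_derivative s x) (at x within {0..u})"
    and F0: "F 0 = 0" and s: "\<And>x. x \<in> {0..u} \<Longrightarrow> s x > 0"
    and c: "\<And>x. x \<in> {0..u} \<Longrightarrow> (c has_vector_derivative c' x) (at x within {0..u})"
    and speed: "\<And>x. x \<in> {0..u} \<Longrightarrow> lorentz (c' x) (c' x) = (s x)\<^sup>2"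
    and inv: "\<And>x. x \<in> {0..u} \<Longrightarrow> \<phi> (c x) = x"
    and diff: "\<And>z. z \<in> c ` {0..u} \<Longrightarrow> \<phi> differentiable (at z)"
  shows "has_arc_length (c ` {0..u}) l \<longleftrightarrow> l = F u"
proof -
  have contF: "continuous_on {0..u} F"
    unfolding continuous_on_eq_continuous_within using F DERIV_continuous by blast
  have mono: "F x < F y" if "0 \<le> x" "x < y" "y \<le> u" for x y
  proof (rule DERIV_pos_imp_increasing_open[OF that(2)])
    show "continuous_on {x..y} F" using contF that by (auto intro: continuous_on_subset)
    fix t assume t: "x < t" "t < y"
    then have "t \<in> {0<..<u}" using that by auto
    moreover from this have "(F has_real_derivative s t) (at t within {0<..<u})"
      using F[of t] by (auto intro: DERIV_subset)
    ultimately show "\<exists>D. (F has_real_derivative D) (at t) \<and> 0 < D"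
      using s[of t] at_within_open[of t "{0<..<u}"] by auto
  qed
  have inj: "inj_on F {0..u}"
    by (rule inj_onI) (metis atLeastAtMost_iff linorder_neqE_linordered_idom mono order_less_irrefl)
  have img: "F ` {0..u} = {0..F u}"
  proof
    show "F ` {0..u} \<subseteq> {0..F u}"
    proof (intro image_subsetI)
      fix x assume "x \<in> {0..u}"
      then show "F x \<in> {0..F u}" using mono[of 0 x] mono[of x u] F0 by (auto simp: le_less)
    qed
    show "{0..F u} \<subseteq> F ` {0..u}"
      using IVT'[of F 0 _ u] contF F0 u by (force simp: image_iff)
  qed
  \<comment> \<open>reparametrization by arc length\<close>
  define G where "G = inv_into {0..u} F"
  have GF: "G (F x) = x" if "x \<in> {0..u}" for x using that inj by (simp add: G_def)
  have FG: "F (G t) = t" "G t \<in> {0..u}" if "t \<in> {0..F u}" for t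
    using that unfolding G_def img[symmetric] by (rule f_inv_into_f, rule inv_into_into)
  have Fu: "F u \<ge> 0" using mono[of 0 u] F0 u by simp
  have contG: "continuous_on {0..F u} G"
    unfolding img[symmetric] by (rule continuous_on_inv[OF contF]) (use GF in auto)
  have dG: "(G has_real_derivative inverse (s (G t))) (at t within {0..F u})" if t: "t \<in> {0..F u}" for t
  proof -
    have "(G has_derivative (\<lambda>x. inverse (s (G t)) * x)) (at (F (G t)) within F ` {0..u})"
    proof (rule has_derivative_inverse_within[where f' = "\<lambda>x. s (G t) * x" and S = "{0..u}"])
      show "(F has_derivative (*) (s (G t))) (at (G t) within {0..u})"
        using F[OF FG(2)[OF t]] by (simp add: has_field_derivative_def)
      show "linear ((*) (inverse (s (G t))))" by (intro bounded_linear.linear bounded_linear_mult_right)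
      show "(*) (inverse (s (G t))) \<circ> (*) (s (G t)) = id"
        using s[OF FG(2)[OF t]] by (auto simp: fun_eq_iff)
      show "continuous (at (F (G t)) within F ` {0..u}) G"
        using contG t by (simp add: img FG continuous_on_eq_continuous_within)
    qed (use FG[OF t] GF in auto)
    then show ?thesis by (simp add: img FG[OF t] has_field_derivative_def)
  qed
  show ?thesis
  proof
    assume l: "l = F u"
    have cG: "((c \<circ> G) has_vector_derivative inverse (s (G t)) *\<^sub>R c' (G t)) (at t within {0..F u})"
      if t: "t \<in> {0..F u}" for t
    proof (rule vector_diff_chain_within)
      show "(G has_vector_derivative inverse (s (G t))) (at t within {0..F u})"
        using dG[OF t] by (simp add: has_real_derivative_iff_has_vector_derivative)
      have "G ` {0..F u} \<subseteq> {0..u}" using FG by auto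
      then show "(c has_vector_derivative c' (G t)) (at (G t) within G ` {0..F u})"
        using c[OF FG(2)[OF t]] has_vector_derivative_within_subset by blast
    qed
    have "inj_on (c \<circ> G) {0..F u}"
      by (rule inj_onI) (metis FG inv comp_apply)
    moreover have "G ` {0..F u} = {0..u}"
      unfolding img[symmetric] image_comp using GF by (simp add: image_cong[of _ _ "G \<circ> F" id])
    then have "(c \<circ> G) ` {0..F u} = c ` {0..u}" by (metis image_comp)
    moreover have "\<exists>v. ((c \<circ> G) has_vector_derivative v) (at t within {0..F u}) \<and> lorentz v v = 1"
      if t: "t \<in> {0..F u}" for t
      using cG[OF t] speed[OF FG(2)[OF t]] s[OF FG(2)[OF t]]
      by (intro exI conjI) (assumption, simp add: power2_eq_square field_simps)
    ultimately show "has_arc_length (c ` {0..u}) l"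
      unfolding has_arc_length_def l using Fu by blast
  next
    assume "has_arc_length (c ` {0..u}) l"
    then obtain \<gamma> where l: "l \<ge> 0" and inj: "inj_on \<gamma> {0..l}" and im: "\<gamma> ` {0..l} = c ` {0..u}"
      and g: "\<And>t. t \<in> {0..l} \<Longrightarrow> \<exists>v. (\<gamma> has_vector_derivative v) (at t within {0..l}) \<and> lorentz v v = 1"
      unfolding has_arc_length_def by blast
    \<comment> \<open>the given parametrization in the parameter of \<open>c\<close>\<close>
    define q where "q = \<phi> \<circ> \<gamma>"
    have gq: "c (q t) = \<gamma> t" "q t \<in> {0..u}" if "t \<in> {0..l}" for t
    proof -
      have "\<gamma> t \<in> c ` {0..u}" unfolding im[symmetric] using that by (rule imageI)
      then obtain x where x: "x \<in> {0..u}" "\<gamma> t = c x" by blast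
      have "q t = x" by (simp add: q_def x(2) inv[OF x(1)])
      then show "c (q t) = \<gamma> t" "q t \<in> {0..u}" using x by simp_all
    qed
    have qimg: "q ` {0..l} = {0..u}"
    proof -
      have "q ` {0..l} = \<phi> ` c ` {0..u}" unfolding q_def im[symmetric] by (simp add: image_comp)
      also have "\<dots> = {0..u}" using inv by (simp add: image_comp)
      finally show ?thesis .
    qed
    have l0: "l > 0"
    proof (rule ccontr)
      assume "\<not> l > 0"
      then have "{0..u} = {q 0}" using l qimg by simp
      moreover have "0 \<in> {0..u}" "u \<in> {0..u}" using u by auto
      ultimately show False using u by auto
    qed
    have dh: "\<exists>y. \<bar>y\<bar> = 1 \<and> ((F \<circ> q) has_vector_derivative y) (at t within {0..l})"
      if t: "t \<in> {0..l}" for t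
    proof -
      obtain v where v: "(\<gamma> has_vector_derivative v) (at t within {0..l})" "lorentz v v = 1"
        using g[OF t] by blast
      obtain \<phi>' where "(\<phi> has_derivative \<phi>') (at (\<gamma> t))"
        using diff[of "\<gamma> t"] im t unfolding differentiable_def by blast
      then have "(\<phi> has_derivative \<phi>') (at (\<gamma> t) within \<gamma> ` {0..l})"
        by (rule has_derivative_at_withinI)
      from vector_derivative_diff_chain_within[OF v(1) this]
      obtain d where d: "(q has_vector_derivative d) (at t within {0..l})" unfolding q_def by blast
      have "((c \<circ> q) has_vector_derivative d *\<^sub>R c' (q t)) (at t within {0..l})"
        using c[OF gq(2)[OF t]] by (intro vector_diff_chain_within d) (simp add: qimg)
      then have v': "(\<gamma> has_vector_derivative d *\<^sub>R c' (q t)) (at t within {0..l})"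
        by (rule has_vector_derivative_transform[rotated 2]) (use t gq in auto)
      have "v = d *\<^sub>R c' (q t)"
        using vector_derivative_unique_within_closed_interval[of 0 l t \<gamma>] l0 t v(1) v' by (simp add: box_real)
      then have "(d * s (q t))\<^sup>2 = 1"
        using v(2) speed[OF gq(2)[OF t]] by (simp add: power2_eq_square mult_ac)
      then have "\<bar>d * s (q t)\<bar> = 1" by (simp add: power2_eq_1_iff abs_if) (auto simp: algebra_simps)
      moreover have "((F \<circ> q) has_vector_derivative d *\<^sub>R s (q t)) (at t within {0..l})"
        using F[OF gq(2)[OF t]]
        by (intro vector_diff_chain_within d) (simp add: qimg has_real_derivative_iff_has_vector_derivative)
      ultimately show ?thesis by auto
    qed
    let ?h = "F \<circ> q"
    have conth: "continuous_on {0..l} ?h"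
      unfolding continuous_on_eq_continuous_within using dh has_vector_derivative_continuous by blast
    have "inj_on q {0..l}" by (rule inj_onI) (metis gq(1) inj inj_onD)
    then have injh: "inj_on ?h {0..l}" using inj_on_subset[OF \<open>inj_on F {0..u}\<close>] qimg
      by (simp add: comp_inj_on)
    have imgh: "?h ` {0..l} = {0..F u}" unfolding image_comp[symmetric] qimg img ..
    obtain D where D: "\<And>t. t \<in> {0..l} \<Longrightarrow> \<bar>D t\<bar> = 1 \<and> (?h has_vector_derivative D t) (at t within {0..l})"
      using dh by metis
    obtain \<xi> where xi: "\<xi> \<in> {0<..<l}" "?h l - ?h 0 = (l - 0) * D \<xi>"
      using mvt_simple[OF l0, of ?h "\<lambda>t y. y *\<^sub>R D t"] D unfolding has_vector_derivative_def by auto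
    have "\<bar>D \<xi>\<bar> = 1" using xi D[of \<xi>] by simp
    then have "\<bar>?h l - ?h 0\<bar> = l" using xi(2) l0 by (simp add: abs_mult)
    moreover have "\<bar>?h l - ?h 0\<bar> = F u"
    proof -
      have ends: "?h 0 \<in> {0..F u}" "?h l \<in> {0..F u}" unfolding imgh[symmetric] using l by auto
      have "0 \<in> ?h ` {0..l}" "F u \<in> ?h ` {0..l}" unfolding imgh using Fu by simp_all
      then obtain a b where ab: "a \<in> {0..l}" "?h a = 0" "b \<in> {0..l}" "?h b = F u"
        by (elim imageE) simp
      consider "mono_on {0..l} ?h" | "antimono_on {0..l} ?h"
        using injh injective_eq_monotone_map[OF is_interval_cc conth]
          strict_mono_on_imp_mono_on strict_antimono_iff_antimono by blast
      then show ?thesis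
      proof cases
        case 1
        then have "?h 0 \<le> ?h a" "?h b \<le> ?h l" using mono_onD[OF 1, of 0 a] mono_onD[OF 1, of b l] ab l by simp_all
        then show ?thesis using ab ends by auto
      next
        case 2
        then have "?h l \<le> ?h a" "?h b \<le> ?h 0" using monotone_onD[OF 2, of a l] monotone_onD[OF 2, of 0 b] ab l by simp_all
        then show ?thesis using ab ends by auto
      qed
    qed
    ultimately show "l = F u" by simp
  qed
qed

text \<open>The curve meets the circle of centre \<open>p\<close> and radius \<open>r\<close> at \<open>x\<close> perpendicularly. So its tangent there
  is the unit vector that points from \<open>x\<close> towards \<open>p\<close>.\<close>

lemma radial_unit_tangent:
  assumes x: "x \<in> cycle_curve N k" and p: "p \<in> hyp_plane" and r: "r > 0"
    and xp: "lorentz x p = - cosh r" and pN: "lorentz p N = - k * cosh r"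
  shows "unit_tangent N x ((1 / sinh r) *\<^sub>R (p - cosh r *\<^sub>R x))"
proof -
  have xx: "lorentz x x = -1" "lorentz x N = -k" "lorentz p p = -1" "lorentz p x = - cosh r"
    using x p xp by (auto simp: cycle_curve_def hyp_plane_def lorentz_sym[of p x])
  have s: "sinh r > 0" using r by simp
  have "lorentz (p - cosh r *\<^sub>R x) (p - cosh r *\<^sub>R x) = (sinh r)\<^sup>2"
    using cosh_square_eq[of r] by (simp add: xx xp power2_eq_square)
  then show ?thesis
    using s by (simp add: unit_tangent_def xx pN xp power2_eq_square)
qed

text \<open>Starting the parametrization at an endpoint \<open>x\<close> of the arc, in the direction of \<open>p\<close>, one has
  \<open>\<langle>w,p\<rangle> = - cosh r\<close> and \<open>\<langle>e,p\<rangle> = sinh r\<close>. For the point with parameter \<open>Y\<close> the inequality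
  \<open>- \<langle>z,p\<rangle> \<le> cosh r\<close> then amounts to \<open>Y\<^sup>2 cosh r \<le> Y sinh r\<close>, that is, to \<open>0 \<le> Y \<le> tanh r\<close>. The function \<open>\<phi>\<close>
  recovers the parameter of a point.\<close>

lemma arc_inside_dual_circle:
  assumes x: "x \<in> cycle_curve N k" and N: "lorentz N N = 1 - k\<^sup>2" and k: "k > 0"
    and p: "p \<in> hyp_plane" and r: "r > 0"
    and xp: "lorentz x p = - cosh r" and pN: "lorentz p N = - k * cosh r"
  defines "e \<equiv> (1 / sinh r) *\<^sub>R (p - cosh r *\<^sub>R x)"
  defines "A \<equiv> cycle_curve N k \<inter> {z \<in> hyp_plane. - lorentz z p \<le> cosh r}"
  defines "\<phi> \<equiv> \<lambda>z. lorentz z e / (2 + (1 - k\<^sup>2) * (- lorentz z x - 1))"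
  shows "A = cycle_point N k x e ` {0..tanh r}"
    and "\<And>Y. Y \<in> {0..tanh r} \<Longrightarrow> \<phi> (cycle_point N k x e Y) = Y"
    and "\<And>z. z \<in> A \<Longrightarrow> 2 + (1 - k\<^sup>2) * (- lorentz z x - 1) > 0"
proof -
  have e: "unit_tangent N x e" unfolding e_def by (rule radial_unit_tangent[OF x p r xp pN])
  define c s \<kappa> w where "c = cosh r" and "s = sinh r" and "\<kappa> = 1 - k\<^sup>2" and "w = \<kappa> *\<^sub>R x + k *\<^sub>R N"
  have cs: "c > 0" "s > 0" "c\<^sup>2 = 1 + s\<^sup>2" using r cosh_square_eq[of r] by (auto simp: c_def s_def)
  have th: "tanh r = s / c" by (simp add: tanh_def c_def s_def)
  have th1: "tanh r < 1" by (rule tanh_real_lt_1)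
  have xx: "lorentz x x = -1" "lorentz x N = - k" "lorentz N x = - k" "x \<in> hyp_plane"
    using x by (auto simp: cycle_curve_def hyp_plane_def lorentz_sym)
  have ee: "lorentz e e = 1" "lorentz e x = 0" "lorentz e N = 0" "lorentz x e = 0" "lorentz N e = 0"
    using e by (auto simp: unit_tangent_def lorentz_sym)
  have Np: "lorentz N p = - k * c" using pN by (simp add: lorentz_sym c_def)
  have xp': "lorentz x p = - c" using xp by (simp add: c_def)
  have ep: "lorentz e p = s"
  proof -
    have "lorentz e p = (1 / s) * (c\<^sup>2 - 1)"
      using p by (simp add: e_def xp hyp_plane_def power2_eq_square c_def s_def)
    then show ?thesis using cs by (simp add: power2_eq_square)
  qed
  have w: "lorentz w N = 0" "lorentz w x = -1" "lorentz w e = 0" "lorentz w p = - c"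
    by (simp_all add: w_def xx ee N Np xp' \<kappa>_def) (simp_all add: power2_eq_square algebra_simps)
  have pt: "cycle_point N k x e Y = x + (2 * Y / (1 - \<kappa> * Y\<^sup>2)) *\<^sub>R (Y *\<^sub>R w + e)" for Y
    by (simp add: cycle_point_def w_def \<kappa>_def power2_eq_square scaleR_add_right mult_ac)
  have D: "1 - \<kappa> * Y\<^sup>2 > 0" if "Y \<in> {0..tanh r}" for Y
    using that cycle_speed_pos[of Y k] k th1 by (simp add: \<kappa>_def)
  show "\<phi> (cycle_point N k x e Y) = Y" if Y: "Y \<in> {0..tanh r}" for Y
  proof -
    have "lorentz (cycle_point N k x e Y) e = 2 * Y / (1 - \<kappa> * Y\<^sup>2)"
      by (simp add: pt ee w)
    moreover have "2 + \<kappa> * (- lorentz (cycle_point N k x e Y) x - 1) = 2 / (1 - \<kappa> * Y\<^sup>2)"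
      using D[OF Y] by (simp add: pt ee w xx divide_simps) (simp add: power2_eq_square algebra_simps)
    ultimately show ?thesis using D[OF Y] by (simp add: \<phi>_def flip: \<kappa>_def)
  qed
  have main: "2 + \<kappa> * (- lorentz z x - 1) > 0 \<and> \<phi> z \<in> {0..tanh r} \<and> z = cycle_point N k x e (\<phi> z)"
    if z: "z \<in> A" for z
  proof -
    have zz: "lorentz z z = -1" "lorentz z N = - k" "- lorentz z p \<le> c" "z \<in> hyp_plane"
      using z by (auto simp: A_def cycle_curve_def hyp_plane_def c_def)
    define C S where "C = - lorentz z x - 1" and "S = lorentz z e"
    have C: "C \<ge> 0" using reverse_Cauchy_Schwarz(1)[OF zz(4) xx(4)] by (simp add: C_def)
    \<comment> \<open>\<open>z - x\<close> is orthogonal to \<open>N\<close>, and so a combination of \<open>w\<close> and \<open>e\<close>.\<close>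
    have zeq: "z = x + C *\<^sub>R w + S *\<^sub>R e"
    proof -
      let ?v = "z - x - C *\<^sub>R w - S *\<^sub>R e"
      have v: "lorentz ?v x = 0" "lorentz ?v N = 0" "lorentz ?v e = 0"
        by (simp_all add: xx ee w zz C_def S_def)
      have "?v = 0" using orthogonal_eq_multiple_tangent[OF x N e v(1,2)] unfolding v(3) by simp
      then show ?thesis by (simp add: algebra_simps)
    qed
    have zw: "lorentz z w = \<kappa> * (- C - 1) - k\<^sup>2"
      by (simp add: w_def zz C_def power2_eq_square)
    have "lorentz z z = lorentz z x + C * lorentz z w + S * lorentz z e"
      by (subst (2) zeq) simp
    then have "- 1 = - C - 1 + C * (\<kappa> * (- C - 1) - k\<^sup>2) + S * S"
      by (simp add: zz zw) (simp add: C_def S_def)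
    then have SC: "S * S = C * (2 + \<kappa> * C)"
      by (simp add: \<kappa>_def power2_eq_square algebra_simps)
    have "lorentz z p = - c - C * c + S * s" by (subst zeq) (simp add: xp' w ep)
    then have CS: "C * c \<le> S * s" using zz(3) by simp
    then have S0: "S \<ge> 0" using C cs by (metis mult_nonneg_nonneg order.strict_implies_order order_trans zero_le_mult_iff not_le)
    \<comment> \<open>For \<open>k > 1\<close> this excludes the point opposite to \<open>x\<close>, which has no parameter.\<close>
    have pos: "2 + \<kappa> * C > 0"
    proof (rule ccontr)
      assume n: "\<not> ?thesis"
      then have "S * S \<le> 0" using SC C by (simp add: mult_nonneg_nonpos)
      then have "S = 0" by (metis antisym mult_eq_0_iff zero_le_square)
      then have "C * c \<le> 0" using CS by simp
      then have "C = 0" using C cs by (metis mult_pos_pos not_le order_le_less)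
      then show False using n by simp
    qed
    define Y where "Y = S / (2 + \<kappa> * C)"
    have phi: "\<phi> z = Y" by (simp add: \<phi>_def Y_def S_def C_def \<kappa>_def)
    have SY: "S = Y * (2 + \<kappa> * C)" using pos by (simp add: Y_def)
    have "C * (2 + \<kappa> * C) = (Y * S) * (2 + \<kappa> * C)" using SC SY by (metis mult.assoc mult.commute)
    then have CY: "C = Y * S" using pos by simp
    have Y0: "Y \<ge> 0" using S0 pos by (simp add: Y_def)
    have Yle: "Y \<le> tanh r"
    proof (cases "S = 0")
      case True then show ?thesis using r by (simp add: Y_def)
    next
      case False
      then have "Y * c \<le> s" using CS S0 CY by (simp add: mult_ac)
      then show ?thesis using cs by (simp add: th field_simps)
    qed
    then have Dp: "1 - \<kappa> * Y\<^sup>2 > 0" using D Y0 by auto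
    have "S * (1 - \<kappa> * Y\<^sup>2) = 2 * Y" using SY CY by (simp add: power2_eq_square algebra_simps)
    then have "S = 2 * Y / (1 - \<kappa> * Y\<^sup>2)" using Dp by (simp add: field_simps)
    then have "cycle_point N k x e Y = x + S *\<^sub>R (Y *\<^sub>R w + e)" by (simp add: pt)
    also have "\<dots> = z" unfolding zeq CY by (simp add: scaleR_add_right mult.commute)
    finally have "z = cycle_point N k x e Y" by simp
    then show ?thesis using pos Y0 Yle phi by (simp add: C_def)
  qed
  then show "2 + (1 - k\<^sup>2) * (- lorentz z x - 1) > 0" if "z \<in> A" for z
    using that by (simp add: \<kappa>_def)
  have "cycle_point N k x e Y \<in> A" if Y: "Y \<in> {0..tanh r}" for Y
  proof -
    have cc: "cycle_point N k x e Y \<in> cycle_curve N k"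
      using cycle_point_in_curve[OF x N e] D[OF Y] by (simp add: \<kappa>_def)
    have "Y * c \<le> s" using Y cs by (simp add: th field_simps)
    then have "(2 * Y / (1 - \<kappa> * Y\<^sup>2)) * (s - Y * c) \<ge> 0" using D[OF Y] Y by simp
    moreover have "lorentz (cycle_point N k x e Y) p = - c + (2 * Y / (1 - \<kappa> * Y\<^sup>2)) * (s - Y * c)"
      by (simp add: pt xp' w ep)
    ultimately have "- lorentz (cycle_point N k x e Y) p \<le> c" by linarith
    then show ?thesis using cc by (simp add: A_def c_def cycle_curve_def)
  qed
  then show "A = cycle_point N k x e ` {0..tanh r}" using main by blast
qed

lemma arc_length_inside_dual_circle:
  assumes x: "x \<in> cycle_curve N k" and N: "lorentz N N = 1 - k\<^sup>2" and k: "k > 0"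
    and p: "p \<in> hyp_plane" and r: "r > 0"
    and xp: "lorentz x p = - cosh r" and pN: "lorentz p N = - k * cosh r"
  shows "has_arc_length (cycle_curve N k \<inter> {z \<in> hyp_plane. - lorentz z p \<le> cosh r}) l \<longleftrightarrow>
    l = arc_integral k (tanh r)"
proof -
  define e where "e = (1 / sinh r) *\<^sub>R (p - cosh r *\<^sub>R x)"
  define \<phi> where "\<phi> = (\<lambda>z. lorentz z e / (2 + (1 - k\<^sup>2) * (- lorentz z x - 1)))"
  note A = arc_inside_dual_circle[OF assms, folded e_def, folded \<phi>_def]
  have e: "unit_tangent N x e" unfolding e_def by (rule radial_unit_tangent[OF x p r xp pN])
  have th1: "tanh r < 1" by (rule tanh_real_lt_1)
  define c' where "c' = (\<lambda>Y. (2 / (1 - (1 - k\<^sup>2) * Y\<^sup>2)\<^sup>2) *\<^sub>R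
    ((2 * Y) *\<^sub>R ((1 - k\<^sup>2) *\<^sub>R x + k *\<^sub>R N) + (1 + (1 - k\<^sup>2) * Y\<^sup>2) *\<^sub>R e))"
  have D: "1 - (1 - k\<^sup>2) * Y\<^sup>2 > 0" if "Y \<in> {0..tanh r}" for Y
    using that cycle_speed_pos[of Y k] k th1 by simp
  show ?thesis unfolding A(1)
  proof (rule has_arc_length_by_speed[where s = "\<lambda>x. 2 / (1 + (k\<^sup>2 - 1) * x\<^sup>2)" and c' = c' and \<phi> = \<phi>])
    show "tanh r > 0" using r by simp
    show "arc_integral k 0 = 0" by (simp add: arc_integral_def)
  next
    fix Y assume Y: "Y \<in> {0..tanh r}"
    then show "(arc_integral k has_real_derivative 2 / (1 + (k\<^sup>2 - 1) * Y\<^sup>2)) (at Y within {0..tanh r})"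
      using th1 by (intro arc_integral_has_derivative k) auto
    show "2 / (1 + (k\<^sup>2 - 1) * Y\<^sup>2) > 0" using D[OF Y] by (simp add: algebra_simps)
    show "(cycle_point N k x e has_vector_derivative c' Y) (at Y within {0..tanh r})"
      unfolding c'_def using D[OF Y] by (intro cycle_point_has_derivative) auto
    show "lorentz (c' Y) (c' Y) = (2 / (1 + (k\<^sup>2 - 1) * Y\<^sup>2))\<^sup>2"
    proof -
      define d where "d = 1 - (1 - k\<^sup>2) * Y\<^sup>2"
      have xx: "lorentz x x = -1" "lorentz x N = - k" "lorentz N x = - k"
        using x by (auto simp: cycle_curve_def hyp_plane_def lorentz_sym)
      have ee: "lorentz e e = 1" "lorentz e x = 0" "lorentz e N = 0" "lorentz x e = 0" "lorentz N e = 0"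
        using e by (auto simp: unit_tangent_def lorentz_sym)
      let ?v = "(2 * Y) *\<^sub>R ((1 - k\<^sup>2) *\<^sub>R x + k *\<^sub>R N) + (1 + (1 - k\<^sup>2) * Y\<^sup>2) *\<^sub>R e"
      have "lorentz ?v ?v = d\<^sup>2"
        by (simp add: xx ee N d_def) (simp add: power2_eq_square algebra_simps)
      then have "lorentz (c' Y) (c' Y) = (2 / d\<^sup>2)\<^sup>2 * d\<^sup>2"
        unfolding c'_def d_def[symmetric] lorentz_linear(7,8) by (simp add: power2_eq_square)
      also have "\<dots> = (2 / d)\<^sup>2" using D[OF Y] by (simp add: power2_eq_square flip: d_def)
      finally show ?thesis by (simp add: d_def algebra_simps)
    qed
    show "\<phi> (cycle_point N k x e Y) = Y" using A(2)[OF Y] by (simp add: \<phi>_def)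
  next
    fix z assume "z \<in> cycle_point N k x e ` {0..tanh r}"
    then have "2 + (1 - k\<^sup>2) * (- lorentz z x - 1) \<noteq> 0" using A(1,3) by fastforce
    moreover have "(\<lambda>z. lorentz z a) differentiable (at z)" for a
      using bounded_bilinear.bounded_linear_left[OF bounded_bilinear_lorentz, of a]
      by (rule bounded_linear_imp_differentiable)
    ultimately show "\<phi> differentiable at z" unfolding \<phi>_def by (intro derivative_intros) auto
  qed
qed

section \<open>The packing of a triangle\<close>

lemma gram_determinant:
  "lorentz a a * (lorentz b b * lorentz c c - (lorentz b c)\<^sup>2)
    - lorentz a b * (lorentz a b * lorentz c c - lorentz b c * lorentz a c)
    + lorentz a c * (lorentz a b * lorentz b c - lorentz b b * lorentz a c)
   = - (lorentz (lcross a b) c)\<^sup>2"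
  by (simp add: lorentz_def lcross_def power2_eq_square algebra_simps)

text \<open>Three vectors orthogonal to \<open>p\<close> lie in a plane, and are linearly dependent. The equation in the
  proof is Cramer's rule, expressing \<open>p\<close> by the reciprocal basis of \<open>a\<close>, \<open>b\<close>, \<open>c\<close>.\<close>

lemma gram_determinant_orthogonal:
  assumes p: "p \<in> hyp_plane" and "lorentz p a = 0" "lorentz p b = 0" "lorentz p c = 0"
  shows "lorentz a a * (lorentz b b * lorentz c c - (lorentz b c)\<^sup>2)
    - lorentz a b * (lorentz a b * lorentz c c - lorentz b c * lorentz a c)
    + lorentz a c * (lorentz a b * lorentz b c - lorentz b b * lorentz a c) = 0"
proof -
  have "lorentz (lcross a b) c *\<^sub>R p =
      lorentz p a *\<^sub>R lcross b c + lorentz p b *\<^sub>R lcross c a + lorentz p c *\<^sub>R lcross a b"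
    by (simp add: vec_eq_iff forall_3 lorentz_def lcross_def algebra_simps)
  then have "lorentz (lcross a b) c *\<^sub>R p = 0" using assms by simp
  moreover have "p \<noteq> 0" using p by (auto simp: hyp_plane_def)
  ultimately show ?thesis unfolding gram_determinant by simp
qed

lemma externally_tangentD:
  assumes C: "gen_circle_ok C" and D: "gen_circle_ok D" and t: "externally_tangent C D"
  shows "lorentz (normal_vector C) (normal_vector D) = - 1 - geod_curvature C * geod_curvature D"
proof -
  note C = gen_circle_as_cycle[OF C] and D = gen_circle_as_cycle[OF D]
  let ?N = "normal_vector C" and ?M = "normal_vector D" and ?k = "geod_curvature C" and ?m = "geod_curvature D"
  obtain x where x: "tangent_at (cycle_curve ?N ?k) (cycle_curve ?M ?m) x"
    and dis: "(top_of_set hyp_plane interior_of cycle_disk ?N ?k) \<inter>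
      (top_of_set hyp_plane interior_of cycle_disk ?M ?m) = {}"
    using t unfolding externally_tangent_def C D by blast
  have xx: "x \<in> cycle_curve ?N ?k" "x \<in> cycle_curve ?M ?m" using x by (auto simp: tangent_at_def)
  have "?N - ?k *\<^sub>R x = - (?M - ?m *\<^sub>R x)"
    using tangent_at_cycles_normals[OF x C(1,2) D(1,2)]
      interiors_meet_if_normals_agree[OF xx C(1,2) D(1,2)] dis by blast
  then have "?N + ?M = (?k + ?m) *\<^sub>R x" by (simp add: algebra_simps)
  then show ?thesis by (rule tangency_inner_product[OF cycle_curveD(1)[OF xx(1)] C(1) D(1)])
qed

lemma externally_tangentI:
  assumes C: "gen_circle_ok C" and D: "gen_circle_ok D"
    and "lorentz (normal_vector C) (normal_vector D) = - 1 - geod_curvature C * geod_curvature D"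
    and "normal_vector C $ 3 + normal_vector D $ 3 > 0"
  shows "externally_tangent C D"
proof -
  note C = gen_circle_as_cycle[OF C] and D = gen_circle_as_cycle[OF D]
  note T = tangent_at_cyclesI[OF C(1,2) D(1,2) assms(3,4) refl]
  let ?x = "(1 / (geod_curvature C + geod_curvature D)) *\<^sub>R (normal_vector C + normal_vector D)"
  have "?x \<in> cycle_curve (normal_vector C) (geod_curvature C)"
    "?x \<in> cycle_curve (normal_vector D) (geod_curvature D)" using T(1) by (auto simp: tangent_at_def)
  from interiors_disjoint_if_normals_opposite[OF this C(1,2) D(2) T(2)] T(1)
  show ?thesis unfolding externally_tangent_def C(3,4) D(3,4) by blast
qed

text \<open>Project the three normals to the plane orthogonal to \<open>p\<close>. The projections have the products
  \<open>1 + k\<^sub>i\<^sup>2 x\<close> and \<open>k\<^sub>i k\<^sub>j x - 1\<close>, where \<open>x = (sinh r)\<^sup>2\<close>, and the Gram determinant of three vectors in a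
  plane is zero. It equals \<open>4 (x (k\<^sub>1 k\<^sub>2 + k\<^sub>1 k\<^sub>3 + k\<^sub>2 k\<^sub>3) - 1)\<close>.\<close>

lemma dual_circle_radius:
  fixes k1 k2 k3 :: real
  assumes p: "p \<in> hyp_plane"
    and pN: "lorentz p N1 = - k1 * cosh r" "lorentz p N2 = - k2 * cosh r" "lorentz p N3 = - k3 * cosh r"
    and NN: "lorentz N1 N1 = 1 - k1\<^sup>2" "lorentz N2 N2 = 1 - k2\<^sup>2" "lorentz N3 N3 = 1 - k3\<^sup>2"
    and NM: "lorentz N1 N2 = - 1 - k1 * k2" "lorentz N1 N3 = - 1 - k1 * k3" "lorentz N2 N3 = - 1 - k2 * k3"
  shows "(sinh r)\<^sup>2 * (k1 * k2 + k1 * k3 + k2 * k3) = 1"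
proof -
  define x where "x = (sinh r)\<^sup>2"
  have c: "(cosh r)\<^sup>2 = x + 1" by (simp add: x_def cosh_square_eq)
  define g where "g = (\<lambda>N k. N - (k * cosh r) *\<^sub>R p)"
  have pp: "lorentz p p = -1" using p by (simp add: hyp_plane_def)
  have gp: "lorentz p (g N k) = 0" if "lorentz p N = - k * cosh r" for N k
    using that by (simp add: g_def pp)
  have gg: "lorentz (g N k) (g M m) = lorentz N M + k * m * (x + 1)"
    if "lorentz p N = - k * cosh r" "lorentz p M = - m * cosh r" for N M k m
    unfolding c[symmetric] using that lorentz_sym[of N p]
    by (simp add: g_def pp power2_eq_square algebra_simps)
  have "4 * (x * (k1 * k2 + k1 * k3 + k2 * k3)) - 4 = 0"
    using gram_determinant_orthogonal[OF p gp[OF pN(1)] gp[OF pN(2)] gp[OF pN(3)]]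
    unfolding gg[OF pN(1) pN(1)] gg[OF pN(2) pN(2)] gg[OF pN(3) pN(3)]
      gg[OF pN(1) pN(2)] gg[OF pN(1) pN(3)] gg[OF pN(2) pN(3)] NN NM
    by (simp add: power2_eq_square algebra_simps)
  then show ?thesis by (simp add: x_def)
qed

lemma tanh_eq_if_sinh_square:
  fixes r q :: real
  assumes "r > 0" "(sinh r)\<^sup>2 * q = 1"
  shows "tanh r = 1 / sqrt (1 + q)"
proof -
  have s: "sinh r > 0" using assms by simp
  then have q: "q = 1 / (sinh r)\<^sup>2" using assms by (simp add: field_simps)
  have "1 + q = (cosh r / sinh r)\<^sup>2" using s by (simp add: q power_divide cosh_square_eq field_simps)
  then show ?thesis using s by (simp add: tanh_def real_sqrt_divide)
qed

context
  fixes W :: "'v set" and k :: "'v \<Rightarrow> real" and i a b :: 'v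
  assumes W: "W = {i, a, b}" and distinct: "i \<noteq> a" "i \<noteq> b" "a \<noteq> b" and k: "k i > 0" "k a > 0" "k b > 0"
begin

text \<open>All data of a packing that enter the length of the arc are determined by the curvatures: the
  products of the normals with each other and with \<open>p\<close>, hence the radius of the dual circle.\<close>

lemma packing_arc_length:
  assumes pack: "triangle_packing W k C p r"
  shows "has_arc_length (curve (C i) \<inter> convex_side (Circle p r)) l \<longleftrightarrow>
    l = arc_integral (k i) (1 / sqrt (1 + (k i * k a + k i * k b + k a * k b)))"
proof -
  have ok: "gen_circle_ok (C v)" "geod_curvature (C v) = k v" if "v \<in> W" for v
    using pack that by (auto simp: triangle_packing_def)
  have cyc: "lorentz (normal_vector (C v)) (normal_vector (C v)) = 1 - (k v)\<^sup>2" "k v > 0"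
    "curve (C v) = cycle_curve (normal_vector (C v)) (k v)" if "v \<in> W" for v
    using gen_circle_as_cycle[OF ok(1)[OF that]] ok(2)[OF that] by simp_all
  have okP: "gen_circle_ok (Circle p r)" using pack by (simp add: triangle_packing_def)
  then have p: "p \<in> hyp_plane" and r: "r > 0" by auto
  have s: "sinh r > 0" "cosh r > 0" using r by auto
  note P = gen_circle_as_cycle[OF okP]
  define N where "N = (\<lambda>v. normal_vector (C v))"
  have pN: "lorentz p (N v) = - k v * cosh r" if v: "v \<in> W" for v
  proof -
    have "perpendicular (curve (Circle p r)) (curve (C v))" using pack v by (simp add: triangle_packing_def)
    then have "lorentz (normal_vector (Circle p r)) (N v) = - geod_curvature (Circle p r) * k v"
      unfolding P(3) cyc(3)[OF v] N_def by (rule perpendicular_cyclesD[OF _ P(1,2) cyc(1,2)[OF v]])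
    then show ?thesis using s by (simp add: tanh_def field_simps)
  qed
  have NM: "lorentz (N u) (N v) = - 1 - k u * k v" if "u \<in> W" "v \<in> W" "u \<noteq> v" for u v
    using externally_tangentD[OF ok(1)[OF that(1)] ok(1)[OF that(2)]] ok(2) that pack
    by (simp add: triangle_packing_def N_def)
  have NN: "lorentz (N v) (N v) = 1 - (k v)\<^sup>2" if "v \<in> W" for v
    unfolding N_def by (rule cyc(1)[OF that])
  have in_W: "i \<in> W" "a \<in> W" "b \<in> W" by (auto simp: W)
  have "(sinh r)\<^sup>2 * (k i * k a + k i * k b + k a * k b) = 1"
    by (rule dual_circle_radius[OF p pN pN pN NN NN NN NM NM NM]) (use in_W distinct in auto)
  from tanh_eq_if_sinh_square[OF r this]
  have t: "tanh r = 1 / sqrt (1 + (k i * k a + k i * k b + k a * k b))" .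
  have "curve (Circle p r) \<inter> curve (C i) \<noteq> {}"
    using pack in_W(1) unfolding triangle_packing_def perpendicular_def by blast
  then obtain x where x: "x \<in> curve (Circle p r)" "x \<in> curve (C i)" by blast
  have xp: "lorentz x p = - cosh r" using x(1) hyp_dist_le_iff(2)[OF p _ r, of x] by simp
  have side: "curve (C i) \<inter> convex_side (Circle p r) =
      cycle_curve (N i) (k i) \<inter> {z \<in> hyp_plane. - lorentz z p \<le> cosh r}"
    using hyp_dist_le_iff(1)[OF p _ r] unfolding N_def cyc(3)[OF in_W(1)] by auto
  show ?thesis unfolding side t[symmetric]
    by (rule arc_length_inside_dual_circle[OF _ NN[OF in_W(1)] k(1) p r xp pN[OF in_W(1)]])
       (use x cyc(3)[OF in_W(1)] in \<open>simp add: N_def\<close>)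
qed

text \<open>Take the centre of the dual circle as \<open>p = (0,0,1)\<close>, and \<open>x = sinh r\<close>, \<open>c = cosh r\<close>. The normal of
  the circle \<open>v\<close> is \<open>k\<^sub>v c p\<close> plus a horizontal vector of square \<open>1 + k\<^sub>v\<^sup>2 x\<^sup>2\<close>. The first of these
  is placed along the first axis, and the products that tangency requires then determine the
  other two up to reflection. The relation between \<open>x\<close> and the curvatures makes the last
  product right.\<close>

lemma normals_of_packing_exist:
  assumes x: "x\<^sup>2 * (k i * k a + k i * k b + k a * k b) = 1" and c: "c\<^sup>2 = 1 + x\<^sup>2" and x0: "x > 0"
  shows "\<exists>N :: 'v \<Rightarrow> real^3. (\<forall>v\<in>W. lorentz (N v) (N v) = 1 - (k v)\<^sup>2 \<and> N v $ 3 = k v * c) \<and>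
    (\<forall>u\<in>W. \<forall>v\<in>W. u \<noteq> v \<longrightarrow> lorentz (N u) (N v) = - 1 - k u * k v)"
proof -
  define m where "m = sqrt (1 + (k i)\<^sup>2 * x\<^sup>2)"
  have m: "m > 0" "m * m = 1 + (k i)\<^sup>2 * x\<^sup>2"
    by (auto simp: m_def add_pos_nonneg)
  define N1 N2 N3 :: "real^3" where
    "N1 = vector [m, 0, k i * c]" and
    "N2 = vector [(k i * k a * x\<^sup>2 - 1) / m, x * (k i + k a) / m, k a * c]" and
    "N3 = vector [(k i * k b * x\<^sup>2 - 1) / m, - x * (k i + k b) / m, k b * c]"
  note Ns = N1_def N2_def N3_def
  have cc: "k u * c * (k v * c) = k u * k v * (1 + x\<^sup>2)" for u v
    unfolding c[symmetric] by (simp add: power2_eq_square)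
  have 11: "lorentz N1 N1 = 1 - (k i)\<^sup>2"
    by (simp add: Ns lorentz_def m cc) (simp add: power2_eq_square algebra_simps)
  have *: "(k i * k v * x\<^sup>2 - 1)\<^sup>2 + (x * (k i + k v))\<^sup>2 = (m * m) * (1 + (k v)\<^sup>2 * x\<^sup>2)" for v
    unfolding m by (simp add: power2_eq_square algebra_simps)
  have **: "((k i * k v * x\<^sup>2 - 1)\<^sup>2 + (x * (k i + k v))\<^sup>2) / (m * m) = 1 + (k v)\<^sup>2 * x\<^sup>2" for v
    unfolding * using m(1) by simp
  have 22: "lorentz N2 N2 = 1 - (k a)\<^sup>2"
  proof -
    have "lorentz N2 N2 = ((k i * k a * x\<^sup>2 - 1)\<^sup>2 + (x * (k i + k a))\<^sup>2) / (m * m) - k a * c * (k a * c)"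
      by (simp add: Ns lorentz_def power2_eq_square add_divide_distrib)
    then show ?thesis unfolding ** cc by (simp add: power2_eq_square algebra_simps)
  qed
  have 33: "lorentz N3 N3 = 1 - (k b)\<^sup>2"
  proof -
    have "lorentz N3 N3 = ((k i * k b * x\<^sup>2 - 1)\<^sup>2 + (x * (k i + k b))\<^sup>2) / (m * m) - k b * c * (k b * c)"
      by (simp add: Ns lorentz_def power2_eq_square add_divide_distrib)
    then show ?thesis unfolding ** cc by (simp add: power2_eq_square algebra_simps)
  qed
  have 12: "lorentz N1 N2 = - 1 - k i * k a" and 13: "lorentz N1 N3 = - 1 - k i * k b"
    using m(1) by (simp_all add: Ns lorentz_def cc) (simp_all add: algebra_simps)
  have 23: "lorentz N2 N3 = - 1 - k a * k b"
  proof -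
    let ?S = "k i * k a + k i * k b + k a * k b"
    have gen: "A / m * (B / m) - C / m * (D / m) = (A * B - C * D) / (m * m)" for A B C D
      by (simp add: diff_divide_distrib)
    have num: "(k i * k a * x\<^sup>2 - 1) * (k i * k b * x\<^sup>2 - 1) - x * (k i + k a) * (x * (k i + k b))
        = (m * m) * (k a * k b * x\<^sup>2 - 1) + 2 - 2 * (x\<^sup>2 * ?S)"
      unfolding m by (simp add: power2_eq_square algebra_simps)
    have "lorentz N2 N3 = (k i * k a * x\<^sup>2 - 1) / m * ((k i * k b * x\<^sup>2 - 1) / m)
        - x * (k i + k a) / m * (x * (k i + k b) / m) - k a * c * (k b * c)"
      by (simp add: Ns lorentz_def)
    also have "\<dots> = (k a * k b * x\<^sup>2 - 1) - k a * k b * (1 + x\<^sup>2)"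
      unfolding gen num x cc using m(1) by simp
    finally show ?thesis by (simp add: algebra_simps)
  qed
  let ?N = "\<lambda>v. if v = i then N1 else if v = a then N2 else N3"
  have "\<forall>v\<in>W. lorentz (?N v) (?N v) = 1 - (k v)\<^sup>2 \<and> ?N v $ 3 = k v * c"
    using distinct 11 22 33 by (auto simp: W) (simp_all add: Ns)
  moreover have "\<forall>u\<in>W. \<forall>v\<in>W. u \<noteq> v \<longrightarrow> lorentz (?N u) (?N v) = - 1 - k u * k v"
    using distinct 12 13 23 lorentz_sym[of N2 N1] lorentz_sym[of N3 N1] lorentz_sym[of N3 N2]
    by (auto simp: W mult.commute)
  ultimately show ?thesis by (intro exI[of _ ?N] conjI)
qed

lemma packing_exists: "\<exists>C p r. triangle_packing W k C p r"
proof -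
  define q where "q = k i * k a + k i * k b + k a * k b"
  have q: "q > 0" using k by (simp add: q_def add_pos_pos)
  define r where "r = arsinh (1 / sqrt q)"
  have r: "r > 0" and sr: "sinh r = 1 / sqrt q" using q by (simp_all add: r_def)
  have s: "sinh r > 0" "cosh r > 0" using r by auto
  have "(sinh r)\<^sup>2 * q = 1" using q by (simp add: sr power_divide)
  then obtain N :: "'v \<Rightarrow> real^3" where NN: "\<And>v. v \<in> W \<Longrightarrow> lorentz (N v) (N v) = 1 - (k v)\<^sup>2"
    and N3: "\<And>v. v \<in> W \<Longrightarrow> N v $ 3 = k v * cosh r"
    and NM: "\<And>u v. u \<in> W \<Longrightarrow> v \<in> W \<Longrightarrow> u \<noteq> v \<Longrightarrow> lorentz (N u) (N v) = - 1 - k u * k v"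
    using normals_of_packing_exist[of "sinh r" "cosh r"] s cosh_square_eq[of r] by (auto simp: q_def)
  have kW: "k v > 0" if "v \<in> W" for v using that k W by auto
  have N3pos: "N v $ 3 > 0" if "v \<in> W" for v using that kW s by (simp add: N3)
  \<comment> \<open>Each normal is that of a generalized circle, of whatever kind.\<close>
  have "\<exists>C. gen_circle_ok C \<and> geod_curvature C = k v \<and> normal_vector C = N v" if "v \<in> W" for v
    by (rule gen_circle_with_normal[OF NN kW N3pos]) (rule that)+
  then obtain C where C: "\<And>v. v \<in> W \<Longrightarrow> gen_circle_ok (C v)" "\<And>v. v \<in> W \<Longrightarrow> geod_curvature (C v) = k v"
    "\<And>v. v \<in> W \<Longrightarrow> normal_vector (C v) = N v" by metis
  have curve: "curve (C v) = cycle_curve (N v) (k v)" if "v \<in> W" for v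
    using gen_circle_as_cycle(3)[OF C(1)[OF that]] C(2,3)[OF that] by simp
  define p :: "real^3" where "p = vector [0, 0, 1]"
  have okP: "gen_circle_ok (Circle p r)" using r by (simp add: p_def hyp_plane_def lorentz_def)
  note P = gen_circle_as_cycle[OF okP]
  define P' K where "P' = normal_vector (Circle p r)" and "K = geod_curvature (Circle p r)"
  have PN: "lorentz P' (N v) = - K * k v" if "v \<in> W" for v
    using N3[OF that] by (simp add: P'_def K_def p_def lorentz_def tanh_def)
  \<comment> \<open>By the formula for tangency points, these lie on the dual circle.\<close>
  have dual: "x \<in> cycle_curve P' K"
    if "u \<in> W" "v \<in> W" "u \<noteq> v" "tangent_at (curve (C u)) (curve (C v)) x" for u v x
  proof -
    have x: "x \<in> cycle_curve (N u) (k u)" using that by (auto simp: tangent_at_def curve)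
    have "N u + N v = (k u + k v) *\<^sub>R x"
      using that by (intro tangent_point_cycles NN kW NM) (auto simp: curve)
    then have "lorentz P' (N u) + lorentz P' (N v) = (k u + k v) * lorentz P' x"
      by (metis lorentz_linear(2,8))
    then have "(k u + k v) * lorentz P' x = (k u + k v) * (- K)"
      using that by (simp add: PN algebra_simps)
    moreover have "k u + k v \<noteq> 0" using kW[OF that(1)] kW[OF that(2)] by simp
    ultimately have "lorentz P' x = - K" by (metis mult_left_cancel)
    then show ?thesis using x by (simp add: cycle_curve_def lorentz_sym)
  qed
  have tangent: "\<exists>x. tangent_at (curve (C u)) (curve (C v)) x" "externally_tangent (C u) (C v)"
    if "u \<in> W" "v \<in> W" "u \<noteq> v" for u v
  proof -
    show "externally_tangent (C u) (C v)"
      using that N3pos by (intro externally_tangentI C) (simp_all add: C NM add_pos_pos)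
    then show "\<exists>x. tangent_at (curve (C u)) (curve (C v)) x" by (auto simp: externally_tangent_def)
  qed
  have perp: "perpendicular (curve (Circle p r)) (curve (C v))" if v: "v \<in> W" for v
  proof -
    obtain u where u: "u \<in> W" "u \<noteq> v" using W distinct by auto
    obtain x where x: "tangent_at (curve (C v)) (curve (C u)) x" using tangent(1)[OF v u(1)] u by auto
    have "x \<in> cycle_curve P' K" using dual[OF v u(1) _ x] u by auto
    moreover have "x \<in> cycle_curve (N v) (k v)" using x curve[OF v] by (simp add: tangent_at_def)
    ultimately show ?thesis
      unfolding P(3) curve[OF v] P'_def[symmetric] K_def[symmetric]
      using P(1,2) NN[OF v] kW[OF v] PN[OF v]
      by (intro perpendicular_cyclesI) (auto simp: P'_def K_def)
  qed
  have "triangle_packing W k C p r"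
    unfolding triangle_packing_def
    using C tangent(2) okP perp dual P(3) by (auto simp: P'_def K_def)
  then show ?thesis by blast
qed

text \<open>The total geodesic curvature in closed form. It depends on the other two curvatures only through
  the radius of the dual circle.\<close>

theorem triangle_total_curvature_eq:
  "triangle_total_curvature W k i =
    k i * arc_integral (k i) (1 / sqrt (1 + (k i * k a + k i * k b + k a * k b)))"
  unfolding triangle_total_curvature_def
proof (rule the_equality)
  let ?l = "arc_integral (k i) (1 / sqrt (1 + (k i * k a + k i * k b + k a * k b)))"
  obtain C p r where pack: "triangle_packing W k C p r" using packing_exists by blast
  then have "has_arc_length (curve (C i) \<inter> convex_side (Circle p r)) ?l"
    by (simp only: packing_arc_length)
  with pack show "\<exists>C p r l. triangle_packing W k C p r \<and>
      has_arc_length (curve (C i) \<inter> convex_side (Circle p r)) l \<and> k i * ?l = k i * l"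
    by blast
next
  fix T
  assume "\<exists>C p r l. triangle_packing W k C p r \<and>
      has_arc_length (curve (C i) \<inter> convex_side (Circle p r)) l \<and> T = k i * l"
  then obtain C p r l where *: "triangle_packing W k C p r"
      "has_arc_length (curve (C i) \<inter> convex_side (Circle p r)) l" "T = k i * l" by blast
  show "T = k i * arc_integral (k i) (1 / sqrt (1 + (k i * k a + k i * k b + k a * k b)))"
    using *(2) unfolding packing_arc_length[OF *(1)] *(3) by simp
qed

end

section \<open>Differential equations with a globally Lipschitz field\<close>

lemma continuous_on_lipschitz_field:
  fixes F :: "('a \<Rightarrow> real) \<Rightarrow> real"
  assumes I: "finite I" and lip: "\<And>x y. \<bar>F x - F y\<bar> \<le> L * (\<Sum>j\<in>I. \<bar>x j - y j\<bar>)"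
    and X: "\<And>j. j \<in> I \<Longrightarrow> continuous_on S (\<lambda>t. X t j)"
  shows "continuous_on S (\<lambda>t. F (X t))"
  unfolding continuous_on_def
proof
  fix t assume t: "t \<in> S"
  have "((\<lambda>s. \<Sum>j\<in>I. \<bar>X s j - X t j\<bar>) \<longlongrightarrow> (\<Sum>j\<in>I. \<bar>X t j - X t j\<bar>)) (at t within S)"
    using X t by (intro tendsto_intros) (auto simp: continuous_on_def)
  then have "((\<lambda>s. L * (\<Sum>j\<in>I. \<bar>X s j - X t j\<bar>)) \<longlongrightarrow> 0) (at t within S)"
    by (simp add: tendsto_mult_right_zero)
  then have "((\<lambda>s. F (X s) - F (X t)) \<longlongrightarrow> 0) (at t within S)"
    by (rule Lim_null_comparison[rotated]) (simp add: lip)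
  then show "((\<lambda>s. F (X s)) \<longlongrightarrow> F (X t)) (at t within S)" by (simp add: LIM_zero_iff)
qed

lemma uniform_limit_lipschitz_field:
  fixes F :: "('a \<Rightarrow> real) \<Rightarrow> real"
  assumes I: "finite I" and L: "L \<ge> 0" and lip: "\<And>x y. \<bar>F x - F y\<bar> \<le> L * (\<Sum>j\<in>I. \<bar>x j - y j\<bar>)"
    and X: "\<And>j. j \<in> I \<Longrightarrow> uniform_limit S (\<lambda>n t. X n t j) (\<lambda>t. Y t j) sequentially"
  shows "uniform_limit S (\<lambda>n t. F (X n t)) (\<lambda>t. F (Y t)) sequentially"
proof (rule uniform_limitI)
  fix e :: real assume e: "e > 0"
  define d where "d = e / (L * real (card I) + 1)"
  have d: "d > 0" using e L by (simp add: d_def add_nonneg_pos)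
  have "eventually (\<lambda>n. \<forall>j\<in>I. \<forall>t\<in>S. dist (X n t j) (Y t j) < d) sequentially"
    using X I d by (simp add: eventually_ball_finite_distrib uniform_limit_iff)
  then show "eventually (\<lambda>n. \<forall>t\<in>S. dist (F (X n t)) (F (Y t)) < e) sequentially"
  proof eventually_elim
    case (elim n)
    show ?case
    proof
      fix t assume t: "t \<in> S"
      have "(\<Sum>j\<in>I. \<bar>X n t j - Y t j\<bar>) \<le> (\<Sum>j\<in>I. d)"
        using elim t by (intro sum_mono) (force simp: dist_real_def)
      then have "(\<Sum>j\<in>I. \<bar>X n t j - Y t j\<bar>) \<le> real (card I) * d" by simp
      from mult_left_mono[OF this L] lip[of "X n t" "Y t"]
      have "\<bar>F (X n t) - F (Y t)\<bar> \<le> L * (real (card I) * d)" by (rule order_trans[rotated])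
      also have "\<dots> < (L * real (card I) + 1) * d" using d by (simp add: algebra_simps)
      also have "\<dots> = e"
      proof -
        have "L * real (card I) + 1 > 0" using L by (intro add_nonneg_pos) auto
        then show ?thesis by (simp add: d_def)
      qed
      finally show "dist (F (X n t)) (F (Y t)) < e" by (simp add: dist_real_def)
    qed
  qed
qed

lemma integral_exp_le:
  fixes A c t :: real
  assumes "A \<ge> 0" "c > 0" "t \<ge> 0"
  shows "integral {0..t} (\<lambda>s. A * exp (c * s)) \<le> A * exp (c * t) / c"
proof -
  have "((\<lambda>s. A * exp (c * s)) has_integral (A * exp (c * t) / c - A * exp (c * 0) / c)) {0..t}"
    using assms
    by (intro fundamental_theorem_of_calculus)
       (auto intro!: derivative_eq_intros simp flip: has_real_derivative_iff_has_vector_derivative)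
  from integral_unique[OF this] show ?thesis using assms by simp
qed

text \<open>Picard iteration. On bounded time intervals the iterates converge geometrically when their
  differences are measured with the weight \<open>exp (- c t)\<close>, where \<open>c\<close> exceeds twice the Lipschitz constant
  of the field in the sum norm. So no subdivision of the time interval is required.\<close>

theorem global_solution_exists:
  fixes F :: "('a \<Rightarrow> real) \<Rightarrow> 'a \<Rightarrow> real"
  assumes I: "finite I" and L: "L \<ge> 0"
    and lip: "\<And>x y i. i \<in> I \<Longrightarrow> \<bar>F x i - F y i\<bar> \<le> L * (\<Sum>j\<in>I. \<bar>x j - y j\<bar>)"
  shows "\<exists>x. (\<forall>i\<in>I. x 0 i = x0 i) \<and>
    (\<forall>t\<ge>0. \<forall>i\<in>I. ((\<lambda>t. x t i) has_real_derivative F (x t) i) (at t within {0..}))"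
proof -
  define X where "X = rec_nat (\<lambda>t :: real. x0) (\<lambda>n X t i. x0 i + integral {0..t} (\<lambda>s. F (X s) i))"
  have X0: "X 0 t = x0" for t by (simp add: X_def)
  have XS: "X (Suc n) t i = x0 i + integral {0..t} (\<lambda>s. F (X n s) i)" for n t i by (simp add: X_def)
  have contX: "continuous_on {0..T} (\<lambda>t. X n t i)" if "i \<in> I" for n i T
    using that
  proof (induction n arbitrary: i)
    case (Suc n)
    have "continuous_on {0..T} (\<lambda>t. F (X n t) i)"
      by (rule continuous_on_lipschitz_field[OF I]) (use Suc lip in auto)
    then have "(\<lambda>t. F (X n t) i) integrable_on {0..T}" by (rule integrable_continuous_real)
    from indefinite_integral_continuous_1[OF this] show ?case
      unfolding XS by (intro continuous_on_add continuous_on_const)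
  qed (simp add: X0)
  have contF: "continuous_on {0..T} (\<lambda>t. F (X n t) i)" if "i \<in> I" for n i T
    by (rule continuous_on_lipschitz_field[OF I]) (use that contX lip in auto)
  \<comment> \<open>\<open>card I * L\<close> is a Lipschitz constant in the sum norm. With this \<open>c\<close>, each integration halves the bound.\<close>
  define c K where "c = 2 * (real (card I) * L) + 1" and "K = (\<Sum>i\<in>I. \<bar>F x0 i\<bar>)"
  have c: "c \<ge> 1" using L by (simp add: c_def)
  have K: "K \<ge> 0" by (simp add: K_def sum_nonneg)
  have step: "(\<Sum>i\<in>I. \<bar>X (Suc n) t i - X n t i\<bar>) \<le> K * exp (c * t) * (1/2) ^ n" if "t \<ge> 0" for n t
    using that
  proof (induction n arbitrary: t)
    case 0
    have "t \<le> exp (c * t)"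
      using exp_ge_add_one_self[of "c * t"] mult_right_mono[OF c 0] by linarith
    then have "t * K \<le> exp (c * t) * K" using K by (intro mult_right_mono)
    moreover have "(\<Sum>i\<in>I. \<bar>X (Suc 0) t i - X 0 t i\<bar>) = t * K"
      using 0 by (simp add: XS X0 K_def abs_mult sum_distrib_left)
    ultimately show ?case by (simp add: mult.commute)
  next
    case (Suc n)
    define A where "A = L * (K * (1/2) ^ n)"
    have A: "A \<ge> 0" using L K by (simp add: A_def)
    have "\<bar>X (Suc (Suc n)) t i - X (Suc n) t i\<bar> \<le> A * exp (c * t) / c" if i: "i \<in> I" for i
    proof -
      have "X (Suc (Suc n)) t i - X (Suc n) t i = integral {0..t} (\<lambda>s. F (X (Suc n) s) i - F (X n s) i)"
        unfolding XS[of "Suc n" t i] XS[of n t i]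
        by (simp add: integral_diff integrable_continuous_real contF[OF i])
      also have "norm \<dots> \<le> integral {0..t} (\<lambda>s. A * exp (c * s))"
      proof (rule integral_norm_bound_integral)
        show "(\<lambda>s. F (X (Suc n) s) i - F (X n s) i) integrable_on {0..t}"
          using contF[OF i] by (intro integrable_continuous_real continuous_intros)
        show "(\<lambda>s. A * exp (c * s)) integrable_on {0..t}"
          by (intro integrable_continuous_real continuous_intros)
        fix s assume "s \<in> {0..t}"
        then have "(\<Sum>i\<in>I. \<bar>X (Suc n) s i - X n s i\<bar>) \<le> K * exp (c * s) * (1/2) ^ n"
          using Suc.IH by simp
        from mult_left_mono[OF this L] lip[OF i, of "X (Suc n) s" "X n s"]
        have "\<bar>F (X (Suc n) s) i - F (X n s) i\<bar> \<le> L * (K * exp (c * s) * (1/2) ^ n)" by linarith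
        then show "norm (F (X (Suc n) s) i - F (X n s) i) \<le> A * exp (c * s)" by (simp add: A_def mult_ac)
      qed
      also have "\<dots> \<le> A * exp (c * t) / c" using A c Suc.prems by (intro integral_exp_le) auto
      finally show ?thesis by simp
    qed
    then have "(\<Sum>i\<in>I. \<bar>X (Suc (Suc n)) t i - X (Suc n) t i\<bar>) \<le> real (card I) * (A * exp (c * t) / c)"
      by (rule sum_bounded_above)
    also have "\<dots> = (real (card I) * L / c) * (K * exp (c * t) * (1/2) ^ n)"
      by (simp add: A_def)
    also have "\<dots> \<le> (1/2) * (K * exp (c * t) * (1/2) ^ n)"
      using c K by (intro mult_right_mono) (auto simp: c_def field_simps)
    finally show ?case by simp
  qed
  define Y where "Y = (\<lambda>t i. x0 i + suminf (\<lambda>n. X (Suc n) t i - X n t i))"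
  have lim: "uniform_limit {0..T} (\<lambda>n t. X n t i) (\<lambda>t. Y t i) sequentially" if i: "i \<in> I" for i T
  proof -
    have "uniform_limit {0..T} (\<lambda>n t. \<Sum>m<n. X (Suc m) t i - X m t i) (\<lambda>t. suminf (\<lambda>m. X (Suc m) t i - X m t i)) sequentially"
    proof (rule Weierstrass_m_test_ev[OF always_eventually])
      show "\<forall>n. \<forall>t\<in>{0..T}. norm (X (Suc n) t i - X n t i) \<le> K * exp (c * T) * (1/2) ^ n"
      proof (intro allI ballI)
        fix n t assume t: "t \<in> {0..T}"
        have "norm (X (Suc n) t i - X n t i) \<le> (\<Sum>i\<in>I. \<bar>X (Suc n) t i - X n t i\<bar>)"
          using member_le_sum[OF i, of "\<lambda>i. \<bar>X (Suc n) t i - X n t i\<bar>"] I by simp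
        also have "\<dots> \<le> K * exp (c * t) * (1/2) ^ n" using step t by simp
        also have "\<dots> \<le> K * exp (c * T) * (1/2) ^ n"
          using t c K by (intro mult_right_mono mult_left_mono) auto
        finally show "norm (X (Suc n) t i - X n t i) \<le> K * exp (c * T) * (1/2) ^ n" .
      qed
      show "summable (\<lambda>n. K * exp (c * T) * (1/2) ^ n)"
        by (intro summable_mult summable_geometric) simp
    qed
    then have "uniform_limit {0..T} (\<lambda>n t. x0 i + (\<Sum>m<n. X (Suc m) t i - X m t i)) (\<lambda>t. Y t i) sequentially"
      unfolding Y_def by (intro uniform_limit_intros)
    moreover have "x0 i + (\<Sum>m<n. X (Suc m) t i - X m t i) = X n t i" for n t
      using sum_lessThan_telescope[of "\<lambda>n. X n t i" n] by (simp add: X0)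
    ultimately show ?thesis by simp
  qed
  have contY: "continuous_on {0..T} (\<lambda>t. F (Y t) i)" if "i \<in> I" for i T
  proof (rule continuous_on_lipschitz_field[where F = "\<lambda>x. F x i", OF I lip[OF that]])
    fix j assume j: "j \<in> I"
    show "continuous_on {0..T} (\<lambda>t. Y t j)"
      by (rule uniform_limit_theorem[OF _ lim[OF j]]) (use contX[OF j] in auto)
  qed
  have fixed: "Y t i = x0 i + integral {0..t} (\<lambda>s. F (Y s) i)" if i: "i \<in> I" and t: "t \<ge> 0" for i t
  proof -
    have "uniform_limit {0..t} (\<lambda>n s. F (X n s) i) (\<lambda>s. F (Y s) i) sequentially"
      by (rule uniform_limit_lipschitz_field[OF I L]) (use i lip lim in auto)
    from uniform_limit_integral[OF this contF[OF i]]
    obtain Z J where Z: "\<And>n. ((\<lambda>s. F (X n s) i) has_integral Z n) {0..t}"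
      and J: "((\<lambda>s. F (Y s) i) has_integral J) {0..t}" "Z \<longlonglongrightarrow> J" by auto
    have "(\<lambda>n. X (Suc n) t i) \<longlonglongrightarrow> x0 i + J"
      unfolding XS using integral_unique[OF Z] J(2) by (auto intro!: tendsto_intros)
    moreover have "(\<lambda>n. X (Suc n) t i) \<longlonglongrightarrow> Y t i"
      using LIMSEQ_Suc[OF tendsto_uniform_limitI[OF lim[OF i], of t t]] t by simp
    ultimately have "Y t i = x0 i + J" using LIMSEQ_unique by blast
    then show ?thesis using integral_unique[OF J(1)] by simp
  qed
  have "((\<lambda>t. Y t i) has_real_derivative F (Y t) i) (at t within {0..})" if i: "i \<in> I" and t: "t \<ge> 0" for i t
  proof -
    have "((\<lambda>s. x0 i + integral {0..s} (\<lambda>s. F (Y s) i)) has_real_derivative F (Y t) i) (at t within {0..t+1})"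
      using integral_has_real_derivative[OF contY[OF i], of t "t+1"] t
      by (auto intro!: derivative_eq_intros)
    then have "((\<lambda>t. Y t i) has_real_derivative F (Y t) i) (at t within {0..t+1})"
      by (rule has_field_derivative_transform_within[where d = 1]) (use t fixed[OF i] in auto)
    moreover have "at t within {0..t+1} = at t within {0..}"
      by (rule at_within_nhd[where S = "{..<t+1}"]) auto
    ultimately show ?thesis by simp
  qed
  moreover have "Y 0 i = x0 i" if "i \<in> I" for i using fixed[OF that, of 0] by simp
  ultimately show ?thesis by blast
qed

text \<open>By the Lipschitz condition, the squared Euclidean distance \<open>\<phi>\<close> of two solutions satisfies
  \<open>\<phi>' \<le> c \<phi>\<close>, so that \<open>exp (- c t) \<phi> t\<close> decreases.\<close>

theorem solutions_unique:
  fixes F :: "('a \<Rightarrow> real) \<Rightarrow> 'a \<Rightarrow> real" and T :: real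
  assumes I: "finite I" and L: "L \<ge> 0"
    and lip: "\<And>x y i. i \<in> I \<Longrightarrow> \<bar>F x i - F y i\<bar> \<le> L * (\<Sum>j\<in>I. \<bar>x j - y j\<bar>)"
    and x: "\<And>t i. t \<in> {0..T} \<Longrightarrow> i \<in> I \<Longrightarrow> ((\<lambda>t. x t i) has_real_derivative F (x t) i) (at t within {0..T})"
    and y: "\<And>t i. t \<in> {0..T} \<Longrightarrow> i \<in> I \<Longrightarrow> ((\<lambda>t. y t i) has_real_derivative F (y t) i) (at t within {0..T})"
    and init: "\<And>i. i \<in> I \<Longrightarrow> x 0 i = y 0 i" and T: "T \<ge> 0" and i: "i \<in> I"
  shows "x T i = y T i"
proof -
  define \<phi> where "\<phi> = (\<lambda>t. \<Sum>i\<in>I. (x t i - y t i)\<^sup>2)"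
  define \<phi>' where "\<phi>' = (\<lambda>t. \<Sum>i\<in>I. 2 * (x t i - y t i) * (F (x t) i - F (y t) i))"
  define c where "c = 2 * L * real (card I)"
  have d\<phi>: "(\<phi> has_real_derivative \<phi>' t) (at t within {0..T})" if "t \<in> {0..T}" for t
    unfolding \<phi>_def \<phi>'_def using x[OF that] y[OF that]
    by (auto intro!: derivative_eq_intros simp: algebra_simps)
  have le: "\<phi>' t \<le> c * \<phi> t" for t
  proof -
    define S where "S = (\<Sum>j\<in>I. \<bar>x t j - y t j\<bar>)"
    have "\<phi>' t \<le> (\<Sum>i\<in>I. 2 * \<bar>x t i - y t i\<bar> * (L * S))"
      unfolding \<phi>'_def
    proof (rule sum_mono)
      fix i assume "i \<in> I"
      have "2 * (x t i - y t i) * (F (x t) i - F (y t) i) \<le> 2 * \<bar>x t i - y t i\<bar> * \<bar>F (x t) i - F (y t) i\<bar>"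
        using abs_ge_self[of "(x t i - y t i) * (F (x t) i - F (y t) i)"] unfolding abs_mult mult.assoc
        by linarith
      also have "\<dots> \<le> 2 * \<bar>x t i - y t i\<bar> * (L * S)"
        using lip[OF \<open>i \<in> I\<close>, of "x t" "y t"] by (intro mult_left_mono) (auto simp: S_def)
      finally show "2 * (x t i - y t i) * (F (x t) i - F (y t) i) \<le> 2 * \<bar>x t i - y t i\<bar> * (L * S)" .
    qed
    also have "\<dots> = 2 * L * S\<^sup>2"
      by (simp add: S_def power2_eq_square sum_distrib_right[symmetric] sum_distrib_left[symmetric] mult_ac)
    also have "\<dots> \<le> 2 * L * ((\<Sum>j\<in>I. \<bar>x t j - y t j\<bar>\<^sup>2) * real (card I))"
      unfolding S_def using L sum_squared_le_sum_of_squares[of "\<lambda>j. \<bar>x t j - y t j\<bar>" I]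
      by (intro mult_left_mono) auto
    also have "\<dots> = c * \<phi> t" by (simp add: c_def \<phi>_def mult_ac)
    finally show ?thesis .
  qed
  define \<psi> where "\<psi> = (\<lambda>t. exp (- c * t) * \<phi> t)"
  have "(\<psi> has_real_derivative exp (- c * t) * (\<phi>' t - c * \<phi> t)) (at t within {0..T})" if "t \<in> {0..T}" for t
    unfolding \<psi>_def using d\<phi>[OF that] by (auto intro!: derivative_eq_intros simp: algebra_simps)
  then have "\<exists>t\<in>{0..T}. \<psi> T - \<psi> 0 = (exp (- c * t) * (\<phi>' t - c * \<phi> t)) * (T - 0)"
    using mvt_very_simple[OF T, of \<psi> "\<lambda>t. (*) (exp (- c * t) * (\<phi>' t - c * \<phi> t))"]
    by (auto simp: has_field_derivative_def)
  then obtain t where t: "\<psi> T - \<psi> 0 = (exp (- c * t) * (\<phi>' t - c * \<phi> t)) * (T - 0)" by blast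
  have "exp (- c * t) * (\<phi>' t - c * \<phi> t) \<le> 0" using le[of t] by (intro mult_nonneg_nonpos) auto
  from mult_nonpos_nonneg[OF this T] have "\<psi> T \<le> \<psi> 0" using t by simp
  moreover have "\<psi> 0 = 0" using init by (simp add: \<psi>_def \<phi>_def)
  ultimately have "\<phi> T \<le> 0" by (simp add: \<psi>_def mult_le_0_iff)
  then have "\<phi> T = 0" unfolding \<phi>_def by (intro antisym sum_nonneg) auto
  then show ?thesis using i I by (simp add: \<phi>_def sum_nonneg_eq_0_iff)
qed

section \<open>Derivatives of the total curvature of an arc\<close>

text \<open>The total geodesic curvature of the arc of \<open>cycle_point\<close> with parameters in \<open>[0,u]\<close> on a curve of
  curvature \<open>exp s\<close>.\<close>

definition arc_total :: "real \<Rightarrow> real \<Rightarrow> real" where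
  "arc_total s u = exp s * arc_integral (exp s) u"

text \<open>The part of the derivative of \<open>arc_total\<close> with respect to \<open>s\<close> that remains after an integration by
  parts.\<close>

definition arc_tail :: "real \<Rightarrow> real \<Rightarrow> real" where
  "arc_tail s u = integral {0..u} (\<lambda>x. 2 * exp s * x\<^sup>2 / (1 + ((exp s)\<^sup>2 - 1) * x\<^sup>2))"

lemma continuous_on_arc_tail_integrand:
  fixes s u :: real
  assumes "u \<le> 1"
  shows "continuous_on {0..u} (\<lambda>x. 2 * exp s * x\<^sup>2 / (1 + ((exp s)\<^sup>2 - 1) * x\<^sup>2))"
  using cycle_density_pos[of "exp s"] assms by (intro continuous_intros) force

lemma arc_total_has_derivative_limit:
  assumes u: "0 < u" "u < 1"
  shows "(arc_total s has_real_derivative 2 * exp s / (1 + ((exp s)\<^sup>2 - 1) * u\<^sup>2)) (at u)"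
proof -
  have "(arc_integral (exp s) has_real_derivative 2 / (1 + ((exp s)\<^sup>2 - 1) * u\<^sup>2)) (at u within {0..1})"
    using u by (intro arc_integral_has_derivative) auto
  then have "(arc_integral (exp s) has_real_derivative 2 / (1 + ((exp s)\<^sup>2 - 1) * u\<^sup>2)) (at u)"
    using u at_within_interior[of u "{0..1}"] by simp
  from DERIV_cmult[OF this, of "exp s"] show ?thesis
    unfolding arc_total_def by (simp add: mult.commute[of "exp s" 2])
qed

lemma arc_tail_has_derivative_limit:
  assumes u: "0 < u" "u < 1"
  shows "(arc_tail s has_real_derivative 2 * exp s * u\<^sup>2 / (1 + ((exp s)\<^sup>2 - 1) * u\<^sup>2)) (at u)"
proof -
  have "(arc_tail s has_real_derivative 2 * exp s * u\<^sup>2 / (1 + ((exp s)\<^sup>2 - 1) * u\<^sup>2)) (at u within {0..1})"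
    unfolding arc_tail_def
    by (rule integral_has_real_derivative[OF continuous_on_arc_tail_integrand]) (use u in auto)
  then show ?thesis using u at_within_interior[of u "{0..1}"] by simp
qed

text \<open>Differentiate under the integral sign. The derivative of the integrand is the sum of the integrand
  of \<open>arc_tail\<close> and the derivative of an elementary function. In this form, the result and its
  variation with \<open>s\<close> are easy to bound uniformly in \<open>s\<close>.\<close>

lemma arc_total_has_derivative_curvature:
  assumes u: "0 < u" "u < 1"
  shows "((\<lambda>s. arc_total s u) has_real_derivative
     2 * exp s * u * (1 - u\<^sup>2) / (1 + ((exp s)\<^sup>2 - 1) * u\<^sup>2) + arc_tail s u) (at s)"
proof -
  define D where "D = (\<lambda>s x :: real. 1 + ((exp s)\<^sup>2 - 1) * x\<^sup>2)"
  define G where "G = (\<lambda>s x. 2 * exp s * (1 - ((exp s)\<^sup>2 + 1) * x\<^sup>2) / (D s x)\<^sup>2)"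
  have D: "D s x > 0" if "x \<in> {0..u}" for s x
    using cycle_density_pos[of "exp s" x] that u by (simp add: D_def)
  have D0: "1 + ((exp s)\<^sup>2 - 1) * x\<^sup>2 \<noteq> 0" if "x \<in> {0..u}" for s x :: real
    using D[OF that, of s] unfolding D_def by linarith
  have 1: "arc_total s u = integral (cbox 0 u) (\<lambda>x. 2 * exp s / D s x)" for s
    unfolding arc_total_def arc_integral_def D_def
    unfolding integral_mult_right[symmetric] by (simp add: mult.commute[of "exp s" 2])
  have "((\<lambda>s. integral (cbox 0 u) (\<lambda>x. 2 * exp s / D s x)) has_real_derivative integral (cbox 0 u) (G s)) (at s)"
  proof (rule leibniz_rule_field_derivative[where U = UNIV])
    fix s x :: real assume x: "x \<in> cbox 0 u"
    then have "D s x \<noteq> 0" using D[of x s] by auto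
    then show "((\<lambda>s. 2 * exp s / D s x) has_real_derivative G s x) (at s)"
      unfolding G_def D_def
      by (auto intro!: derivative_eq_intros) (simp add: field_simps power2_eq_square)
  next
    fix s show "(\<lambda>x. 2 * exp s / D s x) integrable_on cbox 0 u"
      unfolding D_def box_real
      by (intro integrable_continuous_real continuous_intros ballI) (rule D0)
  next
    show "continuous_on (UNIV \<times> cbox 0 u) (\<lambda>(s, x). G s x)"
      unfolding G_def D_def split_def by (intro continuous_intros) (use D0 in auto)
  qed auto
  moreover have "integral (cbox 0 u) (G s) = 2 * exp s * u * (1 - u\<^sup>2) / D s u + arc_tail s u"
  proof -
    have "((\<lambda>x. 2 * exp s * x * (1 - x\<^sup>2) / D s x) has_real_derivative
        G s x - 2 * exp s * x\<^sup>2 / D s x) (at x within {0..u})" if x: "x \<in> {0..u}" for x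
    proof -
      have D_nz: "D s x \<noteq> 0" using D[OF x, of s] by simp
      have num: "((\<lambda>x. 2 * exp s * x * (1 - x\<^sup>2)) has_real_derivative 2 * exp s * (1 - 3 * x\<^sup>2)) (at x within {0..u})"
        by (auto intro!: derivative_eq_intros simp: power2_eq_square algebra_simps)
      have den: "(D s has_real_derivative 2 * ((exp s)\<^sup>2 - 1) * x) (at x within {0..u})"
        unfolding D_def by (auto intro!: derivative_eq_intros)
      have "2 * exp s * (1 - 3 * x\<^sup>2) * D s x - 2 * exp s * x * (1 - x\<^sup>2) * (2 * ((exp s)\<^sup>2 - 1) * x)
          = 2 * exp s * (1 - ((exp s)\<^sup>2 + 1) * x\<^sup>2) - 2 * exp s * x\<^sup>2 * D s x"
        by (simp add: D_def power2_eq_square algebra_simps)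
      moreover have "G s x - 2 * exp s * x\<^sup>2 / D s x =
          (2 * exp s * (1 - ((exp s)\<^sup>2 + 1) * x\<^sup>2) - 2 * exp s * x\<^sup>2 * D s x) / (D s x * D s x)"
        using D_nz by (simp add: G_def power2_eq_square diff_divide_distrib)
      ultimately show ?thesis using DERIV_divide[OF num den D_nz] by simp
    qed
    then have "((\<lambda>x. G s x - 2 * exp s * x\<^sup>2 / D s x) has_integral
        (2 * exp s * u * (1 - u\<^sup>2) / D s u - 2 * exp s * 0 * (1 - 0\<^sup>2) / D s 0)) {0..u}"
      using u by (intro fundamental_theorem_of_calculus)
        (auto simp flip: has_real_derivative_iff_has_vector_derivative)
    moreover have "((\<lambda>x. 2 * exp s * x\<^sup>2 / D s x) has_integral arc_tail s u) {0..u}"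
      unfolding arc_tail_def D_def using u
      by (intro integrable_integral integrable_continuous_real continuous_on_arc_tail_integrand) auto
    ultimately have "((\<lambda>x. G s x - 2 * exp s * x\<^sup>2 / D s x + 2 * exp s * x\<^sup>2 / D s x) has_integral
        (2 * exp s * u * (1 - u\<^sup>2) / D s u - 2 * exp s * 0 * (1 - 0\<^sup>2) / D s 0) + arc_tail s u) {0..u}"
      by (rule has_integral_add)
    then have "(G s has_integral 2 * exp s * u * (1 - u\<^sup>2) / D s u + arc_tail s u) {0..u}" by simp
    then show ?thesis by (simp add: integral_unique)
  qed
  ultimately show ?thesis unfolding 1 by (simp add: D_def)
qed

text \<open>The chain rule for a limit \<open>u s\<close> that varies with the curvature.\<close>

lemma arc_total_has_derivative:
  assumes u: "0 < u s" "u s < 1" and u': "(u has_real_derivative u') (at s)"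
  shows "((\<lambda>s. arc_total s (u s)) has_real_derivative
     (2 * exp s * u s * (1 - (u s)\<^sup>2) / (1 + ((exp s)\<^sup>2 - 1) * (u s)\<^sup>2) + arc_tail s (u s))
     + 2 * exp s / (1 + ((exp s)\<^sup>2 - 1) * (u s)\<^sup>2) * u') (at s)"
proof -
  define g where "g = (\<lambda>s x :: real. 2 * exp s / (1 + ((exp s)\<^sup>2 - 1) * x\<^sup>2))"
  define A where "A = 2 * exp s * u s * (1 - (u s)\<^sup>2) / (1 + ((exp s)\<^sup>2 - 1) * (u s)\<^sup>2) + arc_tail s (u s)"
  have "((\<lambda>(s, x). arc_total s x) has_derivative
      (\<lambda>(tx, ty). A * tx + blinfun_apply (g s (u s) *\<^sub>R id_blinfun) ty)) (at (s, u s) within UNIV \<times> {0<..<1})"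
  proof (rule has_derivative_partialsI)
    show "((\<lambda>x. arc_total x (u s)) has_derivative (*) A) (at s)"
      using arc_total_has_derivative_curvature[OF u] by (simp add: has_field_derivative_def A_def)
    show "((\<lambda>y. arc_total x y) has_derivative blinfun_apply (g x y *\<^sub>R id_blinfun)) (at y within {0<..<1})"
      if "y \<in> {0<..<1}" for x y
    proof -
      have "blinfun_apply (g x y *\<^sub>R id_blinfun) = (*) (g x y)"
        by (auto simp: fun_eq_iff scaleR_blinfun.rep_eq)
      then show ?thesis
        using arc_total_has_derivative_limit[of y x] that
        by (simp add: has_field_derivative_def g_def has_derivative_at_withinI)
    qed
    have "1 + ((exp x)\<^sup>2 - 1) * y\<^sup>2 \<noteq> 0" if "y \<in> {0<..<1}" for x y :: real
      using cycle_density_pos[of "exp x" y] that by auto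
    then have "continuous_on (UNIV \<times> {0<..<1}) (\<lambda>(x, y). g x y *\<^sub>R (id_blinfun :: real \<Rightarrow>\<^sub>L real))"
      unfolding g_def split_def by (intro continuous_intros) auto
    then show "continuous (at (s, u s) within UNIV \<times> {0<..<1})
        (\<lambda>(x, y). g x y *\<^sub>R (id_blinfun :: real \<Rightarrow>\<^sub>L real))"
      using u by (simp add: continuous_on_eq_continuous_within)
  qed (use u in auto)
  moreover have "at (s, u s) within UNIV \<times> {0<..<1} = at (s, u s)"
    using u by (intro at_within_open open_Times) auto
  ultimately have F: "((\<lambda>(s, x). arc_total s x) has_derivative
      (\<lambda>(tx, ty). A * tx + blinfun_apply (g s (u s) *\<^sub>R id_blinfun) ty)) (at (s, u s))" by simp
  have "((\<lambda>s. (s, u s)) has_derivative (\<lambda>t. (t, u' * t))) (at s)"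
    using u' by (auto intro!: derivative_eq_intros simp: has_field_derivative_def)
  from has_derivative_compose[OF this F]
  have "((\<lambda>s. arc_total s (u s)) has_derivative
      (\<lambda>t. A * t + blinfun_apply (g s (u s) *\<^sub>R id_blinfun) (u' * t))) (at s)" by simp
  moreover have "(\<lambda>t. A * t + blinfun_apply (g s (u s) *\<^sub>R id_blinfun) (u' * t)) = (*) (A + g s (u s) * u')"
    by (auto simp: fun_eq_iff scaleR_blinfun.rep_eq algebra_simps)
  ultimately show ?thesis by (simp add: has_field_derivative_def A_def g_def)
qed

section \<open>Bounds uniform in the curvatures\<close>

text \<open>If \<open>exp (2 \<sigma>)\<close> is the sum of the products of two of the three curvatures, then
  \<open>sinh r = exp (- \<sigma>)\<close> for the radius \<open>r\<close> of the dual circle, and \<open>dual_tanh \<sigma> = tanh r\<close>.\<close>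

definition dual_tanh :: "real \<Rightarrow> real" where
  "dual_tanh \<sigma> = 1 / sqrt (1 + exp (2 * \<sigma>))"

text \<open>This is \<open>1 / cosh r\<close>.\<close>

definition dual_weight :: "real \<Rightarrow> real" where
  "dual_weight \<sigma> = exp \<sigma> * dual_tanh \<sigma>"

text \<open>The rate at which an arc loses total curvature as \<open>\<sigma>\<close> grows. In terms of \<open>\<sigma>\<close>, the total curvature of
  an arc is the integral of \<open>arc_rate s\<close> over \<open>[\<sigma>, \<infinity>)\<close>.\<close>

definition arc_rate :: "real \<Rightarrow> real \<Rightarrow> real" where
  "arc_rate s \<sigma> = dual_weight \<sigma> * (1 / cosh (\<sigma> - s))"

lemma dual_tanh_square: "(dual_tanh \<sigma>)\<^sup>2 = 1 / (1 + (exp \<sigma>)\<^sup>2)"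
proof -
  have "1 + exp (2 * \<sigma>) > 0" by (simp add: add_pos_pos)
  then show ?thesis by (simp add: dual_tanh_def power_divide exp_double)
qed

lemma dual_tanh_bounds: "0 < dual_tanh \<sigma>" "dual_tanh \<sigma> < 1"
proof -
  have *: "0 < 1 / r \<and> 1 / r < 1" if "r > 1" for r :: real using that by simp
  have "sqrt (1 + exp (2 * \<sigma>)) > 1" by simp
  from *[OF this] show "0 < dual_tanh \<sigma>" "dual_tanh \<sigma> < 1" by (simp_all only: dual_tanh_def)
qed

lemma dual_weight_square: "(dual_weight \<sigma>)\<^sup>2 = 1 - (dual_tanh \<sigma>)\<^sup>2"
proof -
  have "1 + (exp \<sigma>)\<^sup>2 > 0" by (simp add: add_pos_nonneg)
  then show ?thesis
    by (simp add: dual_weight_def power_mult_distrib dual_tanh_square field_simps)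
qed

lemma dual_weight_bounds: "0 < dual_weight \<sigma>" "dual_weight \<sigma> \<le> 1"
proof -
  show "0 < dual_weight \<sigma>" using dual_tanh_bounds by (simp add: dual_weight_def)
  have "(dual_weight \<sigma>)\<^sup>2 \<le> 1\<^sup>2" by (simp add: dual_weight_square)
  then show "dual_weight \<sigma> \<le> 1" by (rule power2_le_imp_le) simp
qed

lemma dual_tanh_has_derivative:
  "(dual_tanh has_real_derivative - (dual_tanh \<sigma> * (1 - (dual_tanh \<sigma>)\<^sup>2))) (at \<sigma>)"
proof -
  define r where "r = sqrt (1 + exp (2 * \<sigma>))"
  have pos: "1 + exp (2 * \<sigma>) > 0" by (simp add: add_pos_pos)
  then have r: "r > 0" "r\<^sup>2 = 1 + exp (2 * \<sigma>)" by (simp_all add: r_def)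
  have "((\<lambda>\<sigma>. sqrt (1 + exp (2 * \<sigma>))) has_real_derivative exp (2 * \<sigma>) / r) (at \<sigma>)"
    using pos by (auto intro!: derivative_eq_intros simp: r_def field_simps)
  from DERIV_inverse'[OF this]
  have "((\<lambda>\<sigma>. inverse (sqrt (1 + exp (2 * \<sigma>)))) has_real_derivative
      - (inverse r * (exp (2 * \<sigma>) / r) * inverse r)) (at \<sigma>)"
    using r(1) by (simp add: r_def)
  moreover have "inverse r * (exp (2 * \<sigma>) / r) * inverse r = (1 / r) * (1 - (1 / r)\<^sup>2)"
  proof -
    have E: "exp (2 * \<sigma>) = r\<^sup>2 - 1" using r by simp
    show ?thesis unfolding E using r(1) by (simp add: field_simps power2_eq_square)
  qed
  ultimately have "((\<lambda>\<sigma>. inverse (sqrt (1 + exp (2 * \<sigma>)))) has_real_derivative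
      - ((1 / r) * (1 - (1 / r)\<^sup>2))) (at \<sigma>)" by (simp only:)
  then show ?thesis
    by (simp add: dual_tanh_def[abs_def] divide_inverse flip: r_def)
qed

lemma dual_weight_has_derivative:
  "(dual_weight has_real_derivative dual_weight \<sigma> * (dual_tanh \<sigma>)\<^sup>2) (at \<sigma>)"
  unfolding dual_weight_def[abs_def]
  by (auto intro!: derivative_eq_intros dual_tanh_has_derivative simp: algebra_simps)

text \<open>In the variables \<open>w = exp \<sigma>\<close> and \<open>k = exp s\<close>, both sides are \<open>2 k w\<^sup>2 u / (w\<^sup>2 + k\<^sup>2)\<close>.\<close>

lemma arc_rate_eq:
  "2 * exp s * dual_tanh \<sigma> * (1 - (dual_tanh \<sigma>)\<^sup>2) / (1 + ((exp s)\<^sup>2 - 1) * (dual_tanh \<sigma>)\<^sup>2)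
    = arc_rate s \<sigma>"
proof -
  define w k u where "w = exp \<sigma>" and "k = exp s" and "u = dual_tanh \<sigma>"
  have pos: "w > 0" "k > 0" "u > 0" using dual_tanh_bounds by (simp_all add: w_def k_def u_def)
  then have w1: "1 + w\<^sup>2 > 0" by (simp add: add_pos_nonneg)
  have u2: "u\<^sup>2 = 1 / (1 + w\<^sup>2)" by (simp add: u_def w_def dual_tanh_square)
  have 1: "1 - u\<^sup>2 = w\<^sup>2 * u\<^sup>2" unfolding u2 using w1 by (simp add: field_simps)
  have 2: "1 + (k\<^sup>2 - 1) * u\<^sup>2 = (w\<^sup>2 + k\<^sup>2) * u\<^sup>2" unfolding u2 using w1 by (simp add: field_simps)
  have "cosh (\<sigma> - s) = (w / k + k / w) / 2"
    by (simp add: cosh_def w_def k_def exp_diff)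
  also have "\<dots> = (w\<^sup>2 + k\<^sup>2) / (2 * w * k)" using pos by (simp add: field_simps power2_eq_square)
  finally have "arc_rate s \<sigma> = w * u * (2 * w * k) / (w\<^sup>2 + k\<^sup>2)"
    by (simp add: arc_rate_def dual_weight_def w_def u_def)
  moreover have "2 * k * u * (w\<^sup>2 * u\<^sup>2) / ((w\<^sup>2 + k\<^sup>2) * u\<^sup>2) = w * u * (2 * w * k) / (w\<^sup>2 + k\<^sup>2)"
    using pos by (simp add: power2_eq_square mult_ac)
  ultimately show ?thesis unfolding w_def[symmetric] k_def[symmetric] u_def[symmetric] 1 2 by simp
qed

lemma arc_rate_bounds: "0 \<le> arc_rate s \<sigma>" "arc_rate s \<sigma> \<le> 1"
proof -
  have c: "1 / cosh (\<sigma> - s) \<ge> 0" "1 / cosh (\<sigma> - s) \<le> 1"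
    using cosh_real_ge_1[of "\<sigma> - s"] by simp_all
  show "0 \<le> arc_rate s \<sigma>" "arc_rate s \<sigma> \<le> 1"
    using c dual_weight_bounds[of \<sigma>] mult_mono[of "dual_weight \<sigma>" 1 "1 / cosh (\<sigma> - s)" 1]
    by (simp_all add: arc_rate_def)
qed

lemma arc_total_dual_has_derivative:
  assumes "(\<sigma> has_real_derivative \<sigma>') (at s)"
  shows "((\<lambda>s. arc_total s (dual_tanh (\<sigma> s))) has_real_derivative
    arc_rate s (\<sigma> s) * (1 - \<sigma>') + arc_tail s (dual_tanh (\<sigma> s))) (at s)"
proof -
  let ?u = "dual_tanh (\<sigma> s)"
  have "((\<lambda>s. dual_tanh (\<sigma> s)) has_real_derivative - (?u * (1 - ?u\<^sup>2)) * \<sigma>') (at s)"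
    by (rule DERIV_chain2[OF dual_tanh_has_derivative assms])
  from arc_total_has_derivative[OF dual_tanh_bounds this]
  have "((\<lambda>s. arc_total s (dual_tanh (\<sigma> s))) has_real_derivative
     (2 * exp s * ?u * (1 - ?u\<^sup>2) / (1 + ((exp s)\<^sup>2 - 1) * ?u\<^sup>2) + arc_tail s ?u)
     + 2 * exp s / (1 + ((exp s)\<^sup>2 - 1) * ?u\<^sup>2) * (- (?u * (1 - ?u\<^sup>2)) * \<sigma>')) (at s)" .
  moreover have "2 * exp s / (1 + ((exp s)\<^sup>2 - 1) * ?u\<^sup>2) * (- (?u * (1 - ?u\<^sup>2)) * \<sigma>')
      = - (2 * exp s * ?u * (1 - ?u\<^sup>2) / (1 + ((exp s)\<^sup>2 - 1) * ?u\<^sup>2)) * \<sigma>'" by simp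
  ultimately show ?thesis unfolding arc_rate_eq by (simp add: algebra_simps)
qed

lemma arc_total_dual_has_derivative_weight:
  "((\<lambda>\<sigma>. arc_total s (dual_tanh \<sigma>)) has_real_derivative - arc_rate s \<sigma>) (at \<sigma>)"
  using DERIV_chain2[OF arc_total_has_derivative_limit[OF dual_tanh_bounds, of s \<sigma>] dual_tanh_has_derivative]
  unfolding arc_rate_eq[symmetric] by (simp add: mult_ac)

lemma arc_tail_dual_has_derivative_weight:
  "((\<lambda>\<sigma>. arc_tail s (dual_tanh \<sigma>)) has_real_derivative - (dual_tanh \<sigma>)\<^sup>2 * arc_rate s \<sigma>) (at \<sigma>)"
proof -
  let ?u = "dual_tanh \<sigma>"
  have "2 * exp s * ?u\<^sup>2 / (1 + ((exp s)\<^sup>2 - 1) * ?u\<^sup>2) * (- (?u * (1 - ?u\<^sup>2)))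
      = - ?u\<^sup>2 * (2 * exp s * ?u * (1 - ?u\<^sup>2) / (1 + ((exp s)\<^sup>2 - 1) * ?u\<^sup>2))" by simp
  with DERIV_chain2[OF arc_tail_has_derivative_limit[OF dual_tanh_bounds, of s \<sigma>] dual_tanh_has_derivative]
  show ?thesis unfolding arc_rate_eq by simp
qed

text \<open>The denominator is \<open>(1 - x\<^sup>2) + k\<^sup>2 x\<^sup>2\<close>, and the inequality of the means bounds it from below by
  \<open>2 k x sqrt (1 - x\<^sup>2)\<close>. The bound does not depend on \<open>k\<close>, and its integral is at most \<open>1\<close>.\<close>

lemma arc_density_le:
  fixes k x :: real
  assumes k: "k > 0" and x: "0 \<le> x" "x < 1"
  shows "2 * k * x\<^sup>2 / (1 + (k\<^sup>2 - 1) * x\<^sup>2) \<le> x / sqrt (1 - x\<^sup>2)"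
proof -
  define v where "v = sqrt (1 - x\<^sup>2)"
  have x2: "x\<^sup>2 < 1" using x by (simp add: power_less_one_iff abs_square_less_1)
  then have v: "v > 0" "v\<^sup>2 = 1 - x\<^sup>2" by (simp_all add: v_def)
  have D: "1 + (k\<^sup>2 - 1) * x\<^sup>2 = v\<^sup>2 + k\<^sup>2 * x\<^sup>2" unfolding v by (simp add: algebra_simps)
  have Dpos: "v\<^sup>2 + k\<^sup>2 * x\<^sup>2 > 0" using v(1) by (simp add: add_pos_nonneg)
  have "2 * k * x * v \<le> v\<^sup>2 + k\<^sup>2 * x\<^sup>2"
    using zero_le_power2[of "v - k * x"] by (simp add: power2_eq_square algebra_simps)
  from mult_left_mono[OF this x(1)] show ?thesis
    unfolding D v_def[symmetric] using v(1) Dpos by (simp add: field_simps power2_eq_square)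
qed

lemma integral_arc_majorant:
  fixes u :: real
  assumes u: "0 < u" "u < 1"
  shows "((\<lambda>x. x / sqrt (1 - x\<^sup>2)) has_integral 1 - sqrt (1 - u\<^sup>2)) {0..u}"
proof -
  have "((\<lambda>x. - sqrt (1 - x\<^sup>2)) has_real_derivative x / sqrt (1 - x\<^sup>2)) (at x within {0..u})"
    if "x \<in> {0..u}" for x
  proof -
    have "1 - x\<^sup>2 > 0" using that u by (simp add: abs_square_less_1)
    then show ?thesis by (auto intro!: derivative_eq_intros simp: field_simps)
  qed
  then have "((\<lambda>x. x / sqrt (1 - x\<^sup>2)) has_integral (- sqrt (1 - u\<^sup>2) - (- sqrt (1 - 0\<^sup>2)))) {0..u}"
    using u by (intro fundamental_theorem_of_calculus)
      (auto simp flip: has_real_derivative_iff_has_vector_derivative)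
  then show ?thesis by simp
qed

lemma arc_tail_integrable:
  fixes s u :: real
  assumes "u < 1"
  shows "(\<lambda>x. 2 * exp s * x\<^sup>2 / (1 + ((exp s)\<^sup>2 - 1) * x\<^sup>2)) integrable_on {0..u}"
  using assms by (intro integrable_continuous_real continuous_on_arc_tail_integrand) simp

lemma arc_tail_bounds:
  assumes u: "0 < u" "u < 1"
  shows "0 \<le> arc_tail s u" "arc_tail s u \<le> 1"
proof -
  have D: "1 + ((exp s)\<^sup>2 - 1) * x\<^sup>2 > 0" if "x \<in> {0..u}" for x
    using cycle_density_pos[of "exp s" x] that u by simp
  show "0 \<le> arc_tail s u"
    unfolding arc_tail_def
    by (rule integral_nonneg[OF arc_tail_integrable[OF u(2)]])
       (intro divide_nonneg_pos D mult_nonneg_nonneg, auto)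
  have "arc_tail s u \<le> 1 - sqrt (1 - u\<^sup>2)"
    unfolding arc_tail_def
    by (rule has_integral_le[OF integrable_integral[OF arc_tail_integrable[OF u(2)]] integral_arc_majorant[OF u]])
       (use u in \<open>auto intro: arc_density_le\<close>)
  also have "\<dots> \<le> 1" using u by (simp add: abs_square_le_1)
  finally show "arc_tail s u \<le> 1" .
qed

lemma lipschitz_if_derivative_bounded:
  fixes f :: "real \<Rightarrow> real"
  assumes "\<And>x. (f has_real_derivative f' x) (at x)" and "\<And>x. \<bar>f' x\<bar> \<le> C"
  shows "\<bar>f x - f y\<bar> \<le> C * \<bar>x - y\<bar>"
  using field_differentiable_bound[of UNIV f f' C x y] assms by simp

text \<open>The logarithmic derivative of the integrand with respect to \<open>s\<close> lies between \<open>-1\<close> and \<open>1\<close>. So the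
  integrand and its derivative have the same integrable bound.\<close>

lemma arc_tail_lipschitz_curvature:
  assumes u: "0 < u" "u < 1"
  shows "\<bar>arc_tail s u - arc_tail t u\<bar> \<le> \<bar>s - t\<bar>"
proof -
  let ?b = "\<lambda>s x. 2 * exp s * x\<^sup>2 / (1 + ((exp s)\<^sup>2 - 1) * x\<^sup>2)"
  have pw: "\<bar>?b s x - ?b t x\<bar> \<le> \<bar>s - t\<bar> * (x / sqrt (1 - x\<^sup>2))" if x: "x \<in> {0..u}" for x
  proof -
    have D: "1 + ((exp s)\<^sup>2 - 1) * x\<^sup>2 > 0" for s
      using cycle_density_pos[of "exp s" x] x u by simp
    have b: "0 \<le> ?b s x" "?b s x \<le> x / sqrt (1 - x\<^sup>2)" for s
      using D[of s] x u arc_density_le[of "exp s" x] by auto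
    \<comment> \<open>the logarithmic derivative of the integrand\<close>
    let ?q = "\<lambda>s. 1 - 2 * ((exp s)\<^sup>2 * x\<^sup>2) / (1 + ((exp s)\<^sup>2 - 1) * x\<^sup>2)"
    have "\<bar>?b s x - ?b t x\<bar> \<le> (x / sqrt (1 - x\<^sup>2)) * \<bar>s - t\<bar>"
    proof (rule lipschitz_if_derivative_bounded[of "\<lambda>s. ?b s x" "\<lambda>s. ?b s x * ?q s"])
      fix s
      show "((\<lambda>s. ?b s x) has_real_derivative ?b s x * ?q s) (at s)"
        using D[of s]
        by (auto intro!: derivative_eq_intros) (simp add: divide_simps, simp add: power2_eq_square algebra_simps)
      have "(exp s)\<^sup>2 * x\<^sup>2 \<le> 1 + ((exp s)\<^sup>2 - 1) * x\<^sup>2"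
        using x u by (simp add: algebra_simps abs_square_le_1)
      then have "0 \<le> (exp s)\<^sup>2 * x\<^sup>2 / (1 + ((exp s)\<^sup>2 - 1) * x\<^sup>2)"
          "(exp s)\<^sup>2 * x\<^sup>2 / (1 + ((exp s)\<^sup>2 - 1) * x\<^sup>2) \<le> 1" using D[of s] by simp_all
      then have "\<bar>?q s\<bar> \<le> 1" by (simp add: abs_le_iff)
      then have "\<bar>?b s x * ?q s\<bar> \<le> ?b s x * 1"
        unfolding abs_mult abs_of_nonneg[OF b(1)[of s]] using b(1)[of s] by (rule mult_left_mono)
      then show "\<bar>?b s x * ?q s\<bar> \<le> x / sqrt (1 - x\<^sup>2)" using b(2)[of s] by linarith
    qed
    then show ?thesis by (simp add: mult.commute)
  qed
  note int = arc_tail_integrable[OF u(2)]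
  have m: "((\<lambda>x. \<bar>s - t\<bar> * (x / sqrt (1 - x\<^sup>2))) has_integral \<bar>s - t\<bar> * (1 - sqrt (1 - u\<^sup>2))) {0..u}"
    by (rule has_integral_mult_right[OF integral_arc_majorant[OF u]])
  have "arc_tail s u - arc_tail t u = integral {0..u} (\<lambda>x. ?b s x - ?b t x)"
    unfolding arc_tail_def by (rule integral_diff[OF int int, symmetric])
  moreover have "norm (integral {0..u} (\<lambda>x. ?b s x - ?b t x))
      \<le> integral {0..u} (\<lambda>x. \<bar>s - t\<bar> * (x / sqrt (1 - x\<^sup>2)))"
    by (rule integral_norm_bound_integral[OF integrable_diff[OF int int]])
       (use m pw in \<open>auto simp: has_integral_integrable\<close>)
  ultimately have "\<bar>arc_tail s u - arc_tail t u\<bar> \<le> \<bar>s - t\<bar> * (1 - sqrt (1 - u\<^sup>2))"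
    unfolding integral_unique[OF m] real_norm_def by (simp only:)
  also have "\<dots> \<le> \<bar>s - t\<bar> * 1" using u by (intro mult_left_mono) (auto simp: abs_square_le_1)
  finally show ?thesis by simp
qed

text \<open>The integrand increases when it is divided by \<open>sqrt (1 - x\<^sup>2)\<close>, and then it has the elementary
  primitive \<open>2 arctan (k x / sqrt (1 - x\<^sup>2))\<close>.\<close>

lemma arc_total_bounds:
  assumes u: "0 < u" "u < 1"
  shows "0 \<le> arc_total s u" "arc_total s u \<le> pi"
proof -
  define k where "k = exp s"
  have k: "k > 0" by (simp add: k_def)
  have D: "1 + (k\<^sup>2 - 1) * x\<^sup>2 > 0" if "x \<in> {0..u}" for x
    using cycle_density_pos[OF k, of x] that u by simp
  have int: "(\<lambda>x. 2 / (1 + (k\<^sup>2 - 1) * x\<^sup>2)) integrable_on {0..u}"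
    using D by (intro integrable_continuous_real continuous_intros) force
  have "0 \<le> arc_integral k u"
    unfolding arc_integral_def by (rule integral_nonneg[OF int]) (use D in \<open>simp add: less_imp_le\<close>)
  then show "0 \<le> arc_total s u" using k by (simp add: arc_total_def flip: k_def)
  let ?F = "\<lambda>x. 2 * arctan (k * x / sqrt (1 - x\<^sup>2))"
  let ?f = "\<lambda>x. 2 * k / (sqrt (1 - x\<^sup>2) * (1 + (k\<^sup>2 - 1) * x\<^sup>2))"
  have dF: "(?F has_real_derivative ?f x) (at x within {0..u})" if x: "x \<in> {0..u}" for x
  proof -
    define v where "v = sqrt (1 - x\<^sup>2)"
    have "1 - x\<^sup>2 > 0" using x u by (simp add: abs_square_less_1)
    then have v: "v > 0" "v\<^sup>2 = 1 - x\<^sup>2" by (simp_all add: v_def)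
    have dv: "((\<lambda>x. sqrt (1 - x\<^sup>2)) has_real_derivative - x / v) (at x within {0..u})"
      using \<open>1 - x\<^sup>2 > 0\<close> by (auto intro!: derivative_eq_intros simp: v_def field_simps)
    have "((\<lambda>x. k * x / sqrt (1 - x\<^sup>2)) has_real_derivative (k * v - k * x * (- x / v)) / (v * v)) (at x within {0..u})"
      using DERIV_divide[OF _ dv, of "\<lambda>x. k * x" k] v(1)
      by (auto simp: v_def intro!: derivative_eq_intros)
    moreover have "(k * v - k * x * (- x / v)) / (v * v) = k / v ^ 3"
    proof -
      have "k * v - k * x * (- x / v) = k * (v\<^sup>2 + x\<^sup>2) / v"
        using v(1) by (simp add: field_simps power2_eq_square)
      then show ?thesis unfolding v(2) by (simp add: power3_eq_cube)
    qed
    ultimately have "((\<lambda>x. k * x / sqrt (1 - x\<^sup>2)) has_real_derivative k / v ^ 3) (at x within {0..u})" by simp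
    from DERIV_cmult[OF DERIV_chain2[OF DERIV_arctan this], of 2]
    have "(?F has_real_derivative 2 * (inverse (1 + (k * x / v)\<^sup>2) * (k / v ^ 3))) (at x within {0..u})"
      by (simp add: v_def)
    moreover have "1 + (k * x / v)\<^sup>2 = (1 + (k\<^sup>2 - 1) * x\<^sup>2) / v\<^sup>2"
      using v by (simp add: power_divide field_simps power_mult_distrib)
    then have "2 * (inverse (1 + (k * x / v)\<^sup>2) * (k / v ^ 3)) = 2 * k / (v * (1 + (k\<^sup>2 - 1) * x\<^sup>2))"
      using v(1) by (simp only: inverse_divide) (simp add: power3_eq_cube power2_eq_square)
    ultimately show ?thesis by (simp only: v_def)
  qed
  then have I1: "(?f has_integral (?F u - ?F 0)) {0..u}"
    using u by (intro fundamental_theorem_of_calculus)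
      (auto simp flip: has_real_derivative_iff_has_vector_derivative)
  have I2: "((\<lambda>x. k * (2 / (1 + (k\<^sup>2 - 1) * x\<^sup>2))) has_integral k * arc_integral k u) {0..u}"
    unfolding arc_integral_def by (intro has_integral_mult_right integrable_integral int)
  have "k * arc_integral k u \<le> ?F u - ?F 0"
  proof (rule has_integral_le[OF I2 I1])
    fix x assume x: "x \<in> {0..u}"
    have v: "0 < sqrt (1 - x\<^sup>2)" "sqrt (1 - x\<^sup>2) \<le> 1" using x u by (simp_all add: abs_square_less_1)
    then have "sqrt (1 - x\<^sup>2) * (1 + (k\<^sup>2 - 1) * x\<^sup>2) \<le> 1 + (k\<^sup>2 - 1) * x\<^sup>2"
      using D[OF x] by (intro mult_left_le_one_le) auto
    then show "k * (2 / (1 + (k\<^sup>2 - 1) * x\<^sup>2)) \<le> ?f x"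
      using k v D[OF x] by (auto intro!: divide_left_mono simp: mult.commute)
  qed
  also have "\<dots> \<le> pi" using arctan_bounded[of "k * u / sqrt (1 - u\<^sup>2)"] by simp
  finally show "arc_total s u \<le> pi" by (simp add: arc_total_def flip: k_def)
qed

section \<open>Lipschitz estimates in logarithmic coordinates\<close>

lemma product_difference: "a * p - b * q = a * (p - q) + q * (a - b)" for a b p q :: real
  by (simp add: algebra_simps)

lemma abs_diff_triangle: "\<bar>a - c\<bar> \<le> \<bar>a - b\<bar> + \<bar>b - c\<bar>" for a b c :: real
  using abs_triangle_ineq[of "a - b" "b - c"] by simp

text \<open>Both factors of \<open>arc_rate\<close> are bounded by \<open>1\<close> and have derivatives bounded by \<open>1\<close>.\<close>

lemma arc_rate_lipschitz: "\<bar>arc_rate s \<sigma> - arc_rate t \<tau>\<bar> \<le> 2 * (\<bar>s - t\<bar> + \<bar>\<sigma> - \<tau>\<bar>)"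
proof -
  define P :: "real \<Rightarrow> real" where "P = (\<lambda>x. 1 / cosh x)"
  have P: "0 \<le> P x" "P x \<le> 1" for x using cosh_real_ge_1[of x] by (simp_all add: P_def)
  have 1: "\<bar>P x - P y\<bar> \<le> 1 * \<bar>x - y\<bar>" for x y
  proof (rule lipschitz_if_derivative_bounded[where f' = "\<lambda>x. - sinh x / (cosh x * cosh x)"])
    fix x
    show "(P has_real_derivative - sinh x / (cosh x * cosh x)) (at x)"
      unfolding P_def by (auto intro!: derivative_eq_intros)
    have c: "cosh x \<ge> 1" by (rule cosh_real_ge_1)
    have "(sinh x)\<^sup>2 \<le> (cosh x)\<^sup>2" by (simp add: cosh_square_eq)
    then have "\<bar>sinh x\<bar> \<le> cosh x" using c by (simp add: abs_le_square_iff[symmetric])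
    also have "cosh x \<le> cosh x * cosh x" using c mult_left_mono[of 1 "cosh x" "cosh x"] by simp
    finally show "\<bar>- sinh x / (cosh x * cosh x)\<bar> \<le> 1" using c by (simp add: abs_mult)
  qed
  have 2: "\<bar>dual_weight \<sigma> - dual_weight \<tau>\<bar> \<le> 1 * \<bar>\<sigma> - \<tau>\<bar>"
  proof (rule lipschitz_if_derivative_bounded[OF dual_weight_has_derivative])
    fix x
    have "(dual_tanh x)\<^sup>2 \<le> 1" using dual_tanh_bounds[of x] by (simp add: abs_square_le_1)
    then have "dual_weight x * (dual_tanh x)\<^sup>2 \<le> 1 * 1"
      using dual_weight_bounds[of x] by (intro mult_mono) auto
    then show "\<bar>dual_weight x * (dual_tanh x)\<^sup>2\<bar> \<le> 1" using dual_weight_bounds[of x] by simp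
  qed
  have "arc_rate s \<sigma> - arc_rate t \<tau> =
      dual_weight \<sigma> * (P (\<sigma> - s) - P (\<tau> - t)) + P (\<tau> - t) * (dual_weight \<sigma> - dual_weight \<tau>)"
    unfolding arc_rate_def P_def by (rule product_difference)
  also have "\<bar>\<dots>\<bar> \<le> \<bar>dual_weight \<sigma>\<bar> * \<bar>P (\<sigma> - s) - P (\<tau> - t)\<bar> + \<bar>P (\<tau> - t)\<bar> * \<bar>dual_weight \<sigma> - dual_weight \<tau>\<bar>"
    unfolding abs_mult[symmetric] by (rule abs_triangle_ineq)
  also have "\<dots> \<le> 1 * \<bar>P (\<sigma> - s) - P (\<tau> - t)\<bar> + 1 * \<bar>dual_weight \<sigma> - dual_weight \<tau>\<bar>"
    using P[of "\<tau> - t"] dual_weight_bounds[of \<sigma>] by (intro add_mono mult_right_mono) auto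
  also have "\<dots> \<le> (\<bar>s - t\<bar> + \<bar>\<sigma> - \<tau>\<bar>) + \<bar>\<sigma> - \<tau>\<bar>"
  proof -
    have "\<bar>(\<sigma> - s) - (\<tau> - t)\<bar> \<le> \<bar>s - t\<bar> + \<bar>\<sigma> - \<tau>\<bar>" by linarith
    with 1[of "\<sigma> - s" "\<tau> - t"] have "\<bar>P (\<sigma> - s) - P (\<tau> - t)\<bar> \<le> \<bar>s - t\<bar> + \<bar>\<sigma> - \<tau>\<bar>"
      unfolding mult_1 by (rule order_trans)
    from add_mono[OF this 2] show ?thesis unfolding mult_1 .
  qed
  also have "\<dots> \<le> 2 * (\<bar>s - t\<bar> + \<bar>\<sigma> - \<tau>\<bar>)" by simp
  finally show ?thesis .
qed

lemma arc_tail_lipschitz: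
  "\<bar>arc_tail s (dual_tanh \<sigma>) - arc_tail t (dual_tanh \<tau>)\<bar> \<le> \<bar>s - t\<bar> + \<bar>\<sigma> - \<tau>\<bar>"
proof -
  have "\<bar>arc_tail t (dual_tanh \<sigma>) - arc_tail t (dual_tanh \<tau>)\<bar> \<le> 1 * \<bar>\<sigma> - \<tau>\<bar>"
  proof (rule lipschitz_if_derivative_bounded[OF arc_tail_dual_has_derivative_weight])
    fix x
    have "(dual_tanh x)\<^sup>2 \<le> 1" using dual_tanh_bounds[of x] by (simp add: abs_square_le_1)
    then have "(dual_tanh x)\<^sup>2 * arc_rate t x \<le> 1 * 1"
      using arc_rate_bounds[of t x] by (intro mult_mono) auto
    then show "\<bar>- (dual_tanh x)\<^sup>2 * arc_rate t x\<bar> \<le> 1" using arc_rate_bounds[of t x] by (simp add: abs_mult)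
  qed
  moreover have "\<bar>arc_tail s (dual_tanh \<sigma>) - arc_tail t (dual_tanh \<sigma>)\<bar> \<le> \<bar>s - t\<bar>"
    by (rule arc_tail_lipschitz_curvature[OF dual_tanh_bounds])
  moreover note abs_diff_triangle[of "arc_tail s (dual_tanh \<sigma>)" "arc_tail t (dual_tanh \<tau>)"
      "arc_tail t (dual_tanh \<sigma>)"]
  ultimately show ?thesis unfolding mult_1 by (meson add_mono order_trans)
qed

lemma arc_total_lipschitz:
  "\<bar>arc_total s (dual_tanh \<sigma>) - arc_total t (dual_tanh \<tau>)\<bar> \<le> 2 * (\<bar>s - t\<bar> + \<bar>\<sigma> - \<tau>\<bar>)"
proof -
  have "\<bar>arc_total t (dual_tanh \<sigma>) - arc_total t (dual_tanh \<tau>)\<bar> \<le> 1 * \<bar>\<sigma> - \<tau>\<bar>"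
    using arc_rate_bounds
    by (intro lipschitz_if_derivative_bounded[OF arc_total_dual_has_derivative_weight]) (simp add: abs_le_iff)
  moreover have "\<bar>arc_total s (dual_tanh \<sigma>) - arc_total t (dual_tanh \<sigma>)\<bar> \<le> 2 * \<bar>s - t\<bar>"
  proof (rule lipschitz_if_derivative_bounded)
    fix x
    show "((\<lambda>x. arc_total x (dual_tanh \<sigma>)) has_real_derivative
        arc_rate x \<sigma> + arc_tail x (dual_tanh \<sigma>)) (at x)"
      using arc_total_dual_has_derivative[of "\<lambda>_. \<sigma>" 0 x] by simp
    show "\<bar>arc_rate x \<sigma> + arc_tail x (dual_tanh \<sigma>)\<bar> \<le> 2"
      using arc_rate_bounds[of x \<sigma>] arc_tail_bounds[OF dual_tanh_bounds, of x \<sigma>] by simp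
  qed
  moreover note abs_diff_triangle[of "arc_total s (dual_tanh \<sigma>)" "arc_total t (dual_tanh \<tau>)"
      "arc_total t (dual_tanh \<sigma>)"]
  ultimately show ?thesis unfolding distrib_left mult_1
    using abs_ge_zero[of "\<sigma> - \<tau>"] by linarith
qed

text \<open>The logarithm of \<open>1 / sinh r\<close>, for the dual circle of a triangle with curvatures \<open>exp x\<close>, \<open>exp y\<close>,
  \<open>exp z\<close>.\<close>

definition log_scale :: "real \<Rightarrow> real \<Rightarrow> real \<Rightarrow> real" where
  "log_scale x y z = ln (exp (x + y) + exp (x + z) + exp (y + z)) / 2"

lemma log_scale_commute: "log_scale x y z = log_scale x z y" "log_scale x y z = log_scale y x z"
  by (simp_all add: log_scale_def add_ac)

lemma exp_log_scale: "exp (2 * log_scale x y z) = exp (x + y) + exp (x + z) + exp (y + z)"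
proof -
  have "exp (x + y) + exp (x + z) + exp (y + z) > 0" by (intro add_pos_pos exp_gt_zero)
  then show ?thesis by (simp add: log_scale_def)
qed

lemma log_scale_ge: "y + z - 2 * log_scale x y z \<le> 0"
proof -
  have "exp (y + z) \<le> exp (2 * log_scale x y z)" unfolding exp_log_scale by (simp add: add_nonneg_nonneg)
  then show ?thesis by simp
qed

lemma log_scale_has_derivative:
  "((\<lambda>x. log_scale x y z) has_real_derivative (1 - exp (y + z - 2 * log_scale x y z)) / 2) (at x)"
proof -
  define S where "S = exp (x + y) + exp (x + z) + exp (y + z)"
  have S: "S > 0" unfolding S_def by (intro add_pos_pos exp_gt_zero)
  have "((\<lambda>x. log_scale x y z) has_real_derivative (exp (x + y) + exp (x + z)) / S / 2) (at x)"
  proof -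
    have "((\<lambda>x. exp (x + y) + exp (x + z) + exp (y + z)) has_real_derivative exp (x + y) + exp (x + z)) (at x)"
      by (auto intro!: derivative_eq_intros)
    from DERIV_cdivide[OF DERIV_chain2[OF DERIV_ln_divide[OF S, unfolded S_def] this], of 2]
    show ?thesis unfolding log_scale_def S_def by simp
  qed
  moreover have "exp (y + z - 2 * log_scale x y z) = exp (y + z) / S"
    by (simp add: exp_diff exp_log_scale S_def)
  then have "(1 - exp (y + z - 2 * log_scale x y z)) / 2 = (exp (x + y) + exp (x + z)) / S / 2"
    using S by (simp add: field_simps) (simp add: S_def)
  ultimately show ?thesis by (simp only:)
qed

text \<open>If \<open>d\<close> is the sum of the changes of the arguments, then each of the three exponentials changes by a
  factor of at most \<open>exp d\<close>, and so does their sum.\<close>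

lemma log_scale_lipschitz:
  "\<bar>log_scale x y z - log_scale x' y' z'\<bar> \<le> \<bar>x - x'\<bar> + \<bar>y - y'\<bar> + \<bar>z - z'\<bar>"
proof -
  define d where "d = \<bar>x - x'\<bar> + \<bar>y - y'\<bar> + \<bar>z - z'\<bar>"
  have d0: "d \<ge> 0" by (simp add: d_def)
  have le: "log_scale a b c \<le> log_scale a' b' c' + d"
    if "\<bar>a - a'\<bar> + \<bar>b - b'\<bar> + \<bar>c - c'\<bar> = d" for a b c a' b' c'
  proof -
    have "exp (2 * log_scale a b c) \<le> exp d * exp (a' + b') + exp d * exp (a' + c') + exp d * exp (b' + c')"
      unfolding exp_log_scale exp_add[symmetric] using that by (intro add_mono) (simp_all add: abs_if split: if_splits)
    also have "\<dots> = exp (d + 2 * log_scale a' b' c')"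
      by (simp add: exp_add[of d] exp_log_scale distrib_left)
    finally show ?thesis using d0 by simp
  qed
  have "log_scale x y z \<le> log_scale x' y' z' + d" by (rule le) (simp add: d_def)
  moreover have "log_scale x' y' z' \<le> log_scale x y z + d" by (rule le) (simp add: d_def abs_minus_commute)
  ultimately show ?thesis unfolding d_def by linarith
qed

lemma exp_lipschitz_nonpos:
  fixes x y :: real
  assumes "x \<le> 0" "y \<le> 0"
  shows "\<bar>exp x - exp y\<bar> \<le> \<bar>x - y\<bar>"
  using assms
proof (induction x y rule: linorder_wlog)
  case (le x y)
  have "exp y * (1 + (x - y)) \<le> exp y * exp (x - y)" by (intro mult_left_mono exp_ge_add_one_self) simp
  then have "exp y - exp x \<le> exp y * (y - x)" by (simp add: algebra_simps flip: exp_add)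
  also have "\<dots> \<le> 1 * (y - x)" using le by (intro mult_right_mono) auto
  finally show ?case using le by simp
qed (simp add: abs_minus_commute)

text \<open>Functions on an arbitrary type carry no metric, and only finitely many of their values matter here.
  So distances are sums over the finite set \<open>I\<close> of indices.\<close>

definition l1_lipschitz :: "'a set \<Rightarrow> (('a \<Rightarrow> real) \<Rightarrow> real) \<Rightarrow> bool" where
  "l1_lipschitz I f \<longleftrightarrow> (\<exists>C\<ge>0. \<forall>x y. \<bar>f x - f y\<bar> \<le> C * (\<Sum>i\<in>I. \<bar>x i - y i\<bar>))"

text \<open>Bounded Lipschitz functions, unlike Lipschitz functions, are closed under products.\<close>

definition bounded_lipschitz :: "'a set \<Rightarrow> (('a \<Rightarrow> real) \<Rightarrow> real) \<Rightarrow> bool" where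
  "bounded_lipschitz I f \<longleftrightarrow> l1_lipschitz I f \<and> (\<exists>C. \<forall>x. \<bar>f x\<bar> \<le> C)"

lemma l1_lipschitz_const: "l1_lipschitz I (\<lambda>x. c)"
  unfolding l1_lipschitz_def by (rule exI[of _ 0]) simp

lemma l1_lipschitz_coordinate:
  assumes "finite I" "i \<in> I"
  shows "l1_lipschitz I (\<lambda>x. x i)"
  unfolding l1_lipschitz_def
proof (intro exI[of _ 1] conjI allI)
  fix x y :: "'a \<Rightarrow> real"
  show "\<bar>x i - y i\<bar> \<le> 1 * (\<Sum>i\<in>I. \<bar>x i - y i\<bar>)"
    using member_le_sum[OF assms(2), of "\<lambda>i. \<bar>x i - y i\<bar>"] assms(1) by simp
qed simp

lemma l1_lipschitz_compose3:
  assumes "l1_lipschitz I f" "l1_lipschitz I g" "l1_lipschitz I h" and K: "K \<ge> 0"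
    and \<phi>: "\<And>x y. \<bar>\<phi> x - \<phi> y\<bar> \<le> K * (\<bar>f x - f y\<bar> + \<bar>g x - g y\<bar> + \<bar>h x - h y\<bar>)"
  shows "l1_lipschitz I \<phi>"
proof -
  obtain A B C where A: "A \<ge> 0" "\<And>x y. \<bar>f x - f y\<bar> \<le> A * (\<Sum>i\<in>I. \<bar>x i - y i\<bar>)"
    and B: "B \<ge> 0" "\<And>x y. \<bar>g x - g y\<bar> \<le> B * (\<Sum>i\<in>I. \<bar>x i - y i\<bar>)"
    and C: "C \<ge> 0" "\<And>x y. \<bar>h x - h y\<bar> \<le> C * (\<Sum>i\<in>I. \<bar>x i - y i\<bar>)"
    using assms(1-3) unfolding l1_lipschitz_def by blast
  have "\<bar>\<phi> x - \<phi> y\<bar> \<le> (K * (A + B + C)) * (\<Sum>i\<in>I. \<bar>x i - y i\<bar>)" for x y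
  proof -
    let ?d = "\<Sum>i\<in>I. \<bar>x i - y i\<bar>"
    have "\<bar>f x - f y\<bar> + \<bar>g x - g y\<bar> + \<bar>h x - h y\<bar> \<le> A * ?d + B * ?d + C * ?d"
      by (intro add_mono A B C)
    from order_trans[OF \<phi> mult_left_mono[OF this K]] show ?thesis by (simp add: algebra_simps)
  qed
  then show ?thesis unfolding l1_lipschitz_def using A(1) B(1) C(1) K
    by (intro exI[of _ "K * (A + B + C)"]) simp
qed

lemma l1_lipschitz_compose2:
  assumes "l1_lipschitz I f" "l1_lipschitz I g" "K \<ge> 0"
    and "\<And>x y. \<bar>\<phi> x - \<phi> y\<bar> \<le> K * (\<bar>f x - f y\<bar> + \<bar>g x - g y\<bar>)"
  shows "l1_lipschitz I \<phi>"
  by (rule l1_lipschitz_compose3[OF assms(1,2) l1_lipschitz_const[of I 0] assms(3)]) (use assms(4) in simp)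

lemma l1_lipschitz_add: "l1_lipschitz I f \<Longrightarrow> l1_lipschitz I g \<Longrightarrow> l1_lipschitz I (\<lambda>x. f x + g x)"
  by (erule l1_lipschitz_compose2[where K = 1]) (auto simp: abs_if)

lemma l1_lipschitz_diff: "l1_lipschitz I f \<Longrightarrow> l1_lipschitz I g \<Longrightarrow> l1_lipschitz I (\<lambda>x. f x - g x)"
  by (erule l1_lipschitz_compose2[where K = 1]) (auto simp: abs_if)

lemma bounded_lipschitz_const: "bounded_lipschitz I (\<lambda>x. c)"
  by (auto simp: bounded_lipschitz_def l1_lipschitz_const)

lemma bounded_lipschitz_add:
  assumes "bounded_lipschitz I f" "bounded_lipschitz I g"
  shows "bounded_lipschitz I (\<lambda>x. f x + g x)"
proof -
  obtain A B where "\<And>x. \<bar>f x\<bar> \<le> A" "\<And>x. \<bar>g x\<bar> \<le> B" using assms by (auto simp: bounded_lipschitz_def)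
  then have "\<bar>f x + g x\<bar> \<le> A + B" for x by (meson abs_triangle_ineq add_mono order_trans)
  then show ?thesis using assms by (auto simp: bounded_lipschitz_def intro: l1_lipschitz_add)
qed

lemma bounded_lipschitz_mult:
  assumes "bounded_lipschitz I f" "bounded_lipschitz I g"
  shows "bounded_lipschitz I (\<lambda>x. f x * g x)"
proof -
  obtain A B where A: "\<And>x. \<bar>f x\<bar> \<le> A" and B: "\<And>x. \<bar>g x\<bar> \<le> B" using assms by (auto simp: bounded_lipschitz_def)
  have A0: "A \<ge> 0" "B \<ge> 0" using A B by (meson abs_ge_zero order_trans)+
  have "l1_lipschitz I (\<lambda>x. f x * g x)"
  proof (rule l1_lipschitz_compose2[of I f g "A + B"])
    fix x y
    have "f x * g x - f y * g y = f x * (g x - g y) + g y * (f x - f y)" by (rule product_difference)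
    also have "\<bar>\<dots>\<bar> \<le> \<bar>f x\<bar> * \<bar>g x - g y\<bar> + \<bar>g y\<bar> * \<bar>f x - f y\<bar>"
      unfolding abs_mult[symmetric] by (rule abs_triangle_ineq)
    also have "\<dots> \<le> A * \<bar>g x - g y\<bar> + B * \<bar>f x - f y\<bar>"
      by (intro add_mono mult_right_mono A B) auto
    also have "\<dots> \<le> (A + B) * \<bar>g x - g y\<bar> + (A + B) * \<bar>f x - f y\<bar>"
      using A0 by (intro add_mono mult_right_mono) auto
    finally show "\<bar>f x * g x - f y * g y\<bar> \<le> (A + B) * (\<bar>f x - f y\<bar> + \<bar>g x - g y\<bar>)"
      by (simp add: algebra_simps)
  qed (use assms A0 in \<open>auto simp: bounded_lipschitz_def\<close>)
  moreover have "\<bar>f x * g x\<bar> \<le> A * B" for x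
    unfolding abs_mult using A B A0 by (intro mult_mono) auto
  ultimately show ?thesis by (auto simp: bounded_lipschitz_def)
qed

lemma bounded_lipschitz_diff: "bounded_lipschitz I f \<Longrightarrow> bounded_lipschitz I g \<Longrightarrow> bounded_lipschitz I (\<lambda>x. f x - g x)"
  using bounded_lipschitz_add[of I f "\<lambda>x. (-1) * g x"] bounded_lipschitz_mult[OF bounded_lipschitz_const[of I "-1"], of g] by simp

lemma bounded_lipschitz_sum: "(\<And>a. a \<in> A \<Longrightarrow> bounded_lipschitz I (f a)) \<Longrightarrow> bounded_lipschitz I (\<lambda>x. \<Sum>a\<in>A. f a x)"
  by (induction A rule: infinite_finite_induct) (auto simp: bounded_lipschitz_const intro: bounded_lipschitz_add)

lemma bounded_lipschitz_compose2:
  assumes "l1_lipschitz I f" "l1_lipschitz I g" "K \<ge> 0"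
    and "\<And>x y. \<bar>\<phi> x - \<phi> y\<bar> \<le> K * (\<bar>f x - f y\<bar> + \<bar>g x - g y\<bar>)" and "\<And>x. \<bar>\<phi> x\<bar> \<le> C"
  shows "bounded_lipschitz I \<phi>"
  using l1_lipschitz_compose2[OF assms(1-4)] assms(5) by (auto simp: bounded_lipschitz_def)

lemma bounded_lipschitz_exp_nonpos:
  assumes f: "l1_lipschitz I f" and "\<And>x. f x \<le> 0"
  shows "bounded_lipschitz I (\<lambda>x. exp (f x))"
  by (rule bounded_lipschitz_compose2[OF f l1_lipschitz_const[of I 0], where K = 1 and C = 1])
     (use assms exp_lipschitz_nonpos in auto)

section \<open>The combinatorial Calabi flow\<close>

text \<open>The total curvature at a vertex of a triangle, for the logarithmic curvatures \<open>x\<close> at this vertex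
  and \<open>y\<close>, \<open>z\<close> at the other two.\<close>

definition log_vertex_curvature :: "real \<Rightarrow> real \<Rightarrow> real \<Rightarrow> real" where
  "log_vertex_curvature x y z = arc_total x (dual_tanh (log_scale x y z))"

lemma log_vertex_curvature_commute: "log_vertex_curvature x y z = log_vertex_curvature x z y"
  by (simp add: log_vertex_curvature_def log_scale_commute(1)[of x y z])

lemma triangle_total_curvature_log:
  assumes W: "W = {i, a, b}" "i \<noteq> a" "i \<noteq> b" "a \<noteq> b"
    and k: "k i = exp x" "k a = exp y" "k b = exp z"
  shows "triangle_total_curvature W k i = log_vertex_curvature x y z"
proof -
  have "triangle_total_curvature W k i =
      k i * arc_integral (k i) (1 / sqrt (1 + (k i * k a + k i * k b + k a * k b)))"
    by (rule triangle_total_curvature_eq[OF W]) (simp_all add: k)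
  then show ?thesis
    by (simp add: k log_vertex_curvature_def arc_total_def dual_tanh_def exp_log_scale exp_add)
qed

lemma log_vertex_curvature_has_derivative_own:
  "((\<lambda>x. log_vertex_curvature x y z) has_real_derivative
     arc_rate x (log_scale x y z) * (1 - (1 - exp (y + z - 2 * log_scale x y z)) / 2)
     + arc_tail x (dual_tanh (log_scale x y z))) (at x)"
  unfolding log_vertex_curvature_def
  by (rule arc_total_dual_has_derivative[OF log_scale_has_derivative])

lemma log_vertex_curvature_has_derivative_other:
  "((\<lambda>y. log_vertex_curvature x y z) has_real_derivative
     - arc_rate x (log_scale x y z) * ((1 - exp (x + z - 2 * log_scale x y z)) / 2)) (at y)"
proof -
  have "((\<lambda>y. log_scale x y z) has_real_derivative (1 - exp (x + z - 2 * log_scale x y z)) / 2) (at y)"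
    using log_scale_has_derivative[of x z y] unfolding log_scale_commute(2)[of _ x z] .
  from DERIV_chain2[OF arc_total_dual_has_derivative_weight this] show ?thesis
    unfolding log_vertex_curvature_def .
qed

lemma l1_lipschitz_log_scale:
  "l1_lipschitz I f \<Longrightarrow> l1_lipschitz I g \<Longrightarrow> l1_lipschitz I h \<Longrightarrow> l1_lipschitz I (\<lambda>s. log_scale (f s) (g s) (h s))"
  by (rule l1_lipschitz_compose3[of I f g h 1]) (use log_scale_lipschitz in auto)

lemma bounded_lipschitz_log_vertex_curvature:
  assumes "l1_lipschitz I f" "l1_lipschitz I g" "l1_lipschitz I h"
  shows "bounded_lipschitz I (\<lambda>s. log_vertex_curvature (f s) (g s) (h s))"
  unfolding log_vertex_curvature_def
  by (rule bounded_lipschitz_compose2[OF assms(1) l1_lipschitz_log_scale[OF assms], of 2 _ pi])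
     (use arc_total_lipschitz arc_total_bounds[OF dual_tanh_bounds] in \<open>auto simp: abs_le_iff intro: order_trans[OF _ pi_ge_zero]\<close>)

lemma bounded_lipschitz_arc_rate:
  assumes "l1_lipschitz I f" "l1_lipschitz I g"
  shows "bounded_lipschitz I (\<lambda>s. arc_rate (f s) (g s))"
  by (rule bounded_lipschitz_compose2[OF assms, of 2 _ 1]) (use arc_rate_lipschitz arc_rate_bounds in auto)

lemma bounded_lipschitz_arc_tail:
  assumes "l1_lipschitz I f" "l1_lipschitz I g"
  shows "bounded_lipschitz I (\<lambda>s. arc_tail (f s) (dual_tanh (g s)))"
  by (rule bounded_lipschitz_compose2[OF assms, of 1 _ 1])
     (use arc_tail_lipschitz arc_tail_bounds[OF dual_tanh_bounds] in auto)

text \<open>The product \<open>exp (g + h)\<close> is one of the three summands of \<open>exp (2 log_scale)\<close>, so the exponential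
  has a nonpositive argument.\<close>

lemma bounded_lipschitz_log_share:
  assumes "l1_lipschitz I f" "l1_lipschitz I g" "l1_lipschitz I h"
  shows "bounded_lipschitz I (\<lambda>s. (1 - exp (g s + h s - 2 * log_scale (f s) (g s) (h s))) / 2)"
proof -
  have "l1_lipschitz I (\<lambda>s. g s + h s - (log_scale (f s) (g s) (h s) + log_scale (f s) (g s) (h s)))"
    by (intro l1_lipschitz_diff l1_lipschitz_add l1_lipschitz_log_scale assms)
  then have "bounded_lipschitz I (\<lambda>s. exp (g s + h s - 2 * log_scale (f s) (g s) (h s)))"
    using log_scale_ge by (intro bounded_lipschitz_exp_nonpos) simp_all
  from bounded_lipschitz_mult[OF bounded_lipschitz_diff[OF bounded_lipschitz_const[of I 1] this] bounded_lipschitz_const[of I "1/2"]] show ?thesis by simp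
qed

text \<open>A face is an embedded nondegenerate triangle, so its three vertices are distinct.\<close>

lemma face_vertices:
  assumes "face_in S V E f"
  shows "\<exists>a b c. f \<inter> V = {a, b, c} \<and> a \<noteq> b \<and> a \<noteq> c \<and> b \<noteq> c"
proof -
  obtain \<phi> :: "real^2 \<Rightarrow> 'a" and a b c where nc: "\<not> collinear {a, b, c}"
    and emb: "embedding_map (top_of_set (convex hull {a, b, c})) S \<phi>"
    and fV: "f \<inter> V = {\<phi> a, \<phi> b, \<phi> c}"
    using assms unfolding face_in_def by blast
  have inj: "inj_on \<phi> (convex hull {a, b, c})"
    using emb by (simp add: embedding_map_def homeomorphic_eq_everything_map)
  have mem: "a \<in> convex hull {a, b, c}" "b \<in> convex hull {a, b, c}" "c \<in> convex hull {a, b, c}"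
    by (simp_all add: hull_inc)
  have "a \<noteq> b" "a \<noteq> c" "b \<noteq> c" using nc by (auto simp: insert_commute)
  then have "\<phi> a \<noteq> \<phi> b" "\<phi> a \<noteq> \<phi> c" "\<phi> b \<noteq> \<phi> c"
    using inj mem by (auto simp: inj_on_eq_iff)
  with fV show ?thesis by blast
qed

lemma triangle_total_curvature_cong:
  assumes "\<And>v. v \<in> W \<Longrightarrow> k v = k' v" and "i \<in> W"
  shows "triangle_total_curvature W k i = triangle_total_curvature W k' i"
proof -
  have "triangle_packing W k = triangle_packing W k'"
    using assms(1) by (intro ext) (simp add: triangle_packing_def)
  then show ?thesis using assms by (simp add: triangle_total_curvature_def)
qed

lemma interior_total_curvature_cong:
  assumes "\<And>v. v \<in> V - B \<Longrightarrow> k v = k' v"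
  shows "interior_total_curvature V F B khat k i = interior_total_curvature V F B khat k' i"
  unfolding interior_total_curvature_def total_curvature_def
  by (rule sum.cong[OF refl], rule triangle_total_curvature_cong) (use assms in auto)

context
  fixes V B :: "'a set" and khat :: "'a \<Rightarrow> real"
  assumes V: "finite V" and khat: "\<And>v. v \<in> V \<inter> B \<Longrightarrow> khat v > 0"
begin

definition log_curvature :: "('a \<Rightarrow> real) \<Rightarrow> 'a \<Rightarrow> real" where
  "log_curvature s v = (if v \<in> B then ln (khat v) else s v)"

lemma exp_log_curvature:
  "v \<in> V \<Longrightarrow> (if v \<in> B then khat v else exp (s v)) = exp (log_curvature s v)"
  using khat by (simp add: log_curvature_def)

lemma l1_lipschitz_log_curvature: "v \<in> V \<Longrightarrow> l1_lipschitz (V - B) (\<lambda>s. log_curvature s v)"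
  using V by (cases "v \<in> B") (auto simp: log_curvature_def l1_lipschitz_const intro: l1_lipschitz_coordinate)

text \<open>With respect to the logarithm of an interior curvature, the partial derivative is one of the two
  formulas above or zero, according as the vertex is \<open>i\<close> itself, another vertex of the triangle or
  none of its vertices. In each case it is made of bounded Lipschitz functions.\<close>

lemma triangle_curvature_partials:
  assumes W: "W \<subseteq> V" "i \<in> W" "W = {a', b', c'}" "a' \<noteq> b'" "a' \<noteq> c'" "b' \<noteq> c'"
  defines "T \<equiv> \<lambda>s. triangle_total_curvature W (\<lambda>v. if v \<in> B then khat v else exp (s v)) i"
  shows "bounded_lipschitz (V - B) T"
    and "j \<in> V - B \<Longrightarrow> \<exists>G. bounded_lipschitz (V - B) G \<and> (\<forall>s. ((\<lambda>t. T (s(j := t))) has_real_derivative G s) (at (s j)))"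
proof -
  obtain a b where ab: "W = {i, a, b}" "i \<noteq> a" "i \<noteq> b" "a \<noteq> b"
    using W(2-6) by auto
  define l where "l = log_curvature"
  have T: "T s = log_vertex_curvature (l s i) (l s a) (l s b)" for s
    unfolding T_def l_def using ab W(1)
    by (intro triangle_total_curvature_log[OF ab] exp_log_curvature) auto
  have lip: "l1_lipschitz (V - B) (\<lambda>s. l s i)" "l1_lipschitz (V - B) (\<lambda>s. l s a)" "l1_lipschitz (V - B) (\<lambda>s. l s b)"
    unfolding l_def using ab W(1) by (auto intro: l1_lipschitz_log_curvature)
  show "bounded_lipschitz (V - B) T" unfolding T[abs_def] by (rule bounded_lipschitz_log_vertex_curvature[OF lip])
  assume j: "j \<in> V - B"
  have upd: "l (s(j := t)) v = (if v = j then t else l s v)" for s t v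
    using j by (simp add: l_def log_curvature_def)
  have own: "l s j = s j" for s using j by (simp add: l_def log_curvature_def)
  have tame_other: "bounded_lipschitz (V - B) (\<lambda>s. - arc_rate (x s) (log_scale (x s) (y s) (z s))
      * ((1 - exp (x s + z s - 2 * log_scale (x s) (y s) (z s))) / 2))"
    if "l1_lipschitz (V - B) x" "l1_lipschitz (V - B) y" "l1_lipschitz (V - B) z" for x y z
  proof -
    have "bounded_lipschitz (V - B) (\<lambda>s. (1 - exp (x s + z s - 2 * log_scale (y s) (x s) (z s))) / 2)"
      by (rule bounded_lipschitz_log_share[OF that(2,1,3)])
    then have "bounded_lipschitz (V - B) (\<lambda>s. (1 - exp (x s + z s - 2 * log_scale (x s) (y s) (z s))) / 2)"
      by (simp add: log_scale_commute(2))
    from bounded_lipschitz_mult[OF bounded_lipschitz_const[of _ "-1"] bounded_lipschitz_mult[OF bounded_lipschitz_arc_rate[OF that(1) l1_lipschitz_log_scale[OF that]] this]]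
    show ?thesis by simp
  qed
  consider "j = i" | "j = a" | "j = b" | "j \<notin> W" using ab by auto
  then show "\<exists>G. bounded_lipschitz (V - B) G \<and> (\<forall>s. ((\<lambda>t. T (s(j := t))) has_real_derivative G s) (at (s j)))"
  proof cases
    case 1
    let ?G = "\<lambda>s. arc_rate (l s i) (log_scale (l s i) (l s a) (l s b))
        * (1 - (1 - exp (l s a + l s b - 2 * log_scale (l s i) (l s a) (l s b))) / 2)
        + arc_tail (l s i) (dual_tanh (log_scale (l s i) (l s a) (l s b)))"
    have "bounded_lipschitz (V - B) ?G"
      by (intro bounded_lipschitz_add bounded_lipschitz_mult bounded_lipschitz_diff bounded_lipschitz_const bounded_lipschitz_arc_rate bounded_lipschitz_arc_tail bounded_lipschitz_log_share
          l1_lipschitz_log_scale lip)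
    moreover have "((\<lambda>t. T (s(j := t))) has_real_derivative ?G s) (at (s j))" for s
      using log_vertex_curvature_has_derivative_own[of "l s a" "l s b" "s i"] ab own[of s, unfolded 1]
      by (simp add: T upd[unfolded 1] 1)
    ultimately show ?thesis by blast
  next
    case 2
    let ?G = "\<lambda>s. - arc_rate (l s i) (log_scale (l s i) (l s a) (l s b))
      * ((1 - exp (l s i + l s b - 2 * log_scale (l s i) (l s a) (l s b))) / 2)"
    have "bounded_lipschitz (V - B) ?G" by (rule tame_other[OF lip])
    moreover have "((\<lambda>t. T (s(j := t))) has_real_derivative ?G s) (at (s j))" for s
      using log_vertex_curvature_has_derivative_other[of "l s i" "l s b" "s a"] ab own[of s, unfolded 2]
      by (simp add: T upd[unfolded 2] 2)
    ultimately show ?thesis by blast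
  next
    case 3
    let ?G = "\<lambda>s. - arc_rate (l s i) (log_scale (l s i) (l s b) (l s a))
      * ((1 - exp (l s i + l s a - 2 * log_scale (l s i) (l s b) (l s a))) / 2)"
    have "bounded_lipschitz (V - B) ?G" by (rule tame_other[OF lip(1,3,2)])
    moreover have "((\<lambda>t. T (s(j := t))) has_real_derivative ?G s) (at (s j))" for s
      using log_vertex_curvature_has_derivative_other[of "l s i" "l s a" "s b"] ab own[of s, unfolded 3]
      by (simp add: T upd[unfolded 3] log_vertex_curvature_commute[of _ "l s a"] 3)
    ultimately show ?thesis by blast
  next
    case 4
    then have "(\<lambda>t. T (s(j := t))) = (\<lambda>t. T s)" for s using ab by (auto simp: T upd)
    then show ?thesis by (intro exI[of _ "\<lambda>s. 0"]) (auto simp: bounded_lipschitz_const)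
  qed
qed

end

lemma interior_total_curvature_partials:
  fixes V B :: "'a set" and F :: "'a set set" and khat :: "'a \<Rightarrow> real"
  assumes "finite V" and F: "finite F" and khat: "\<And>v. v \<in> V \<inter> B \<Longrightarrow> khat v > 0"
    and faces: "\<And>f. f \<in> F \<Longrightarrow> face_in S V E f"
  defines "T \<equiv> \<lambda>s. interior_total_curvature V F B khat (\<lambda>v. exp (s v))"
  shows "bounded_lipschitz (V - B) (\<lambda>s. T s i)"
    and "j \<in> V - B \<Longrightarrow> \<exists>G. bounded_lipschitz (V - B) G \<and> (\<forall>s. ((\<lambda>t. T (s(j := t)) i) has_real_derivative G s) (at (s j)))"
proof -
  let ?Fi = "{f \<in> F. i \<in> f \<inter> V}"
  define Tf where "Tf = (\<lambda>f s. triangle_total_curvature (f \<inter> V) (\<lambda>v. if v \<in> B then khat v else exp (s v)) i)"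
  have T: "T s i = (\<Sum>f\<in>?Fi. Tf f s)" for s
    by (simp add: T_def Tf_def interior_total_curvature_def total_curvature_def)
  have smooth: "bounded_lipschitz (V - B) (Tf f)"
    "j \<in> V - B \<Longrightarrow> \<exists>G. bounded_lipschitz (V - B) G \<and> (\<forall>s. ((\<lambda>t. Tf f (s(j := t))) has_real_derivative G s) (at (s j)))"
    if f: "f \<in> ?Fi" for f
  proof -
    obtain a b c where abc: "f \<inter> V = {a, b, c}" "a \<noteq> b" "a \<noteq> c" "b \<noteq> c"
      using face_vertices[OF faces, of f] f by auto
    have sub: "f \<inter> V \<subseteq> V" "i \<in> f \<inter> V" using f by auto
    note * = triangle_curvature_partials[OF assms(1) khat sub abc]
    show "bounded_lipschitz (V - B) (Tf f)" unfolding Tf_def by (rule *(1))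
    show "j \<in> V - B \<Longrightarrow> \<exists>G. bounded_lipschitz (V - B) G \<and> (\<forall>s. ((\<lambda>t. Tf f (s(j := t))) has_real_derivative G s) (at (s j)))"
      unfolding Tf_def by (rule *(2))
  qed
  show "bounded_lipschitz (V - B) (\<lambda>s. T s i)" unfolding T by (intro bounded_lipschitz_sum smooth)
  assume j: "j \<in> V - B"
  have "\<forall>f\<in>?Fi. \<exists>G. bounded_lipschitz (V - B) G \<and> (\<forall>s. ((\<lambda>t. Tf f (s(j := t))) has_real_derivative G s) (at (s j)))"
    by (rule ballI, rule smooth(2)[OF _ j])
  from bchoice[OF this] obtain G where G': "\<forall>f\<in>?Fi. bounded_lipschitz (V - B) (G f) \<and>
      (\<forall>s. ((\<lambda>t. Tf f (s(j := t))) has_real_derivative G f s) (at (s j)))" by blast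
  have G: "bounded_lipschitz (V - B) (G f)" "((\<lambda>t. Tf f (s(j := t))) has_real_derivative G f s) (at (s j))"
    if "f \<in> ?Fi" for f s using bspec[OF G' that] by auto
  have "bounded_lipschitz (V - B) (\<lambda>s. \<Sum>f\<in>?Fi. G f s)" by (intro bounded_lipschitz_sum G)
  moreover have "((\<lambda>t. T (s(j := t)) i) has_real_derivative (\<Sum>f\<in>?Fi. G f s)) (at (s j))" for s
    unfolding T by (intro DERIV_sum G)
  ultimately show "\<exists>G. bounded_lipschitz (V - B) G \<and> (\<forall>s. ((\<lambda>t. T (s(j := t)) i) has_real_derivative G s) (at (s j)))"
    by (intro exI[of _ "\<lambda>s. \<Sum>f\<in>?Fi. G f s"]) blast
qed

lemma uniform_lipschitz_constant:
  assumes I: "finite I" and tame: "\<And>i. i \<in> I \<Longrightarrow> bounded_lipschitz I (\<lambda>x. F x i)"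
  shows "\<exists>L\<ge>0. \<forall>i\<in>I. \<forall>x y. \<bar>F x i - F y i\<bar> \<le> L * (\<Sum>j\<in>I. \<bar>x j - y j\<bar>)"
proof -
  have "\<forall>i\<in>I. \<exists>C\<ge>0. \<forall>x y. \<bar>F x i - F y i\<bar> \<le> C * (\<Sum>j\<in>I. \<bar>x j - y j\<bar>)"
    using tame by (simp add: bounded_lipschitz_def l1_lipschitz_def)
  then obtain C where C: "\<And>i. i \<in> I \<Longrightarrow> C i \<ge> 0"
    "\<And>i x y. i \<in> I \<Longrightarrow> \<bar>F x i - F y i\<bar> \<le> C i * (\<Sum>j\<in>I. \<bar>x j - y j\<bar>)" by metis
  have "\<bar>F x i - F y i\<bar> \<le> sum C I * (\<Sum>j\<in>I. \<bar>x j - y j\<bar>)" if i: "i \<in> I" for i x y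
  proof -
    have "C i \<le> sum C I" using member_le_sum[OF i, of C] C(1) I by simp
    then have "C i * (\<Sum>j\<in>I. \<bar>x j - y j\<bar>) \<le> sum C I * (\<Sum>j\<in>I. \<bar>x j - y j\<bar>)"
      by (intro mult_right_mono sum_nonneg) auto
    with C(2)[OF i, of x y] show ?thesis by (rule order_trans)
  qed
  moreover have "sum C I \<ge> 0" using C(1) by (intro sum_nonneg)
  ultimately show ?thesis by blast
qed

theorem theorem1p3:
  fixes S :: "'a topology" and B V :: "'a set" and E F :: "'a set set" and g n :: nat
    and khat That k0 :: "'a \<Rightarrow> real"
  assumes "n \<ge> 1" and "surface_with_holes g n S B"
    and "surface_triangulation S V E F"
    and "card (V \<inter> B) \<ge> 2" and "\<And>f. f \<in> F \<Longrightarrow> card (f \<inter> V \<inter> B) \<le> 2"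
    and "\<And>v. v \<in> V \<inter> B \<Longrightarrow> khat v > 0"
    and "That \<in> admissible_curvatures V F B"
    and "\<And>v. v \<in> V - B \<Longrightarrow> k0 v > 0"
  shows "\<exists>k. calabi_flow_on V F B khat That {0..} k \<and> (\<forall>v\<in>V - B. k 0 v = k0 v) \<and>
    (\<forall>J k'. is_interval J \<and> 0 \<in> J \<and> J \<subseteq> {0..} \<and>
        calabi_flow_on V F B khat That J k' \<and> (\<forall>v\<in>V - B. k' 0 v = k0 v) \<longrightarrow>
      (\<forall>t\<in>J. \<forall>v\<in>V - B. k' t v = k t v))"
proof -
  let ?I = "V - B"
  have fin: "finite V" "finite F" and faces: "\<And>f. f \<in> F \<Longrightarrow> face_in S V E f"
    using assms(3) by (auto simp: surface_triangulation_def)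
  define T where "T = (\<lambda>s. interior_total_curvature V F B khat (\<lambda>v. exp (s v)))"
  note T_smooth = interior_total_curvature_partials[OF fin assms(6) faces]
  have T_tame: "bounded_lipschitz ?I (\<lambda>s. T s i)" for i
    unfolding T_def by (rule T_smooth(1))
  have T_deriv: "\<exists>G. bounded_lipschitz ?I G \<and> (\<forall>s. ((\<lambda>t. T (s(j := t)) i) has_real_derivative G s) (at (s j)))"
    if "j \<in> ?I" for i j
    unfolding T_def by (rule T_smooth(2)[OF _ _ that])
  have "\<exists>M. \<forall>j\<in>?I. bounded_lipschitz ?I (M j) \<and> (\<forall>s. ((\<lambda>t. T (s(j := t)) i) has_real_derivative M j s) (at (s j)))" for i
    by (intro bchoice ballI T_deriv)
  then obtain M where M': "\<And>i. \<forall>j\<in>?I. bounded_lipschitz ?I (M i j) \<and>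
      (\<forall>s. ((\<lambda>t. T (s(j := t)) i) has_real_derivative M i j s) (at (s j)))" by metis
  have M: "bounded_lipschitz ?I (M i j)" "((\<lambda>t. T (s(j := t)) i) has_real_derivative M i j s) (at (s j))"
    if "j \<in> ?I" for i j s using bspec[OF M' that, of i] by auto
  \<comment> \<open>the field \<open>- M' (T - That)\<close> of the flow in the coordinates \<open>s = ln k\<close>\<close>
  define \<Phi> where "\<Phi> = (\<lambda>s i. \<Sum>j\<in>?I. M j i s * (That j - T s j))"
  have "bounded_lipschitz ?I (\<lambda>s. \<Phi> s i)" if "i \<in> ?I" for i
    unfolding \<Phi>_def using that by (intro bounded_lipschitz_sum bounded_lipschitz_mult bounded_lipschitz_diff bounded_lipschitz_const M T_tame)
  with uniform_lipschitz_constant[of ?I \<Phi>] fin obtain L where L: "L \<ge> 0"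
    and lip: "\<And>i x y. i \<in> ?I \<Longrightarrow> \<bar>\<Phi> x i - \<Phi> y i\<bar> \<le> L * (\<Sum>j\<in>?I. \<bar>x j - y j\<bar>)" by auto
  have field: "- k i * (\<Sum>j\<in>?I. curvature_jacobian V F B khat k j i *
      (interior_total_curvature V F B khat k j - That j)) = k i * \<Phi> s i"
    if i: "i \<in> ?I" and k: "\<And>v. v \<in> ?I \<Longrightarrow> k v = exp (s v)" for k s i
  proof -
    have "curvature_jacobian V F B khat k j i = M j i s" for j
    proof -
      have "interior_total_curvature V F B khat (k(i := exp t)) j = T (s(i := t)) j" for t
        unfolding T_def by (rule interior_total_curvature_cong) (simp add: k)
      then have "curvature_jacobian V F B khat k j i = deriv (\<lambda>t. T (s(i := t)) j) (s i)"
        using k[OF i] by (simp add: curvature_jacobian_def)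
      also have "\<dots> = M j i s" by (rule DERIV_imp_deriv[OF M(2)[OF i]])
      finally show ?thesis .
    qed
    moreover have "interior_total_curvature V F B khat k j = T s j" for j
      unfolding T_def by (rule interior_total_curvature_cong) (simp add: k)
    ultimately show ?thesis
      by (simp add: \<Phi>_def sum_distrib_left flip: sum_negf) (simp add: algebra_simps)
  qed
  have fI: "finite ?I" using fin by simp
  obtain \<sigma> where s0: "\<And>i. i \<in> ?I \<Longrightarrow> \<sigma> 0 i = ln (k0 i)"
    and ds: "\<And>t i. t \<ge> 0 \<Longrightarrow> i \<in> ?I \<Longrightarrow> ((\<lambda>t. \<sigma> t i) has_real_derivative \<Phi> (\<sigma> t) i) (at t within {0..})"
    using global_solution_exists[where F = \<Phi> and ?x0.0 = "\<lambda>i. ln (k0 i)", OF fI L lip] by blast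
  define k where "k = (\<lambda>t i. exp (\<sigma> t i))"
  have "calabi_flow_on V F B khat That {0..} k"
    unfolding calabi_flow_on_def
  proof (intro ballI conjI)
    fix t :: real and i assume t: "t \<in> {0..}" and i: "i \<in> ?I"
    show "k t i > 0" by (simp add: k_def)
    have "((\<lambda>t. k t i) has_real_derivative k t i * \<Phi> (\<sigma> t) i) (at t within {0..})"
      unfolding k_def using DERIV_chain2[OF DERIV_exp ds[of t i]] t i by (simp add: mult.commute)
    then show "((\<lambda>t. k t i) has_real_derivative - k t i * (\<Sum>j\<in>?I. curvature_jacobian V F B khat (k t) j i *
      (interior_total_curvature V F B khat (k t) j - That j))) (at t within {0..})"
      by (subst field[OF i, of "k t" "\<sigma> t"]) (simp_all add: k_def)
  qed
  moreover have "\<forall>v\<in>?I. k 0 v = k0 v" using s0 assms(8) by (simp add: k_def)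
  moreover have "k' t v = k t v"
    if J: "is_interval J" "0 \<in> J" "J \<subseteq> {0..}" and flow: "calabi_flow_on V F B khat That J k'"
      and init: "\<forall>v\<in>?I. k' 0 v = k0 v" and t: "t \<in> J" and v: "v \<in> ?I" for J :: "real set" and k' t v
  proof -
    have "r \<in> J" if "r \<in> {0..t}" for r
      using mem_is_interval_1_I[OF J(1,2) t, of r] that by simp
    then have sub: "{0..t} \<subseteq> J" by (rule subsetI)
    have t0: "t \<ge> 0" using subsetD[OF J(3) t] by simp
    have flowD: "k' r i > 0 \<and> ((\<lambda>r. k' r i) has_real_derivative - k' r i *
        (\<Sum>j\<in>?I. curvature_jacobian V F B khat (k' r) j i *
          (interior_total_curvature V F B khat (k' r) j - That j))) (at r within J)"
      if "r \<in> {0..t}" "i \<in> ?I" for r i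
      using bspec[OF bspec[OF flow[unfolded calabi_flow_on_def] subsetD[OF sub that(1)]] that(2)] .
    have pos: "k' r i > 0" if "r \<in> {0..t}" "i \<in> ?I" for r i
      using flowD[OF that] by simp
    have "((\<lambda>r. ln (k' r i)) has_real_derivative \<Phi> (\<lambda>i. ln (k' r i)) i) (at r within {0..t})"
      if r: "r \<in> {0..t}" and i: "i \<in> ?I" for r i
    proof -
      have "((\<lambda>r. k' r i) has_real_derivative k' r i * \<Phi> (\<lambda>i. ln (k' r i)) i) (at r within J)"
        using conjunct2[OF flowD[OF r i]] by (subst (asm) field[OF i]) (simp_all add: pos[OF r])
      from DERIV_chain2[OF DERIV_ln_divide[OF pos[OF r i]] DERIV_subset[OF this sub]] show ?thesis
        using pos[OF r i] by simp
    qed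
    moreover have "((\<lambda>r. \<sigma> r i) has_real_derivative \<Phi> (\<sigma> r) i) (at r within {0..t})"
      if "r \<in> {0..t}" and "i \<in> ?I" for r i
      using ds[of r i] that by (auto intro: DERIV_subset)
    ultimately have "ln (k' t v) = \<sigma> t v"
      using s0 init t0 v
      by (intro solutions_unique[where F = \<Phi> and T = t and x = "\<lambda>r i. ln (k' r i)" and y = \<sigma> and i = v, OF fI L lip]) auto
    then have "exp (ln (k' t v)) = k t v" by (simp add: k_def)
    then show ?thesis using pos[of t v] v t0 by simp
  qed
  ultimately show ?thesis by blast
qed

end
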